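(* Let $k$ be a field of characteristic different from $2$ and $3$, and let $C\subset\mathbb P^2$ be a smooth plane projective cubic over $k$ having a $k$-rational flex and non-zero modular invariant. Let $\hat C$ be the dual curve of $C$ in the dual projective plane $\hat{\mathbb P}$. Then there are infinitely many rational curves in $\hat{\mathbb P}$ having even intersection with $\hat C$, giving rise to infinitely many inequivalent pseudo-parameterizations of $C$.
   Context: The dual plane $\hat{\mathbb P}$, with coordinates $[U:V:W]$, parametrizes the lines of $\mathbb P^2$: the point $[U:V:W]$ corresponds to the line $UX+VY+WZ=0$. The dual curve $\hat C\subset\hat{\mathbb P}$ is the Zariski closure of the set of points corresponding to tangent lines of $C$; it is a curve of degree $6$. A rational curve is a curve of geometric genus $0$ with a rational point; equivalently, it has a rational parameterization $t\mapsto[U(t):V(t):W(t)]$ with $U(t),V(t),W(t)$ polynomials in $t$. A rational curve $L\subset\hat{\mathbb P}$ has even intersection with $\hat C$ if it meets $\hat C$ with all multiplicities even (counted along the parameterization of $L$). A pseudo-parameterization of $C$ is a parameterization of $C$ by cubic radicals: a non-constant point $P_t=[X(t):Y(t):Z(t)]$ of $C$ whose coordinates are rational fractions in $t$ and $\sqrt[3]{R(t)}$ for some $R(t)\in k(t)$. Two pseudo-parameterizations $t\mapsto P_t$ and $t\mapsto Q_t$ are equivalent if there is a birational fraction $\phi(t)$ such that $Q_t=P_{\phi(t)}$. A rational curve $L$ with parameterization $t\mapsto[U(t):V(t):W(t)]$ corresponds to a one-parameter family of lines $D_t: U(t)X+V(t)Y+W(t)Z=0$ in $\mathbb P^2$.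 The intersection of $D_t$ with $C$ is described by a cubic form whose twisted discriminant (that is, $-3$ times the usual discriminant) is, up to a square, the value at $[U(t):V(t):W(t)]$ of an equation of $\hat C$. The condition that this twisted discriminant be a square in $k(t)$ is interpreted geometrically as $L$ having even intersection with $\hat C$. The Tartaglia-Cardan formulae then give a point $P_t$ of $D_t\cap C$ using only field operations and a cubic root; this is the pseudo-parameterization to which $L$ gives rise. *)

theory Defs
  imports "HOL-Analysis.Analysis" "HOL-Algebra.Algebraic_Closure_Type"
begin

hide_const (open) up_ring.coeff up_ring.monom Polynomials.degree
unbundle no fps_syntax


section \<open>Ternary forms\<close>

text \<open>
  A polynomial in X, Y, Z is an iterated univariate polynomial whose outermost variable is X and
  whose innermost variable is Z.  Points and lines of the projective plane are given by their
  nonzero vectors of homogeneous coordinates, and sets of points by the corresponding cones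
  (without the origin).
\<close>

type_synonym 'a poly3 = "'a poly poly poly"

definition coeff3 :: "'a::zero poly3 \<Rightarrow> nat \<Rightarrow> nat \<Rightarrow> nat \<Rightarrow> 'a" where
  "coeff3 p i j l = coeff (coeff (coeff p i) j) l"

definition form :: "nat \<Rightarrow> 'a::zero poly3 \<Rightarrow> bool" where
  "form n p \<longleftrightarrow> (\<forall>i j l. coeff3 p i j l \<noteq> 0 \<longrightarrow> i + j + l = n)"

text \<open>Evaluation in an algebra over the coefficient ring, with structure map \<open>h\<close>.\<close>

definition eval3 :: "('a::zero \<Rightarrow> 'b::comm_ring_1) \<Rightarrow> 'a poly3 \<Rightarrow> 'b ^ 3 \<Rightarrow> 'b" where
  "eval3 h p v =
     poly (map_poly (\<lambda>q. poly (map_poly (\<lambda>r. poly (map_poly h r) (v $ 3)) q) (v $ 2)) p) (v $ 1)"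

definition gradient :: "('a::field \<Rightarrow> 'b::comm_ring_1) \<Rightarrow> 'a poly3 \<Rightarrow> 'b ^ 3 \<Rightarrow> 'b ^ 3" where
  "gradient h p v = vector
     [eval3 h (pderiv p) v, eval3 h (map_poly pderiv p) v, eval3 h (map_poly (map_poly pderiv) p) v]"


section \<open>Smooth cubics, flexes and the modular invariant\<close>

definition smooth_cubic :: "'k::field poly3 \<Rightarrow> bool" where
  "smooth_cubic F \<longleftrightarrow> form 3 F \<and>
     (\<forall>v :: 'k alg_closure ^ 3. v \<noteq> 0 \<and> eval3 to_ac F v = 0 \<longrightarrow> gradient to_ac F v \<noteq> 0)"

text \<open>
  A rational point at which the tangent line meets the curve with multiplicity at least 3; here
  the tangent line is parameterized by \<open>s \<mapsto> v + s w\<close>.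
\<close>

definition flex :: "'k::field poly3 \<Rightarrow> 'k ^ 3 \<Rightarrow> bool" where
  "flex F v \<longleftrightarrow> v \<noteq> 0 \<and> eval3 id F v = 0 \<and> gradient id F v \<noteq> 0 \<and>
     (\<forall>w. scalar_product (gradient id F v) w = 0 \<longrightarrow>
        [:0, 1:] ^ 3 dvd eval3 (\<lambda>c. [:c:]) F (\<chi> i. [:v $ i, w $ i:]))"

definition const3 :: "'a::zero \<Rightarrow> 'a poly3" where
  "const3 c = [:[:[:c:]:]:]"

definition coords3 :: "('a::comm_ring_1 poly3) ^ 3" where
  "coords3 = vector [[:0, 1:], [:[:0, 1:]:], [:[:[:0, 1:]:]:]]"

definition linear_substitution :: "'a::comm_ring_1 ^ 3 ^ 3 \<Rightarrow> 'a poly3 \<Rightarrow> 'a poly3" where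
  "linear_substitution M p = eval3 const3 p ((\<chi> i j. const3 (M $ i $ j)) *v coords3)"

definition weierstrass_form :: "'a::comm_ring_1 \<Rightarrow> 'a \<Rightarrow> 'a poly3" where
  "weierstrass_form a b =
     (let x = coords3 $ 1; y = coords3 $ 2; z = coords3 $ 3
      in y\<^sup>2 * z - x ^ 3 - const3 a * x * z\<^sup>2 - const3 b * z ^ 3)"

definition weierstrass_model :: "'k::field poly3 \<Rightarrow> 'k \<Rightarrow> 'k \<Rightarrow> bool" where
  "weierstrass_model F a b \<longleftrightarrow> (\<exists>(M :: 'k ^ 3 ^ 3) c. invertible M \<and> c \<noteq> 0 \<and>
     linear_substitution M F = const3 c * weierstrass_form a b)"

text \<open>
  The modular invariant of a smooth cubic with a rational flex, in characteristic different from
  2 and 3.  Such a cubic has a Weierstrass model over the ground field, and the value below does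
  not depend on the chosen model.
\<close>

definition modular_invariant :: "'k::field poly3 \<Rightarrow> 'k" where
  "modular_invariant F = (SOME j. \<exists>a b. weierstrass_model F a b \<and>
     j = 1728 * (4 * a ^ 3) / (4 * a ^ 3 + 27 * b\<^sup>2))"


section \<open>The dual curve\<close>

definition zariski_closure :: "('a::field ^ 3) set \<Rightarrow> ('a ^ 3) set" where
  "zariski_closure S = {v. v \<noteq> 0 \<and>
     (\<forall>n H. form n H \<and> (\<forall>u\<in>S. eval3 id H u = 0) \<longrightarrow> eval3 id H v = 0)}"

definition tangent_lines :: "'k::field poly3 \<Rightarrow> ('k alg_closure ^ 3) set" where
  "tangent_lines F = {gradient to_ac F v | v. v \<noteq> 0 \<and> eval3 to_ac F v = 0}"

definition dual_curve :: "'k::field poly3 \<Rightarrow> ('k alg_closure ^ 3) set" where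
  "dual_curve F = zariski_closure (tangent_lines F)"

text \<open>\<open>G\<close> is a form of degree \<open>n\<close> generating the homogeneous ideal of the plane curve \<open>E\<close>.\<close>

definition curve_equation :: "nat \<Rightarrow> 'a::field poly3 \<Rightarrow> ('a ^ 3) set \<Rightarrow> bool" where
  "curve_equation n G E \<longleftrightarrow> form n G \<and> G \<noteq> 0 \<and>
     (\<forall>m H. form m H \<longrightarrow> ((\<forall>v\<in>E. eval3 id H v = 0) \<longleftrightarrow> G dvd H))"


section \<open>Rational curves with even intersection\<close>

text \<open>
  A parameterization \<open>t \<mapsto> [U(t):V(t):W(t)]\<close> without base points and birational onto its image:
  the last conjunct says that \<open>t\<close> is a rational function, quotient of two forms of the same
  degree, of the point.
\<close>

definition rational_parameterization :: "'k::field poly ^ 3 \<Rightarrow> bool" where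
  "rational_parameterization c \<longleftrightarrow>
     (\<forall>d. (\<forall>i. d dvd c $ i) \<longrightarrow> is_unit d) \<and>
     (\<exists>n A B. form n A \<and> form n B \<and> eval3 (\<lambda>x. [:x:]) B c \<noteq> 0 \<and>
        eval3 (\<lambda>x. [:x:]) A c = [:0, 1:] * eval3 (\<lambda>x. [:x:]) B c)"

definition geometric_param :: "'k::field poly ^ 3 \<Rightarrow> 'k alg_closure poly ^ 3" where
  "geometric_param c = (\<chi> i. map_poly to_ac (c $ i))"

definition parameterized_curve :: "'k::field poly ^ 3 \<Rightarrow> ('k alg_closure ^ 3) set" where
  "parameterized_curve c =
     zariski_closure (range (\<lambda>t. \<chi> i. poly (geometric_param c $ i) t))"

definition param_degree :: "'k::field poly ^ 3 \<Rightarrow> nat" where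
  "param_degree c = Max (range (\<lambda>i. degree (c $ i)))"

text \<open>
  Multiplicities are orders of vanishing of \<open>G(U(t),V(t),W(t))\<close> at the geometric points of the
  projective line.  The last conjunct is the point at infinity, this being a binary form of degree
  \<open>n * param_degree c\<close>.
\<close>

definition even_intersection :: "'k::field poly3 \<Rightarrow> 'k poly ^ 3 \<Rightarrow> bool" where
  "even_intersection F c \<longleftrightarrow> (\<exists>n G. curve_equation n G (dual_curve F) \<and>
     (let g = eval3 (\<lambda>x. [:x:]) G (geometric_param c)
      in g \<noteq> 0 \<and> (\<forall>t. even (Polynomial.order t g)) \<and> even (n * param_degree c - degree g)))"


section \<open>Pseudo-parameterizations\<close>

text \<open>Cube roots of elements of \<open>k(t)\<close> are taken in an algebraic closure of \<open>k(t)\<close>.\<close>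

type_synonym 'k radical = "'k poly fract alg_closure"

definition const_fun :: "'k::field \<Rightarrow> 'k radical" where
  "const_fun x = to_ac (to_fract [:x:])"

definition algebraic_const :: "'k::field radical \<Rightarrow> bool" where
  "algebraic_const x \<longleftrightarrow> (\<exists>p. p \<noteq> 0 \<and> poly (map_poly const_fun p) x = 0)"

definition nonconstant_point :: "'k::field radical ^ 3 \<Rightarrow> bool" where
  "nonconstant_point P \<longleftrightarrow> P \<noteq> 0 \<and>
     \<not> (\<exists>l. l \<noteq> 0 \<and> (\<forall>i. algebraic_const (l * P $ i)))"

text \<open>The rational fractions in \<open>t\<close> and \<open>s\<close>.\<close>

definition rational_fractions :: "'k::field radical \<Rightarrow> 'k radical set" where
  "rational_fractions s =
     {poly (map_poly to_ac p) s / poly (map_poly to_ac q) s | p q. poly (map_poly to_ac q) s \<noteq> 0}"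

definition pseudo_parameterization :: "'k::field poly3 \<Rightarrow> 'k radical ^ 3 \<Rightarrow> bool" where
  "pseudo_parameterization F P \<longleftrightarrow> nonconstant_point P \<and> eval3 const_fun F P = 0 \<and>
     (\<exists>R s. s ^ 3 = to_ac R \<and> (\<forall>i. P $ i \<in> rational_fractions s))"

text \<open>
  Substituting the birational fraction \<open>(a t + b) / (c t + d)\<close> for \<open>t\<close> in a function involving
  radicals means applying a field embedding over \<open>k\<close> which sends \<open>t\<close> to that fraction.  The
  embeddings with this property differ by the determinations of the radicals.
\<close>

definition substitution :: "'k::field poly fract \<Rightarrow> ('k radical \<Rightarrow> 'k radical) \<Rightarrow> bool" where
  "substitution \<phi> \<sigma> \<longleftrightarrow>
     (\<forall>x y. \<sigma> (x + y) = \<sigma> x + \<sigma> y) \<and> (\<forall>x y. \<sigma> (x * y) = \<sigma> x * \<sigma> y) \<and>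
     (\<forall>x. \<sigma> (const_fun x) = const_fun x) \<and> \<sigma> (to_ac (to_fract [:0, 1:])) = to_ac \<phi>"

definition birational_fraction :: "'k::field poly fract \<Rightarrow> bool" where
  "birational_fraction \<phi> \<longleftrightarrow>
     (\<exists>a b c d. a * d - b * c \<noteq> 0 \<and> \<phi> = to_fract [:b, a:] / to_fract [:d, c:])"

definition equivalent_pseudo :: "'k::field radical ^ 3 \<Rightarrow> 'k radical ^ 3 \<Rightarrow> bool" where
  "equivalent_pseudo P Q \<longleftrightarrow> (\<exists>\<phi> \<sigma> l. birational_fraction \<phi> \<and> substitution \<phi> \<sigma> \<and>
     l \<noteq> 0 \<and> (\<forall>i. Q $ i = l * \<sigma> (P $ i)))"


section \<open>The pseudo-parameterization arising from a family of lines\<close>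

definition twisted_discriminant :: "'a::comm_ring_1 poly \<Rightarrow> 'a" where
  "twisted_discriminant f =
     (let a = coeff f 3; b = coeff f 2; c = coeff f 1; d = coeff f 0
      in - 3 * (b\<^sup>2 * c\<^sup>2 - 4 * a * c ^ 3 - 4 * b ^ 3 * d - 27 * a\<^sup>2 * d\<^sup>2 + 18 * a * b * c * d))"

text \<open>
  The Tartaglia-Cardan formula for a root of the cubic polynomial \<open>f\<close> whose twisted discriminant
  is the square of \<open>\<delta>\<close>; here \<open>y\<^sup>3 + p y + q\<close> is the depressed form of \<open>f\<close>, with \<open>x = y - b / (3 a)\<close>.
\<close>

definition cardan_root :: "'a::field poly \<Rightarrow> 'a alg_closure \<Rightarrow> bool" where
  "cardan_root f x \<longleftrightarrow> degree f = 3 \<and>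
     (let a = coeff f 3; b = coeff f 2; c = coeff f 1; d = coeff f 0;
          p = c / a - b\<^sup>2 / (3 * a\<^sup>2);
          q = 2 * b ^ 3 / (27 * a ^ 3) - b * c / (3 * a\<^sup>2) + d / a
      in \<exists>\<delta> s. \<delta>\<^sup>2 = twisted_discriminant f \<and> s \<noteq> 0 \<and>
           s ^ 3 = to_ac (- q / 2 + \<delta> / (18 * a\<^sup>2)) \<and>
           x = s - to_ac (p / 3) / s - to_ac (b / (3 * a)))"

text \<open>
  \<open>A\<close> and \<open>B\<close> span the line \<open>D\<^sub>t\<close> over \<open>k(t)\<close>, and \<open>F(x A + B)\<close> is the dehomogenized cubic form
  describing its intersection with the cubic.
\<close>

definition gives_rise_to :: "'k::field poly3 \<Rightarrow> 'k poly ^ 3 \<Rightarrow> 'k radical ^ 3 \<Rightarrow> bool" where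
  "gives_rise_to F D P \<longleftrightarrow> (\<exists>(A :: 'k poly fract ^ 3) B x l.
     scalar_product (\<chi> i. to_fract (D $ i)) A = 0 \<and>
     scalar_product (\<chi> i. to_fract (D $ i)) B = 0 \<and>
     (\<forall>m n. m *s A + n *s B = 0 \<longrightarrow> m = 0 \<and> n = 0) \<and>
     cardan_root (eval3 (\<lambda>c. [:to_fract [:c:]:]) F (\<chi> i. [:B $ i, A $ i:])) x \<and>
     l \<noteq> 0 \<and> (\<forall>i. P $ i = l * (x * to_ac (A $ i) + to_ac (B $ i))))"

end

theory Submission
  imports Defs
begin

text \<open>
  Put the cubic in the form \<open>y\<^sup>2 = x\<^sup>3 + a x + b\<close> and consider lines \<open>y = t x + \<mu>\<close> over \<open>k(t)\<close>; such a
  family is automatically birational onto its image.  For fixed slope \<open>t\<close> the condition that the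
  twisted discriminant of the intersection is a square defines a curve of genus 1 in \<open>\<mu>\<close>, so the
  plane becomes an elliptic surface over the \<open>t\<close>-line.  The section \<open>p = 0\<close> (where the depressed cubic
  has no linear term) and a section at infinity generate sections of infinite order when
  \<open>a \<noteq> 0\<close>: the triple of the latter has nonsingular reduction at every finite place, so in its
  successive doubles nothing cancels and the set of poles strictly grows, in any characteristic.

  A constant point on such a family would put all lines through one point of the cubic, and the
  discriminant would have four simple roots.  If two of the resulting points were equivalent, the
  point would lie on two lines over \<open>k(t)\<close>; if these differ, it is rational over \<open>k(t)\<close>, which is
  impossible because an elliptic curve has no nonconstant point over a rational function field.
\<close>

unbundle no Formal_Power_Series.fps_syntax

section \<open>Ring morphisms and evaluation of forms\<close>

text \<open>Write a root of X^3 + p X + q as s + s' with s s' = -p/3. Then m = s^3 gives s'^3 = -(m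
  + q), hence p^3 = 27 m (m + q); this is the origin of that equation, and 18 m + 9 q is the square
  root of the twisted discriminant 81 q^2 + 12 p^3. For fixed t it is a plane cubic in (p, m),
  because q is quadratic in p. Its flex p = m = 0, with tangent m = 0, serves as zero. The line p =
  0 meets it again in S = (0, -q) and in a point at infinity, which is therefore -S. The fibre
  degenerates where t is the slope of one of the eight affine flex tangents; there S passes through
  the node of a fibre with three components, which is why the triple of S is needed to get
  nonsingular reduction. Doubling then suffices, and no height function enters. A second obstacle:
  even intersection refers to a generator of the ideal of the dual curve. It is not enough that the
  sextic vanishes on all tangents; it must divide every form that does. This is obtained by
  exhibiting six distinct tangents in a general pencil.\<close>

definition ring_morphism :: "('a::comm_ring_1 \<Rightarrow> 'b::comm_ring_1) \<Rightarrow> bool" where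
  "ring_morphism h \<longleftrightarrow> h 1 = 1 \<and> (\<forall>x y. h (x + y) = h x + h y) \<and> (\<forall>x y. h (x * y) = h x * h y)"

lemma ring_morphismI:
  assumes "h 1 = 1" "\<And>x y. h (x + y) = h x + h y" "\<And>x y. h (x * y) = h x * h y"
  shows "ring_morphism h"
  using assms by (simp add: ring_morphism_def)

lemma ring_morphism_1: "ring_morphism h \<Longrightarrow> h 1 = 1"
  and ring_morphism_add: "ring_morphism h \<Longrightarrow> h (x + y) = h x + h y"
  and ring_morphism_mult: "ring_morphism h \<Longrightarrow> h (x * y) = h x * h y"
  by (simp_all add: ring_morphism_def)

lemma ring_morphism_0: "ring_morphism h \<Longrightarrow> h 0 = 0"
  using ring_morphism_add[of h 0 0] by simp

lemma ring_morphism_minus: "ring_morphism h \<Longrightarrow> h (- x) = - h x"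
  using ring_morphism_add[of h x "- x"] ring_morphism_0[of h] by (simp add: eq_neg_iff_add_eq_0 add.commute)

lemma ring_morphism_diff: "ring_morphism h \<Longrightarrow> h (x - y) = h x - h y"
  using ring_morphism_add[of h x "- y"] ring_morphism_minus[of h y] by simp

lemma ring_morphism_power: "ring_morphism h \<Longrightarrow> h (x ^ n) = h x ^ n"
  by (induction n) (simp_all add: ring_morphism_1 ring_morphism_mult)

lemma ring_morphism_of_nat: "ring_morphism h \<Longrightarrow> h (of_nat n) = of_nat n"
  by (induction n) (simp_all add: ring_morphism_1 ring_morphism_0 ring_morphism_add)

lemma ring_morphism_numeral: "ring_morphism h \<Longrightarrow> h (numeral n) = numeral n"
  using ring_morphism_of_nat[of h "numeral n"] by simp

lemma ring_morphism_sum: "ring_morphism h \<Longrightarrow> h (sum f A) = (\<Sum>x\<in>A. h (f x))"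
  by (induction A rule: infinite_finite_induct) (simp_all add: ring_morphism_0 ring_morphism_add)

lemmas ring_morphism_simps = ring_morphism_1 ring_morphism_add ring_morphism_mult ring_morphism_0
  ring_morphism_minus ring_morphism_diff ring_morphism_power ring_morphism_numeral

lemma ring_morphism_comp: "ring_morphism g \<Longrightarrow> ring_morphism h \<Longrightarrow> ring_morphism (\<lambda>x. g (h x))"
  by (simp add: ring_morphism_def)

lemma ring_morphism_id: "ring_morphism id" "ring_morphism (\<lambda>x. x)"
  by (simp_all add: ring_morphism_def)

lemma ring_morphism_to_ac: "ring_morphism to_ac"
  and ring_morphism_to_fract: "ring_morphism to_fract"
  by (simp_all add: ring_morphism_def)

lemma ring_morphism_const_poly: "ring_morphism (\<lambda>c. [:c:])"
  by (simp add: ring_morphism_def one_pCons)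

lemma ring_morphism_poly: "ring_morphism (\<lambda>p. poly p x)"
  by (simp add: ring_morphism_def)

lemma ring_morphism_const3: "ring_morphism const3"
  by (simp add: ring_morphism_def const3_def one_pCons)

lemma ring_morphism_const_fun: "ring_morphism const_fun"
  unfolding const_fun_def
  by (intro ring_morphism_comp[OF ring_morphism_to_ac] ring_morphism_comp[OF ring_morphism_to_fract]
      ring_morphism_const_poly)

text \<open>Makes \<open>eval3\<close> a threefold iteration of one univariate evaluation, each
  inner evaluation being the structure map of the next, so that properties need a proof in one
  variable only.\<close>

definition eval1 :: "('a::comm_ring_1 \<Rightarrow> 'b::comm_ring_1) \<Rightarrow> 'b \<Rightarrow> 'a poly \<Rightarrow> 'b" where
  "eval1 h x p = poly (map_poly h p) x"

lemma eval1_pCons: "ring_morphism h \<Longrightarrow> eval1 h x (pCons a p) = h a + x * eval1 h x p"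
  by (cases "p = 0 \<and> a = 0") (auto simp: eval1_def map_poly_pCons ring_morphism_0)

lemma eval1_0: "eval1 h x 0 = 0"
  by (simp add: eval1_def)

lemma eval1_const: "ring_morphism h \<Longrightarrow> eval1 h x [:a:] = h a"
  by (simp add: eval1_pCons eval1_0)

lemma eval1_add: "ring_morphism h \<Longrightarrow> eval1 h x (p + q) = eval1 h x p + eval1 h x q"
  by (induction p q rule: poly_induct2) (simp_all add: eval1_pCons eval1_0 ring_morphism_add algebra_simps)

lemma eval1_smult: "ring_morphism h \<Longrightarrow> eval1 h x (Polynomial.smult a p) = h a * eval1 h x p"
  by (induction p) (simp_all add: eval1_pCons eval1_0 ring_morphism_mult algebra_simps)

lemma eval1_mult: "ring_morphism h \<Longrightarrow> eval1 h x (p * q) = eval1 h x p * eval1 h x q"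
  by (induction p) (simp_all add: eval1_pCons eval1_0 eval1_add eval1_smult ring_morphism_0 algebra_simps)

lemma ring_morphism_eval1: "ring_morphism h \<Longrightarrow> ring_morphism (eval1 h x)"
  by (rule ring_morphismI)
     (simp_all add: eval1_add eval1_mult eval1_const ring_morphism_1 one_pCons)

lemma eval3_eval1: "eval3 h p v = eval1 (eval1 (eval1 h (v $ 3)) (v $ 2)) (v $ 1) p"
  by (simp add: eval3_def eval1_def[abs_def])

lemma ring_morphism_eval3: "ring_morphism h \<Longrightarrow> ring_morphism (\<lambda>p. eval3 h p v)"
  unfolding eval3_eval1 by (intro ring_morphism_eval1)

lemmas eval3_simps = ring_morphism_simps[OF ring_morphism_eval3]

lemma eval3_const3: "ring_morphism h \<Longrightarrow> eval3 h (const3 c) v = h c"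
  by (simp add: eval3_eval1 const3_def eval1_const ring_morphism_eval1)

lemma coords3_nth: "coords3 $ 1 = [:0, 1:]" "coords3 $ 2 = [:[:0, 1:]:]" "coords3 $ 3 = [:[:[:0, 1:]:]:]"
  by (simp_all add: coords3_def)

lemma eval3_coords3: "ring_morphism h \<Longrightarrow> eval3 h (coords3 $ i) v = v $ i"
  using exhaust_3[of i]
  by (auto simp: eval3_eval1 coords3_nth eval1_const eval1_pCons eval1_0 ring_morphism_eval1 ring_morphism_simps)

text \<open>Ternary polynomials are generated as a ring by constants and coordinates. Most
  identities below compare two ring morphisms and are therefore checked on these generators instead
  of on coefficients.\<close>

lemma poly3_induct [case_names const coord add mult]:
  fixes p :: "'a::comm_ring_1 poly3"
  assumes c: "\<And>c. P (const3 c)" and x: "\<And>i. P (coords3 $ i)"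
    and a: "\<And>p q. P p \<Longrightarrow> P q \<Longrightarrow> P (p + q)" and m: "\<And>p q. P p \<Longrightarrow> P q \<Longrightarrow> P (p * q)"
  shows "P p"
proof -
  have 1: "P [:[:r:]:]" for r :: "'a poly"
  proof (induction r)
    case 0
    then show ?case using c[of 0] by (simp add: const3_def)
  next
    case (pCons a r)
    have "[:[:pCons a r:]:] = const3 a + coords3 $ 3 * [:[:r:]:]"
      by (simp add: const3_def coords3_nth)
    then show ?case using a[OF c m[OF x pCons(2)]] by simp
  qed
  have 2: "P [:q:]" for q :: "'a poly poly"
  proof (induction q)
    case 0
    then show ?case using c[of 0] by (simp add: const3_def)
  next
    case (pCons a r)
    have "[:pCons a r:] = [:[:a:]:] + coords3 $ 2 * [:r:]"
      by (simp add: coords3_nth)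
    then show ?case using a[OF 1 m[OF x pCons(2)]] by simp
  qed
  show ?thesis
  proof (induction p)
    case 0
    then show ?case using c[of 0] by (simp add: const3_def)
  next
    case (pCons a r)
    have "pCons a r = [:a:] + coords3 $ 1 * r"
      by (simp add: coords3_nth)
    then show ?case using a[OF 2 m[OF x pCons(2)]] by simp
  qed
qed

lemma ring_morphism_poly3_eqI:
  assumes "ring_morphism f" "ring_morphism g" "\<And>c. f (const3 c) = g (const3 c)"
    "\<And>i. f (coords3 $ i) = g (coords3 $ i)"
  shows "f p = g p"
  by (induction p rule: poly3_induct) (simp_all add: assms ring_morphism_add ring_morphism_mult)

lemma ring_morphism_of_eval3:
  assumes "ring_morphism g" "ring_morphism h"
  shows "g (eval3 h p v) = eval3 (\<lambda>c. g (h c)) p (\<chi> i. g (v $ i))"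
proof (rule ring_morphism_poly3_eqI[where f = "\<lambda>p. g (eval3 h p v)"])
  show "ring_morphism (\<lambda>p. g (eval3 h p v))"
    by (rule ring_morphism_comp[OF assms(1) ring_morphism_eval3[OF assms(2)]])
qed (use ring_morphism_comp[OF assms] assms in \<open>simp_all add: ring_morphism_eval3 eval3_const3 eval3_coords3\<close>)

lemma ring_morphism_linear_substitution: "ring_morphism (linear_substitution M)"
  unfolding linear_substitution_def by (rule ring_morphism_eval3[OF ring_morphism_const3])

lemma linear_substitution_const3: "linear_substitution M (const3 c) = const3 c"
  by (simp add: linear_substitution_def eval3_const3 ring_morphism_const3)

lemma linear_substitution_coords3:
  "linear_substitution M (coords3 $ i) = (\<Sum>j\<in>UNIV. const3 (M $ i $ j) * coords3 $ j)"
  by (simp add: linear_substitution_def eval3_coords3 ring_morphism_const3 matrix_vector_mult_def)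

definition map_mat :: "('a \<Rightarrow> 'b) \<Rightarrow> 'a ^ 'n ^ 'm \<Rightarrow> 'b ^ 'n ^ 'm" where
  "map_mat h M = (\<chi> i j. h (M $ i $ j))"

lemma eval3_linear_substitution:
  assumes h: "ring_morphism h"
  shows "eval3 h (linear_substitution M p) v = eval3 h p (map_mat h M *v v)"
proof (rule ring_morphism_poly3_eqI[where f = "\<lambda>p. eval3 h (linear_substitution M p) v"])
  show "ring_morphism (\<lambda>p. eval3 h (linear_substitution M p) v)"
    by (rule ring_morphism_comp[OF ring_morphism_eval3[OF h] ring_morphism_linear_substitution])
qed (use assms in \<open>simp_all add: ring_morphism_eval3 ring_morphism_linear_substitution
  eval3_const3 eval3_coords3 linear_substitution_const3 linear_substitution_coords3
  ring_morphism_sum[OF ring_morphism_eval3] eval3_simps matrix_vector_mult_def map_mat_def\<close>)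

lemma map_mat_mult: "ring_morphism h \<Longrightarrow> map_mat h (M ** N) = map_mat h M ** map_mat h N"
  by (simp add: map_mat_def matrix_matrix_mult_def vec_eq_iff ring_morphism_sum ring_morphism_simps)

lemma map_mat_one: "ring_morphism h \<Longrightarrow> map_mat h (mat 1) = mat 1"
  by (simp add: map_mat_def mat_def vec_eq_iff ring_morphism_simps)

lemma map_mat_transpose: "map_mat h (transpose M) = transpose (map_mat h M)"
  by (simp add: map_mat_def transpose_def vec_eq_iff)

lemma map_mat_vector_mult:
  "ring_morphism h \<Longrightarrow> map_mat h M *v (\<chi> i. h (v $ i)) = (\<chi> i. h ((M *v v) $ i))"
  by (simp add: map_mat_def matrix_vector_mult_def vec_eq_iff ring_morphism_sum ring_morphism_simps)

lemma map_mat_comp: "map_mat g (map_mat h M) = map_mat (\<lambda>x. g (h x)) M"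
  by (simp add: map_mat_def)

lemma linear_substitution_comp:
  "linear_substitution M (linear_substitution N p) = linear_substitution (N ** M) p"
  unfolding linear_substitution_def[of M] eval3_linear_substitution[OF ring_morphism_const3]
  unfolding linear_substitution_def
  by (simp add: map_mat_def[symmetric] matrix_vector_mul_assoc map_mat_mult ring_morphism_const3)

lemma linear_substitution_one: "linear_substitution (mat 1) p = p"
proof (rule ring_morphism_poly3_eqI[where g = "\<lambda>x. x"])
  show "linear_substitution (mat 1) (coords3 $ i) = (coords3 $ i :: 'a poly3)" for i
    using exhaust_3[of i]
    by (auto simp: linear_substitution_coords3 mat_def sum_3 ring_morphism_simps[OF ring_morphism_const3])
qed (simp_all add: ring_morphism_linear_substitution linear_substitution_const3 ring_morphism_id)

section \<open>Gradients as first-order terms\<close>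

lemma map_poly_add_additive:
  "D 0 = 0 \<Longrightarrow> (\<And>x y. D (x + y) = D x + D y) \<Longrightarrow> map_poly D (p + q) = map_poly D p + map_poly D q"
  by (rule poly_eqI) (simp add: coeff_map_poly)

lemma additive_sum:
  fixes D :: "'a::ab_group_add \<Rightarrow> 'b::ab_group_add"
  assumes "\<And>x y. D (x + y) = D x + D y"
  shows "D (sum f A) = (\<Sum>x\<in>A. D (f x))"
proof -
  have "D 0 = 0" using assms[of 0 0] by simp
  then show ?thesis
    by (induction A rule: infinite_finite_induct) (simp_all add: assms)
qed

lemma map_poly_mult_derivation:
  fixes D :: "'a::comm_ring_1 \<Rightarrow> 'a"
  assumes a: "\<And>x y. D (x + y) = D x + D y" and m: "\<And>x y. D (x * y) = D x * y + x * D y"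
  shows "map_poly D (p * q) = map_poly D p * q + p * map_poly D q"
proof -
  have 0: "D 0 = 0" using a[of 0 0] by simp
  show ?thesis
    by (rule poly_eqI) (simp add: coeff_map_poly 0 coeff_mult additive_sum[of D, OF a] m sum.distrib)
qed

text \<open>Taylor expansion along v + s w. Both the coefficient of s and the pairing with the
  gradient obey the Leibniz rule, so they agree once they agree on generators. Gradients can from
  here on be computed by evaluating at linear polynomials, without touching the iterated
  derivatives.\<close>

lemma coeff_eval3_dual:
  fixes h :: "'a::field \<Rightarrow> 'b::comm_ring_1"
  assumes h: "ring_morphism h"
  defines "e \<equiv> \<lambda>v w p. eval3 (\<lambda>c. [:h c:]) p (\<chi> i. [:v $ i, w $ i:])"
  shows "coeff (e v w p) 0 = eval3 h p v"
    and "coeff (e v w p) 1 = scalar_product (gradient h p v) w"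
proof -
  have rm: "ring_morphism (\<lambda>c. [:h c:])"
    using ring_morphism_comp[OF ring_morphism_const_poly h] .
  have re: "ring_morphism (e v w)" for v w
    unfolding e_def by (rule ring_morphism_eval3[OF rm])
  have rc: "ring_morphism (\<lambda>p. coeff p 0 :: 'b)"
    by (rule ring_morphismI) (simp_all add: coeff_mult_0)
  show 0: "coeff (e v w p) 0 = eval3 h p v" for v w p
  proof (rule ring_morphism_poly3_eqI[where f = "\<lambda>p. coeff (e v w p) 0"])
  qed (simp_all add: ring_morphism_comp[OF rc re] ring_morphism_eval3[OF h] eval3_const3[OF h]
        eval3_coords3[OF h], simp_all add: e_def eval3_const3[OF rm] eval3_coords3[OF rm])
  have D1: "map_poly pderiv (p + q) = map_poly pderiv p + map_poly pderiv q" for p q :: "'a poly3"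
    by (rule map_poly_add_additive) (simp_all add: pderiv_add)
  have M1: "map_poly pderiv (p * q) = map_poly pderiv p * q + p * map_poly pderiv q" for p q :: "'a poly3"
    by (rule map_poly_mult_derivation) (simp_all add: pderiv_add pderiv_mult algebra_simps)
  have D2': "map_poly pderiv (p + q) = map_poly pderiv p + map_poly pderiv q" for p q :: "'a poly poly"
    by (rule map_poly_add_additive) (simp_all add: pderiv_add)
  have M2': "map_poly pderiv (p * q) = map_poly pderiv p * q + p * map_poly pderiv q" for p q :: "'a poly poly"
    by (rule map_poly_mult_derivation) (simp_all add: pderiv_add pderiv_mult algebra_simps)
  have D2: "map_poly (map_poly pderiv) (p + q) = map_poly (map_poly pderiv) p + map_poly (map_poly pderiv) q" for p q :: "'a poly3"
    by (rule map_poly_add_additive) (simp_all add: D2')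
  have M2: "map_poly (map_poly pderiv) (p * q) = map_poly (map_poly pderiv) p * q + p * map_poly (map_poly pderiv) q" for p q :: "'a poly3"
    by (rule map_poly_mult_derivation) (simp_all add: D2' M2')
  have c1: "coeff (p * q) 1 = coeff p 0 * coeff q 1 + coeff p 1 * coeff q 0" for p q :: "'b poly"
    by (simp add: coeff_mult)
  show "coeff (e v w p) 1 = scalar_product (gradient h p v) w" for v w p
  proof (induction p rule: poly3_induct)
    case (const c)
    then show ?case
      by (simp add: e_def eval3_const3[OF rm])
         (simp add: scalar_product_def sum_3 gradient_def const3_def pderiv_pCons map_poly_pCons eval3_eval1 eval1_0)
  next
    case (coord i)
    have [simp]: "eval3 h 0 v = 0" "eval3 h 1 v = 1" using eval3_simps[OF h] by blast+
    then have [simp]: "eval3 h [:1:] v = 1" "eval3 h [:[:1:]:] v = 1" "eval3 h [:[:[:1:]:]:] v = 1" by (simp_all add: one_pCons)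
    have "i = 1 \<or> i = 2 \<or> i = 3" using exhaust_3 by auto
    then show ?case
      by (elim disjE)
       (simp_all add: e_def eval3_coords3[OF rm],
        simp_all add: scalar_product_def sum_3 gradient_def coords3_nth pderiv_pCons map_poly_pCons one_pCons eval3_eval1 eval1_pCons h ring_morphism_eval1 eval1_0 ring_morphism_simps)
  next
    case (add p q)
    then show ?case
      by (simp add: ring_morphism_add[OF re] scalar_product_def sum_3 gradient_def pderiv_add D1 D2 eval3_simps[OF h] algebra_simps)
  next
    case (mult p q)
    then show ?case
      by (simp add: ring_morphism_mult[OF re] c1[unfolded One_nat_def] 0 scalar_product_def sum_3 gradient_def pderiv_mult M1 M2 eval3_simps[OF h] algebra_simps)
  qed
qed

section \<open>Homogeneity and monomials\<close>

lemma coeff3_add: "coeff3 (p + q) i j l = coeff3 p i j l + coeff3 q i j l"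
  for p q :: "'a::comm_ring_1 poly3"
  by (simp add: coeff3_def)

lemma coeff3_mult_nonzero:
  fixes p q :: "'a::comm_ring_1 poly3"
  assumes "coeff3 (p * q) i j l \<noteq> 0"
  obtains i1 i2 j1 j2 l1 l2 where "i = i1 + i2" "j = j1 + j2" "l = l1 + l2"
    "coeff3 p i1 j1 l1 \<noteq> 0" "coeff3 q i2 j2 l2 \<noteq> 0"
proof -
  have "(\<Sum>a\<le>i. coeff (coeff (coeff p a * coeff q (i - a)) j) l) \<noteq> 0"
    using assms by (simp add: coeff3_def coeff_mult[of p q] coeff_sum)
  then obtain a where a: "a \<le> i" "coeff (coeff (coeff p a * coeff q (i - a)) j) l \<noteq> 0"
    by (meson atMost_iff sum.not_neutral_contains_not_neutral)
  have "(\<Sum>b\<le>j. coeff (coeff (coeff p a) b * coeff (coeff q (i - a)) (j - b)) l) \<noteq> 0"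
    using a(2) by (simp add: coeff_mult[of "coeff p a"] coeff_sum)
  then obtain b where b: "b \<le> j" "coeff (coeff (coeff p a) b * coeff (coeff q (i - a)) (j - b)) l \<noteq> 0"
    by (meson atMost_iff sum.not_neutral_contains_not_neutral)
  have "(\<Sum>c\<le>l. coeff3 p a b c * coeff3 q (i - a) (j - b) (l - c)) \<noteq> 0"
    using b(2) by (simp add: coeff_mult[of "coeff (coeff p a) b"] coeff3_def)
  then obtain c where c: "c \<le> l" "coeff3 p a b c * coeff3 q (i - a) (j - b) (l - c) \<noteq> 0"
    by (meson atMost_iff sum.not_neutral_contains_not_neutral)
  have "coeff3 p a b c \<noteq> 0" "coeff3 q (i - a) (j - b) (l - c) \<noteq> 0" using c(2) by auto
  then show ?thesis using that[of a "i - a" b "j - b" c "l - c"] a b c by auto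
qed

lemma form_0: "form n 0"
  by (simp add: form_def coeff3_def)

lemma form_add: "form n p \<Longrightarrow> form n q \<Longrightarrow> form n (p + q)" for p q :: "'a::comm_ring_1 poly3"
proof -
  assume "form n p" "form n q"
  then show ?thesis
    unfolding form_def coeff3_add by (metis add_0)
qed

lemma form_mult: "form m p \<Longrightarrow> form n q \<Longrightarrow> form (m + n) (p * q)" for p q :: "'a::comm_ring_1 poly3"
proof -
  assume p: "form m p" and q: "form n q"
  show ?thesis
    unfolding form_def
  proof (intro allI impI)
    fix i j l
    assume "coeff3 (p * q) i j l \<noteq> 0"
    then obtain i1 i2 j1 j2 l1 l2 where *: "i = i1 + i2" "j = j1 + j2" "l = l1 + l2"
      "coeff3 p i1 j1 l1 \<noteq> 0" "coeff3 q i2 j2 l2 \<noteq> 0"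
      by (rule coeff3_mult_nonzero)
    then have "i1 + j1 + l1 = m" "i2 + j2 + l2 = n"
      using p q by (simp_all add: form_def)
    then show "i + j + l = m + n" using * by simp
  qed
qed

lemma form_const3: "form 0 (const3 c)"
  by (auto simp: form_def coeff3_def const3_def coeff_pCons split: nat.splits)

lemma form_coords3: "form 1 (coords3 $ i)"
  using exhaust_3[of i]
  by (auto simp: form_def coeff3_def coords3_nth coeff_pCons one_pCons split: nat.splits if_splits)

lemma form_const3_mult: "form n p \<Longrightarrow> form n (const3 c * p)" for p :: "'a::comm_ring_1 poly3"
  using form_mult[OF form_const3, of n p c] by simp

lemma form_1: "form 0 (1 :: 'a::comm_ring_1 poly3)"
  using form_const3[of 1] by (simp add: const3_def one_pCons)

lemma form_power: "form n p \<Longrightarrow> form (n * k) (p ^ k)" for p :: "'a::comm_ring_1 poly3"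
proof (induction k)
  case (Suc k)
  then have "form (n + n * k) (p * p ^ k)" by (intro form_mult) auto
  then show ?case by simp
qed (simp add: form_1)

lemma form_sum: "(\<And>x. x \<in> A \<Longrightarrow> form n (f x)) \<Longrightarrow> form n (sum f A)"
  for f :: "'b \<Rightarrow> 'a::comm_ring_1 poly3"
  by (induction A rule: infinite_finite_induct) (auto simp: form_0 form_add)

definition mono3 :: "nat \<Rightarrow> nat \<Rightarrow> nat \<Rightarrow> 'a::comm_ring_1 poly3" where
  "mono3 i j l = (coords3 $ 1) ^ i * (coords3 $ 2) ^ j * (coords3 $ 3) ^ l"

lemma const3_mult_mono3: "const3 c * mono3 i j l = monom (monom (monom c l) j) i"
proof -
  have a: "[:q:] ^ k = [:q ^ k:]" for q :: "'c::comm_ring_1" and k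
    by (induction k) (simp_all add: one_pCons)
  have 3: "(coords3 $ 3 :: 'a poly3) ^ l = [:[:monom 1 l:]:]"
    by (simp add: coords3_nth a monom_altdef)
  have 2: "(coords3 $ 2 :: 'a poly3) ^ j = [:monom 1 j:]"
    by (simp add: coords3_nth a monom_altdef)
  have 1: "(coords3 $ 1 :: 'a poly3) ^ i = monom 1 i"
    by (simp add: coords3_nth a monom_altdef)
  show ?thesis
    unfolding mono3_def 1 2 3 const3_def by (simp add: monom_altdef smult_monom)
qed

lemma coeff3_mono3: "coeff3 (const3 c * mono3 i j l) i' j' l' = (if i = i' \<and> j = j' \<and> l = l' then c else 0)"
  by (simp add: const3_mult_mono3 coeff3_def coeff_monom)

lemma form_induct [consumes 1, case_names zero add mono]:
  fixes p :: "'a::comm_ring_1 poly3"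
  assumes "form n p" and z: "P 0" and a: "\<And>p q. P p \<Longrightarrow> P q \<Longrightarrow> P (p + q)"
    and m: "\<And>c i j l. i + j + l = n \<Longrightarrow> P (const3 c * mono3 i j l)"
  shows "P p"
proof -
  have S: "P (sum f A)" if "\<And>x. x \<in> A \<Longrightarrow> P (f x)" for f and A :: "nat set"
    using that by (induction A rule: infinite_finite_induct) (auto simp: z a)
  have ms: "monom (sum f A) k = (\<Sum>x\<in>A. monom (f x) k)" for f :: "nat \<Rightarrow> 'c::comm_monoid_add" and A k
    by (rule poly_eqI) (simp add: coeff_sum coeff_monom)
  have M: "P (monom (monom (monom (coeff3 p i j l) l) j) i)" for i j l
    using assms(1) m[of i j l "coeff3 p i j l"] z
    by (cases "coeff3 p i j l = 0") (simp, auto simp: const3_mult_mono3 form_def)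
  have 1: "P (monom (monom (coeff (coeff p i) j) j) i)" for i j
  proof -
    have "P (monom (monom (\<Sum>l\<le>degree (coeff (coeff p i) j). monom (coeff3 p i j l) l) j) i)"
      unfolding ms by (intro S M)
    then show ?thesis
      by (simp add: coeff3_def poly_as_sum_of_monoms)
  qed
  have 2: "P (monom (coeff p i) i)" for i
  proof -
    have "P (monom (\<Sum>j\<le>degree (coeff p i). monom (coeff (coeff p i) j) j) i)"
      unfolding ms by (intro S 1)
    then show ?thesis
      by (simp add: poly_as_sum_of_monoms)
  qed
  have "P (\<Sum>i\<le>degree p. monom (coeff p i) i)"
    by (intro S 2)
  then show ?thesis
    by (simp add: poly_as_sum_of_monoms)
qed

lemma eval3_scale:
  assumes "form n p" and h: "ring_morphism h"
  shows "eval3 h p (c *s v) = c ^ n * eval3 h p v"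
  using assms(1)
proof (induction p rule: form_induct)
  case (mono a i j l)
  have "eval3 h (const3 a * mono3 i j l) (c *s v) = c ^ (i + j + l) * eval3 h (const3 a * mono3 i j l) v"
    by (simp add: mono3_def eval3_simps[OF h] eval3_const3[OF h] eval3_coords3[OF h] power_mult_distrib power_add mult_ac)
  then show ?case
    by (simp only: mono)
qed (simp_all add: eval3_simps[OF h] algebra_simps)

lemma form_linear_substitution:
  assumes "form n p"
  shows "form n (linear_substitution M p)"
  using assms
proof (induction p rule: form_induct)
  case (mono c i j l)
  note rm = ring_morphism_linear_substitution[of M]
  have 1: "form 1 (linear_substitution M (coords3 $ i))" for i
    unfolding linear_substitution_coords3 by (intro form_sum form_const3_mult form_coords3)
  have "form (1 * i + 1 * j + 1 * l) (linear_substitution M (mono3 i j l))"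
    unfolding mono3_def ring_morphism_simps[OF rm] by (intro form_mult form_power 1)
  then show ?case
    using mono by (simp add: ring_morphism_simps[OF rm] linear_substitution_const3 form_const3_mult)
qed (simp_all add: ring_morphism_simps[OF ring_morphism_linear_substitution] form_0 form_add)

lemma form_expand:
  assumes "form n p"
  shows "(\<Sum>i\<le>n. \<Sum>j\<le>n - i. const3 (coeff3 p i j (n - i - j)) * mono3 i j (n - i - j)) = p"
  using assms
proof (induction p rule: form_induct)
  case zero
  then show ?case by (simp add: coeff3_def ring_morphism_0[OF ring_morphism_const3])
next
  case (add p q)
  then show ?case by (simp add: coeff3_add ring_morphism_add[OF ring_morphism_const3] ring_distribs sum.distrib)
next
  case (mono c i j l)
  have [simp]: "const3 0 = (0 :: 'a poly3)" by (rule ring_morphism_0[OF ring_morphism_const3])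
  have "(\<Sum>i'\<le>n. \<Sum>j'\<le>n - i'. const3 (coeff3 (const3 c * mono3 i j l) i' j' (n - i' - j')) * mono3 i' j' (n - i' - j'))
    = (\<Sum>i'\<le>n. \<Sum>j'\<le>n - i'. if i' = i then (if j' = j then const3 c * mono3 i j l else 0) else 0)"
    using mono by (intro sum.cong refl) (auto simp: coeff3_mono3)
  also have "\<dots> = (\<Sum>i'\<le>n. if i' = i then (\<Sum>j'\<le>n - i'. (if j' = j then const3 c * mono3 i j l else 0)) else 0)"
    by (intro sum.cong refl) auto
  also have "\<dots> = const3 c * mono3 i j l"
    using mono by (simp add: sum.delta)
  finally show ?case by simp
qed

lemma form3_expand:
  assumes "form 3 p"
  obtains c300 c210 c201 c120 c111 c102 c030 c021 c012 c003 where
   "p = const3 c300 * (coords3 $ 1) ^ 3 + const3 c210 * (coords3 $ 1)\<^sup>2 * coords3 $ 2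
      + const3 c201 * (coords3 $ 1)\<^sup>2 * coords3 $ 3 + const3 c120 * coords3 $ 1 * (coords3 $ 2)\<^sup>2
      + const3 c111 * coords3 $ 1 * coords3 $ 2 * coords3 $ 3 + const3 c102 * coords3 $ 1 * (coords3 $ 3)\<^sup>2
      + const3 c030 * (coords3 $ 2) ^ 3 + const3 c021 * (coords3 $ 2)\<^sup>2 * coords3 $ 3
      + const3 c012 * coords3 $ 2 * (coords3 $ 3)\<^sup>2 + const3 c003 * (coords3 $ 3) ^ 3"
proof -
  have *: "{..3::nat} = {0, 1, 2, 3}" "{..2::nat} = {0, 1, 2}" "{..1::nat} = {0, 1}" "{..0::nat} = {0}" by auto
  let ?c = "coeff3 p"
  have e: "p = const3 (?c 3 0 0) * mono3 3 0 0 + const3 (?c 2 1 0) * mono3 2 1 0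
      + const3 (?c 2 0 1) * mono3 2 0 1 + const3 (?c 1 2 0) * mono3 1 2 0
      + const3 (?c 1 1 1) * mono3 1 1 1 + const3 (?c 1 0 2) * mono3 1 0 2
      + const3 (?c 0 3 0) * mono3 0 3 0 + const3 (?c 0 2 1) * mono3 0 2 1
      + const3 (?c 0 1 2) * mono3 0 1 2 + const3 (?c 0 0 3) * mono3 0 0 3"
    by (subst form_expand[OF assms, symmetric]) (simp add: * del: One_nat_def, simp add: numeral_2_eq_2 add_ac)
  show ?thesis
    by (rule that[of "?c 3 0 0" "?c 2 1 0" "?c 2 0 1" "?c 1 2 0" "?c 1 1 1" "?c 1 0 2"
          "?c 0 3 0" "?c 0 2 1" "?c 0 1 2" "?c 0 0 3"], rule trans[OF e]) (simp add: mono3_def mult.assoc)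
qed

lemma scalar_product_axis: "scalar_product v (axis i 1) = v $ i" for v :: "'a::comm_ring_1 ^ 'n"
  by (simp add: scalar_product_def axis_def if_distrib cong: if_cong)

lemma scalar_product_transpose: "scalar_product (transpose M *v v) w = scalar_product v (M *v w)"
  for v :: "'a::comm_ring_1 ^ 3" and w :: "'a ^ 3"
  by (simp add: scalar_product_def matrix_vector_mult_def transpose_def sum_3 algebra_simps)

lemma vec_eq_scalar_productI: "(\<And>w. scalar_product v w = scalar_product v' w) \<Longrightarrow> v = v'"
  for v :: "'a::comm_ring_1 ^ 'n"
  by (metis scalar_product_axis vec_eq_iff)

text \<open>The chain rule, read off from the substitution rule applied to v + s w.\<close>

lemma gradient_linear_substitution:
  assumes h: "ring_morphism h"
  shows "gradient h (linear_substitution M F) v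
    = transpose (map_mat h M) *v gradient h F (map_mat h M *v v)"
proof (rule vec_eq_scalar_productI)
  fix w
  have rm: "ring_morphism (\<lambda>c. [:h c:])"
    using ring_morphism_comp[OF ring_morphism_const_poly h] .
  have "scalar_product (gradient h (linear_substitution M F) v) w
    = coeff (eval3 (\<lambda>c. [:h c:]) (linear_substitution M F) (\<chi> i. [:v $ i, w $ i:])) 1"
    using coeff_eval3_dual(2)[OF h] by metis
  also have "map_mat (\<lambda>c. [:h c:]) M *v (\<chi> i. [:v $ i, w $ i:])
    = (\<chi> i. [:(map_mat h M *v v) $ i, (map_mat h M *v w) $ i:])"
    by (simp add: vec_eq_iff matrix_vector_mult_def map_mat_def sum_3 algebra_simps)
  then have "coeff (eval3 (\<lambda>c. [:h c:]) (linear_substitution M F) (\<chi> i. [:v $ i, w $ i:])) 1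
     = scalar_product (gradient h F (map_mat h M *v v)) (map_mat h M *v w)"
    using coeff_eval3_dual(2)[OF h] by (simp only: eval3_linear_substitution[OF rm])
  finally show "scalar_product (gradient h (linear_substitution M F) v) w
    = scalar_product (transpose (map_mat h M) *v gradient h F (map_mat h M *v v)) w"
    by (simp only: scalar_product_transpose)
qed

lemma gradient_const3_mult:
  assumes h: "ring_morphism h"
  shows "gradient h (const3 c * F) v = h c *s gradient h F v"
proof (rule vec_eq_scalar_productI)
  fix w
  have rm: "ring_morphism (\<lambda>c. [:h c:])"
    using ring_morphism_comp[OF ring_morphism_const_poly h] .
  show "scalar_product (gradient h (const3 c * F) v) w = scalar_product (h c *s gradient h F v) w"
    unfolding coeff_eval3_dual(2)[OF h, symmetric]
    by (simp add: eval3_simps[OF rm] eval3_const3[OF rm] coeff_eval3_dual(2)[OF h, unfolded One_nat_def])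
       (simp add: scalar_product_def sum_3 algebra_simps)
qed

lemma eval3_weierstrass_form:
  assumes h: "ring_morphism h"
  shows "eval3 h (weierstrass_form a b) v
    = (v $ 2)\<^sup>2 * v $ 3 - (v $ 1) ^ 3 - h a * v $ 1 * (v $ 3)\<^sup>2 - h b * (v $ 3) ^ 3"
  by (simp add: weierstrass_form_def Let_def eval3_simps[OF h] eval3_const3[OF h] eval3_coords3[OF h])

lemma gradient_weierstrass_form:
  assumes h: "ring_morphism h"
  shows "gradient h (weierstrass_form a b) v = vector
    [- 3 * (v $ 1)\<^sup>2 - h a * (v $ 3)\<^sup>2, 2 * v $ 2 * v $ 3,
     (v $ 2)\<^sup>2 - 2 * h a * v $ 1 * v $ 3 - 3 * h b * (v $ 3)\<^sup>2]"
proof (rule vec_eq_scalar_productI)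
  fix w
  have rm: "ring_morphism (\<lambda>c. [:h c:])"
    using ring_morphism_comp[OF ring_morphism_const_poly h] .
  have c1: "coeff (p * q) 1 = coeff p 0 * coeff q 1 + coeff p 1 * coeff q 0" for p q :: "'b poly"
    by (simp add: coeff_mult)
  show "scalar_product (gradient h (weierstrass_form a b) v) w = scalar_product (vector
    [- 3 * (v $ 1)\<^sup>2 - h a * (v $ 3)\<^sup>2, 2 * v $ 2 * v $ 3,
     (v $ 2)\<^sup>2 - 2 * h a * v $ 1 * v $ 3 - 3 * h b * (v $ 3)\<^sup>2]) w"
    unfolding coeff_eval3_dual(2)[OF h, symmetric] eval3_weierstrass_form[OF rm]
    by (simp add: power2_eq_square power3_eq_cube c1[unfolded One_nat_def] coeff_mult_0 del: mult_pCons_left mult_pCons_right)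
       (simp add: scalar_product_def sum_3 algebra_simps)
qed

section \<open>The Weierstrass model of a cubic with a flex\<close>

lemma invertible_map_mat:
  assumes "ring_morphism h" "invertible M"
  shows "invertible (map_mat h M)"
  using assms(2) unfolding invertible_def
  by (metis map_mat_mult[OF assms(1)] map_mat_one[OF assms(1)])

lemma invertible_transpose:
  fixes M :: "'a::field ^ 'n ^ 'n"
  shows "invertible M \<Longrightarrow> invertible (transpose M)"
  by (simp add: invertible_det_nz)

lemma invertible_mult_eq_0_iff:
  fixes M :: "'a::field ^ 'n ^ 'n"
  assumes "invertible M"
  shows "M *v v = 0 \<longleftrightarrow> v = 0"
proof
  obtain N where "N ** M = mat 1" using assms unfolding invertible_def by blast
  then have "v = N *v (M *v v)" by (simp add: matrix_vector_mul_assoc)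
  moreover assume "M *v v = 0"
  ultimately show "v = 0" by simp
qed simp

lemma smooth_cubic_linear_substitution:
  assumes "smooth_cubic F" "invertible M"
  shows "smooth_cubic (linear_substitution M F)"
  unfolding smooth_cubic_def
proof (intro conjI allI impI)
  show "form 3 (linear_substitution M F)"
    using assms(1) by (simp add: smooth_cubic_def form_linear_substitution)
  fix v :: "'a alg_closure ^ 3"
  let ?M = "map_mat to_ac M"
  have i: "invertible ?M" "invertible (transpose ?M)"
    using invertible_map_mat[OF ring_morphism_to_ac assms(2)] by (auto intro: invertible_transpose)
  assume v: "v \<noteq> 0 \<and> eval3 to_ac (linear_substitution M F) v = 0"
  then have "?M *v v \<noteq> 0" "eval3 to_ac F (?M *v v) = 0"
    by (simp_all add: invertible_mult_eq_0_iff[OF i(1)] eval3_linear_substitution[OF ring_morphism_to_ac])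
  then have "gradient to_ac F (?M *v v) \<noteq> 0"
    using assms(1) by (simp add: smooth_cubic_def)
  then show "gradient to_ac (linear_substitution M F) v \<noteq> 0"
    unfolding gradient_linear_substitution[OF ring_morphism_to_ac] invertible_mult_eq_0_iff[OF i(2)] .
qed

text \<open>Euler's identity: moving along v + s v multiplies the form by (1 + s)^n, whose linear
  coefficient is n.\<close>

lemma scalar_product_gradient_self:
  assumes "form n F" and h: "ring_morphism h"
  shows "scalar_product (gradient h F v) v = of_nat n * eval3 h F v"
proof -
  have rm: "ring_morphism (\<lambda>c. [:h c:])"
    using ring_morphism_comp[OF ring_morphism_const_poly h] .
  have r: "ring_morphism (\<lambda>c. [:c:] :: 'b poly)" by (rule ring_morphism_const_poly)
  have "(\<chi> i. [:v $ i, v $ i:]) = [:1, 1:] *s (\<chi> i. [:v $ i:])"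
    by (simp add: vec_eq_iff)
  then have "scalar_product (gradient h F v) v = coeff ([:1, 1:] ^ n * eval3 (\<lambda>c. [:h c:]) F (\<chi> i. [:v $ i:])) 1"
    unfolding coeff_eval3_dual(2)[OF h, symmetric] using eval3_scale[OF assms(1) rm] by metis
  also have "eval3 (\<lambda>c. [:h c:]) F (\<chi> i. [:v $ i:]) = [:eval3 h F v:]"
    using ring_morphism_of_eval3[OF r h] by metis
  also have "coeff ([:1, 1 :: 'b:] ^ n) 1 = of_nat n"
  proof (induction n)
    case (Suc n)
    have "coeff ([:1, 1 :: 'b:] ^ n) 0 = 1"
      by (simp add: coeff_0_power)
    then show ?case using Suc by (simp add: coeff_mult)
  qed simp
  then have "coeff ([:1, 1 :: 'b:] ^ n * [:eval3 h F v:]) 1 = of_nat n * eval3 h F v"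
    by simp
  finally show ?thesis .
qed

text \<open>The first column is the cross product of \<open>g\<close> with a unit vector
  \<open>x\<close> not orthogonal to \<open>v\<close>, hence orthogonal to \<open>g\<close>; the
  third is a unit vector \<open>u\<close> not orthogonal to \<open>g\<close>. Lagrange's identity
  for (g x x).(v x u), together with g.v = 0, evaluates the determinant as -(v.x)(g.u).\<close>

lemma adapted_frame:
  fixes v g :: "'a::field ^ 3"
  assumes "v \<noteq> 0" "g \<noteq> 0" "scalar_product g v = 0"
  obtains M :: "'a ^ 3 ^ 3" where "invertible M" "\<And>i. M $ i $ 2 = v $ i"
    "scalar_product g (\<chi> i. M $ i $ 1) = 0" "scalar_product g (\<chi> i. M $ i $ 3) \<noteq> 0"
proof -
  obtain j where j: "g $ j \<noteq> 0" using assms(2) by (auto simp: vec_eq_iff)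
  obtain k where k: "v $ k \<noteq> 0" using assms(1) by (auto simp: vec_eq_iff)
  define x :: "'a ^ 3" where "x = axis k 1"
  define u :: "'a ^ 3" where "u = axis j 1"
  define w :: "'a ^ 3" where "w = vector [g $ 2 * x $ 3 - g $ 3 * x $ 2, g $ 3 * x $ 1 - g $ 1 * x $ 3, g $ 1 * x $ 2 - g $ 2 * x $ 1]"
  define M :: "'a ^ 3 ^ 3" where "M = (\<chi> i. vector [w $ i, v $ i, u $ i])"
  have gv: "g $ 1 * v $ 1 + g $ 2 * v $ 2 + g $ 3 * v $ 3 = 0"
    using assms(3) by (simp add: scalar_product_def sum_3)
  have gu: "g $ 1 * u $ 1 + g $ 2 * u $ 2 + g $ 3 * u $ 3 = g $ j"
    using scalar_product_axis[of g j] by (simp add: u_def scalar_product_def sum_3)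
  have vx: "v $ 1 * x $ 1 + v $ 2 * x $ 2 + v $ 3 * x $ 3 = v $ k"
    using scalar_product_axis[of v k] by (simp add: x_def scalar_product_def sum_3)
  have "det M = - ((v $ 1 * x $ 1 + v $ 2 * x $ 2 + v $ 3 * x $ 3) * (g $ 1 * u $ 1 + g $ 2 * u $ 2 + g $ 3 * u $ 3))
     + (g $ 1 * v $ 1 + g $ 2 * v $ 2 + g $ 3 * v $ 3) * (x $ 1 * u $ 1 + x $ 2 * u $ 2 + x $ 3 * u $ 3)"
    by (simp add: det_3 M_def w_def) Groebner_Basis.algebra
  then have "det M \<noteq> 0"
    using j k by (simp add: gv gu vx)
  then have "invertible M" by (simp add: invertible_det_nz)
  moreover have "scalar_product g w = 0"
    by (simp add: scalar_product_def sum_3 w_def algebra_simps)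
  moreover have "scalar_product g u \<noteq> 0"
    using j by (simp add: u_def scalar_product_axis)
  moreover have "(\<chi> i. M $ i $ 1) = w" "(\<chi> i. M $ i $ 3) = u"
    by (simp_all add: M_def vec_eq_iff)
  moreover have "M $ i $ 2 = v $ i" for i
    by (simp add: M_def)
  ultimately show ?thesis
    by (intro that[of M]) simp_all
qed

text \<open>The coefficients of the cubic in a frame whose second vector is the flex and whose first
  two vectors span the flex tangent.\<close>

lemma flex_normal_form:
  fixes F :: "'a::field poly3"
  assumes sm: "smooth_cubic F" and fl: "flex F v"
  obtains M :: "'a ^ 3 ^ 3" and A B C D E G H where "invertible M" "A \<noteq> 0" "D \<noteq> 0"
    "linear_substitution M F = const3 D * (coords3 $ 1) ^ 3
      + (const3 E * (coords3 $ 1)\<^sup>2 + const3 B * coords3 $ 1 * coords3 $ 2 + const3 A * (coords3 $ 2)\<^sup>2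
         + const3 G * coords3 $ 1 * coords3 $ 3 + const3 C * coords3 $ 2 * coords3 $ 3
         + const3 H * (coords3 $ 3)\<^sup>2) * coords3 $ 3"
proof -
  define g where "g = gradient id F v"
  have f3: "form 3 F" using sm by (simp add: smooth_cubic_def)
  have v: "v \<noteq> 0" "eval3 id F v = 0" "g \<noteq> 0" using fl by (auto simp: flex_def g_def)
  have "scalar_product g v = 0"
    using scalar_product_gradient_self[OF f3 ring_morphism_id(1), of v] v by (simp add: g_def)
  from adapted_frame[OF v(1,3) this] obtain M :: "'a ^ 3 ^ 3" where M: "invertible M" "\<And>i. M $ i $ 2 = v $ i"
    "scalar_product g (\<chi> i. M $ i $ 1) = 0" "scalar_product g (\<chi> i. M $ i $ 3) \<noteq> 0"
    by blast
  define F1 where "F1 = linear_substitution M F"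
  have sm1: "smooth_cubic F1" unfolding F1_def by (rule smooth_cubic_linear_substitution[OF sm M(1)])
  then have "form 3 F1" by (simp add: smooth_cubic_def)
  then obtain D c210 E c120 B G c030 A C H where F1:
    "F1 = const3 D * (coords3 $ 1) ^ 3 + const3 c210 * (coords3 $ 1)\<^sup>2 * coords3 $ 2
      + const3 E * (coords3 $ 1)\<^sup>2 * coords3 $ 3 + const3 c120 * coords3 $ 1 * (coords3 $ 2)\<^sup>2
      + const3 B * coords3 $ 1 * coords3 $ 2 * coords3 $ 3 + const3 G * coords3 $ 1 * (coords3 $ 3)\<^sup>2
      + const3 c030 * (coords3 $ 2) ^ 3 + const3 A * (coords3 $ 2)\<^sup>2 * coords3 $ 3
      + const3 C * coords3 $ 2 * (coords3 $ 3)\<^sup>2 + const3 H * (coords3 $ 3) ^ 3"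
    by (rule form3_expand)
  have e1: "eval3 h F1 p = h D * (p $ 1) ^ 3 + h c210 * (p $ 1)\<^sup>2 * p $ 2
      + h E * (p $ 1)\<^sup>2 * p $ 3 + h c120 * p $ 1 * (p $ 2)\<^sup>2
      + h B * p $ 1 * p $ 2 * p $ 3 + h G * p $ 1 * (p $ 3)\<^sup>2
      + h c030 * (p $ 2) ^ 3 + h A * (p $ 2)\<^sup>2 * p $ 3
      + h C * p $ 2 * (p $ 3)\<^sup>2 + h H * (p $ 3) ^ 3" if h: "ring_morphism h" for h :: "'a \<Rightarrow> 'b::comm_ring_1" and p
    by (simp add: F1 eval3_simps[OF h] eval3_const3[OF h] eval3_coords3[OF h])
  have rc: "ring_morphism (\<lambda>c. [:c:] :: 'a poly)" by (rule ring_morphism_const_poly)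
  have "monom 1 3 = ([:0, 1:] ^ 3 :: 'a poly)" by (simp add: monom_altdef)
  moreover have "[:0, 1:] ^ 3 dvd eval3 (\<lambda>c. [:c:]) F (\<chi> i. [:v $ i, (\<chi> i. M $ i $ 1) $ i:])"
    using fl M(3) unfolding flex_def g_def by blast
  \<comment> \<open>In the new frame the flex tangent is parameterized by (s, 1, 0), so the flex
    condition kills the coefficients of 1, s and s^2 of the restriction.\<close>
  moreover have "map_mat (\<lambda>c. [:c:]) M *v vector [[:0, 1:], 1, 0] = (\<chi> i. [:v $ i, (\<chi> i. M $ i $ 1) $ i:])"
    by (simp add: vec_eq_iff matrix_vector_mult_def map_mat_def sum_3 M(2))
  moreover have "eval3 (\<lambda>c. [:c:]) F1 (vector [[:0, 1:], 1, 0]) = [:c030, c120, c210, D:]"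
    by (simp add: e1[OF rc] power2_eq_square power3_eq_cube)
  ultimately have "monom 1 3 dvd [:c030, c120, c210, D:]"
    unfolding F1_def eval3_linear_substitution[OF rc] by simp
  then have "coeff [:c030, c120, c210, D:] k = 0" if "k < 3" for k
    using that by (simp add: monom_1_dvd_iff')
  from this[of 0] this[of 1] this[of 2] have z: "c030 = 0" "c120 = 0" "c210 = 0"
    by (simp_all add: numeral_2_eq_2)
  have F1': "F1 = const3 D * (coords3 $ 1) ^ 3
      + (const3 E * (coords3 $ 1)\<^sup>2 + const3 B * coords3 $ 1 * coords3 $ 2 + const3 A * (coords3 $ 2)\<^sup>2
         + const3 G * coords3 $ 1 * coords3 $ 3 + const3 C * coords3 $ 2 * coords3 $ 3
         + const3 H * (coords3 $ 3)\<^sup>2) * coords3 $ 3"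
    unfolding F1 z ring_morphism_0[OF ring_morphism_const3]
    by (simp add: algebra_simps power2_eq_square power3_eq_cube)
  have e2: "eval3 h F1 p = h D * (p $ 1) ^ 3 + (h E * (p $ 1)\<^sup>2
      + h B * p $ 1 * p $ 2 + h A * (p $ 2)\<^sup>2 + h G * p $ 1 * p $ 3 + h C * p $ 2 * p $ 3
      + h H * (p $ 3) ^ 2) * p $ 3" if h: "ring_morphism h" for h :: "'a \<Rightarrow> 'b::comm_ring_1" and p
    by (simp add: F1' eval3_simps[OF h] eval3_const3[OF h] eval3_coords3[OF h])
  have c1: "coeff (p * q) (Suc 0) = coeff p 0 * coeff q 1 + coeff p 1 * coeff q 0" for p q :: "'b::comm_ring_1 poly"
    by (simp add: coeff_mult)
  \<comment> \<open>\<open>A\<close> is the derivative at the flex in the direction of the third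
    frame vector, which is not tangent.\<close>
  have "A \<noteq> 0"
  proof -
    have mv: "map_mat id M *v axis 2 1 = v"
      by (simp add: vec_eq_iff matrix_vector_mult_def map_mat_def sum_3 M(2) axis_def)
    have "scalar_product (gradient id F1 (axis 2 1)) (axis 3 1) = scalar_product g (map_mat id M *v axis 3 1)"
      unfolding F1_def gradient_linear_substitution[OF ring_morphism_id(1)] mv scalar_product_transpose g_def ..
    also have "map_mat id M *v axis 3 1 = (\<chi> i. M $ i $ 3)"
      by (simp add: vec_eq_iff matrix_vector_mult_def map_mat_def sum_3 axis_def)
    also have "scalar_product (gradient id F1 (axis 2 1)) (axis 3 1) = A"
      unfolding coeff_eval3_dual(2)[OF ring_morphism_id(1), symmetric]
      by (simp add: e2 ring_morphism_comp[OF ring_morphism_const_poly] axis_def c1 coeff_mult_0 coeff_0_power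
           power2_eq_square ring_morphism_const_poly)
    finally show ?thesis using M(4) by simp
  qed
  \<comment> \<open>If \<open>D\<close> vanished, the flex tangent would be a component of the
    cubic, and any of its intersections with the residual conic would be singular.\<close>
  moreover have "D \<noteq> 0"
  proof
    assume D: "D = 0"
    let ?p = "[:to_ac E, to_ac B, to_ac A:]"
    have "degree ?p > 0" using \<open>A \<noteq> 0\<close> by simp
    then obtain y where y: "poly ?p y = 0" using alg_closed_imp_poly_has_root by blast
    define q :: "'a alg_closure ^ 3" where "q = vector [1, y, 0]"
    have "q $ 1 \<noteq> 0" by (simp add: q_def)
    then have "q \<noteq> 0" by auto
    moreover have "eval3 to_ac F1 q = 0"
      by (simp add: e2[OF ring_morphism_to_ac] D q_def)
    moreover have "gradient to_ac F1 q = 0"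
    proof (rule vec_eq_scalar_productI)
      fix w
      show "scalar_product (gradient to_ac F1 q) w = scalar_product 0 w"
        unfolding coeff_eval3_dual(2)[OF ring_morphism_to_ac, symmetric]
          e2[OF ring_morphism_comp[OF ring_morphism_const_poly ring_morphism_to_ac]]
        by (rule trans[of _ "w $ 3 * poly ?p y"])
           (simp add: D q_def c1 coeff_mult_0 coeff_0_power power2_eq_square algebra_simps
             del: mult_pCons_left mult_pCons_right, subst y, simp add: scalar_product_def)
    qed
    ultimately show False using sm1 by (auto simp: smooth_cubic_def)
  qed
  ultimately show ?thesis using that[OF M(1) _ _ F1'[unfolded F1_def]] by blast
qed

text \<open>\<open>f\<close> and \<open>g\<close> complete the square in the second coordinate,
  \<open>e\<close> then removes the quadratic term in the first. The scalings -A D and A D^2 give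
  y^2 z and -x^3 the same coefficient A^3 D^4 without extracting roots.\<close>

lemma cubic_completion:
  fixes A B C D E G H :: "'a::field"
  assumes "(2::'a) \<noteq> 0" "(3::'a) \<noteq> 0" "A \<noteq> 0" "D \<noteq> 0"
  defines "F \<equiv> const3 D * (coords3 $ 1) ^ 3
      + (const3 E * (coords3 $ 1)\<^sup>2 + const3 B * coords3 $ 1 * coords3 $ 2 + const3 A * (coords3 $ 2)\<^sup>2
         + const3 G * coords3 $ 1 * coords3 $ 3 + const3 C * coords3 $ 2 * coords3 $ 3
         + const3 H * (coords3 $ 3)\<^sup>2) * coords3 $ 3"
  shows "\<exists>a b. weierstrass_model F a b"
proof -
  define f where "f = B / (2 * A)"
  define g where "g = C / (2 * A)"
  define e where "e = (E - A * f\<^sup>2) / (3 * D)"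
  define G' where "G' = G - 2 * A * f * g"
  define c where "c = A ^ 3 * D ^ 4"
  define P where "P = - A * D * (G' - 3 * D * e\<^sup>2)"
  define Q where "Q = 2 * D * e ^ 3 - G' * e + H - A * g\<^sup>2"
  define a where "a = - P / c"
  define b where "b = - Q / c"
  define M :: "'a ^ 3 ^ 3" where "M = vector [vector [- A * D, 0, - e],
     vector [f * A * D, A * D\<^sup>2, f * e - g], vector [0, 0, 1]]"
  have c0: "c \<noteq> 0" using assms by (simp add: c_def)
  have B: "B = 2 * A * f" and C: "C = 2 * A * g" using assms by (simp_all add: f_def g_def)
  have E: "E = 3 * D * e + A * f\<^sup>2" and G: "G = G' + 2 * A * f * g"
    using assms by (simp_all add: e_def G'_def)
  have H: "H = Q - 2 * D * e ^ 3 + G' * e + A * g\<^sup>2" by (simp add: Q_def)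
  have ca: "const3 c * const3 a = const3 A * const3 D * (const3 G' - 3 * const3 D * (const3 e)\<^sup>2)"
    and cb: "const3 c * const3 b = - const3 Q"
    unfolding ring_morphism_simps[OF ring_morphism_const3, symmetric] a_def b_def P_def
    using c0 by simp_all
  have cc: "const3 c = (const3 A) ^ 3 * (const3 D) ^ 4"
    by (simp add: c_def ring_morphism_simps[OF ring_morphism_const3])
  have ls: "linear_substitution M (coords3 $ 1) = - const3 A * const3 D * coords3 $ 1 - const3 e * coords3 $ 3"
    "linear_substitution M (coords3 $ 2) = const3 f * const3 A * const3 D * coords3 $ 1
       + const3 A * (const3 D)\<^sup>2 * coords3 $ 2 + (const3 f * const3 e - const3 g) * coords3 $ 3"
    "linear_substitution M (coords3 $ 3) = coords3 $ 3"
    by (simp_all add: linear_substitution_coords3 sum_3 M_def ring_morphism_simps[OF ring_morphism_const3])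
  have "det M = - A\<^sup>2 * D ^ 3"
    by (simp add: det_3 M_def power2_eq_square power3_eq_cube)
  then have "invertible M" using assms by (simp add: invertible_det_nz)
  moreover have "linear_substitution M F = const3 c * weierstrass_form a b"
  proof -
    have "const3 c * weierstrass_form a b = const3 c * ((coords3 $ 2)\<^sup>2 * coords3 $ 3 - (coords3 $ 1) ^ 3)
        - const3 c * const3 a * coords3 $ 1 * (coords3 $ 3)\<^sup>2 - const3 c * const3 b * (coords3 $ 3) ^ 3"
      by (simp add: weierstrass_form_def Let_def algebra_simps)
    also have "\<dots> = linear_substitution M F"
      unfolding ca cb
      unfolding F_def ring_morphism_simps[OF ring_morphism_linear_substitution] linear_substitution_const3 ls
        cc B C E G
      unfolding H ring_morphism_simps[OF ring_morphism_const3]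
      by Groebner_Basis.algebra
    finally show ?thesis by simp
  qed
  ultimately show ?thesis using c0 unfolding weierstrass_model_def by blast
qed

theorem flex_imp_weierstrass_model:
  fixes F :: "'a::field poly3"
  assumes "(2::'a) \<noteq> 0" "(3::'a) \<noteq> 0" "smooth_cubic F" "flex F v"
  shows "\<exists>a b. weierstrass_model F a b"
proof -
  obtain M :: "'a ^ 3 ^ 3" and A B C D E G H where M: "invertible M" "A \<noteq> 0" "D \<noteq> 0"
    and F: "linear_substitution M F = const3 D * (coords3 $ 1) ^ 3
      + (const3 E * (coords3 $ 1)\<^sup>2 + const3 B * coords3 $ 1 * coords3 $ 2 + const3 A * (coords3 $ 2)\<^sup>2
         + const3 G * coords3 $ 1 * coords3 $ 3 + const3 C * coords3 $ 2 * coords3 $ 3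
         + const3 H * (coords3 $ 3)\<^sup>2) * coords3 $ 3"
    by (rule flex_normal_form[OF assms(3,4)])
  obtain a b N c where N: "invertible N" "c \<noteq> 0"
    "linear_substitution N (linear_substitution M F) = const3 c * weierstrass_form a b"
    using cubic_completion[OF assms(1,2) M(2,3), of E B G C H] unfolding F[symmetric] weierstrass_model_def by blast
  then have "weierstrass_model F a b"
    unfolding weierstrass_model_def linear_substitution_comp using invertible_mult[OF M(1) N(1)] by blast
  then show ?thesis by blast
qed

lemma modular_invariant_nonzero:
  fixes F :: "'a::field poly3"
  assumes "(2::'a) \<noteq> 0" "(3::'a) \<noteq> 0" "smooth_cubic F" "flex F v" "modular_invariant F \<noteq> 0"
  obtains a b where "weierstrass_model F a b" "a \<noteq> 0" "4 * a ^ 3 + 27 * b\<^sup>2 \<noteq> 0"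
proof -
  obtain a b where "weierstrass_model F a b"
    using flex_imp_weierstrass_model[OF assms(1-4)] by blast
  then have "\<exists>j. \<exists>a b. weierstrass_model F a b \<and> j = 1728 * (4 * a ^ 3) / (4 * a ^ 3 + 27 * b\<^sup>2)"
    by blast
  from someI_ex[OF this] obtain a b where
    "weierstrass_model F a b" "modular_invariant F = 1728 * (4 * a ^ 3) / (4 * a ^ 3 + 27 * b\<^sup>2)"
    unfolding modular_invariant_def by blast
  \<comment> \<open>Division by zero has value 0, so a nonzero value of the quotient rules out both
    a zero numerator and a zero discriminant.\<close>
  then show ?thesis using assms(5) that by fastforce
qed

section \<open>The equation of the dual curve\<close>

text \<open>The line \<open>u x + v y + w = 0\<close> meets \<open>y\<^sup>2 = x\<^sup>3 + a x + b\<close> where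
  \<open>v\<^sup>2 x\<^sup>3 - u\<^sup>2 x\<^sup>2 + (a v\<^sup>2 - 2 u w) x + b v\<^sup>2 - w\<^sup>2\<close> vanishes; the sextic is the discriminant of
  this cubic divided by \<open>v\<^sup>2\<close>.  The variables are ordered as \<open>v, u, w\<close>, because the leading
  coefficient with respect to \<open>v\<close> is a constant.\<close>

definition dual_sextic :: "'a::comm_ring_1 \<Rightarrow> 'a \<Rightarrow> 'a poly3" where
  "dual_sextic a b = (let u = [:0, 1:]; w = [:[:0, 1:]:]; a' = [:[:a:]:]; b' = [:[:b:]:] in
    [:4 * b' * u ^ 6 - 4 * a' * u ^ 5 * w - 4 * u ^ 3 * w ^ 3, 0,
      a'\<^sup>2 * u ^ 4 + 36 * b' * u ^ 3 * w - 30 * a' * u\<^sup>2 * w\<^sup>2 - 27 * w ^ 4, 0,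
      24 * a'\<^sup>2 * u * w + 54 * b' * w\<^sup>2 - 18 * a' * b' * u\<^sup>2, 0, - 4 * a' ^ 3 - 27 * b'\<^sup>2:])"

definition sextic :: "'a::comm_ring_1 \<Rightarrow> 'a \<Rightarrow> 'a \<Rightarrow> 'a \<Rightarrow> 'a \<Rightarrow> 'a" where
  "sextic a b v u w = 4 * b * u ^ 6 - 4 * a * u ^ 5 * w - 4 * u ^ 3 * w ^ 3
     + (a\<^sup>2 * u ^ 4 + 36 * b * u ^ 3 * w - 30 * a * u\<^sup>2 * w\<^sup>2 - 27 * w ^ 4) * v\<^sup>2
     + (24 * a\<^sup>2 * u * w + 54 * b * w\<^sup>2 - 18 * a * b * u\<^sup>2) * v ^ 4 + (- 4 * a ^ 3 - 27 * b\<^sup>2) * v ^ 6"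

lemma eval3_dual_sextic:
  assumes h: "ring_morphism h"
  shows "eval3 h (dual_sextic a b) v = sextic (h a) (h b) (v $ 1) (v $ 2) (v $ 3)"
proof -
  note r1 = ring_morphism_eval1[OF h] and r2 = ring_morphism_eval1[OF ring_morphism_eval1[OF h]]
  show ?thesis
    unfolding eval3_eval1 dual_sextic_def Let_def
    apply (simp only: eval1_pCons[OF r2] eval1_0 ring_morphism_simps[OF r2])
    apply (simp only: eval1_pCons[OF r1] eval1_0 ring_morphism_simps[OF r1])
    apply (simp only: eval1_pCons[OF h] eval1_0 ring_morphism_simps[OF h])
    apply (simp add: sextic_def)
    apply (simp add: algebra_simps power2_eq_square eval_nat_numeral)
    done
qed

lemma form_dual_sextic: "form 6 (dual_sextic a b :: 'a::comm_ring_1 poly3)"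
proof -
  define tx ty tz :: "'a poly3" where "tx = coords3 $ 1" and "ty = coords3 $ 2" and "tz = coords3 $ 3"
  let ?k = "const3 :: 'a \<Rightarrow> 'a poly3"
  have e: "dual_sextic a b = ?k (4 * b) * ty ^ 6 + ?k (- 4 * a) * (ty ^ 5 * tz ^ 1) + ?k (- 4) * (ty ^ 3 * tz ^ 3)
    + (?k (a\<^sup>2) * ty ^ 4 + ?k (36 * b) * (ty ^ 3 * tz ^ 1) + ?k (- 30 * a) * (ty\<^sup>2 * tz\<^sup>2) + ?k (- 27) * tz ^ 4) * tx\<^sup>2
    + (?k (24 * a\<^sup>2) * (ty ^ 1 * tz ^ 1) + ?k (54 * b) * tz\<^sup>2 + ?k (- 18 * a * b) * ty\<^sup>2) * tx ^ 4
    + ?k (- 4 * a ^ 3 - 27 * b\<^sup>2) * tx ^ 6"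
  proof -
    define k where "k = (\<lambda>c :: 'a poly poly. [:c:])"
    have k: "ring_morphism k" unfolding k_def by (rule ring_morphism_const_poly)
    have kv: "k [:0, 1:] = ty" "k [:[:0, 1:]:] = tz" "k [:[:c:]:] = ?k c" for c
      by (simp_all add: k_def ty_def tz_def coords3_nth const3_def)
    have t2: "tx\<^sup>2 = [:0, 0, 1:]" by (simp add: tx_def coords3_nth power2_eq_square)
    have t4: "tx ^ 4 = [:0, 0, 0, 0, 1:]" using power_add[of tx 2 2] by (simp add: t2)
    have t6: "tx ^ 6 = [:0, 0, 0, 0, 0, 0, 1:]" using power_add[of tx 4 2] by (simp add: t2 t4)
    have p: "[:p, 0, q, 0, r, 0, s:] = k p + k q * tx\<^sup>2 + k r * tx ^ 4 + k s * tx ^ 6" for p q r s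
      by (simp add: t2 t4 t6 k_def)
    show ?thesis
      unfolding dual_sextic_def Let_def p
      by (simp only: ring_morphism_simps[OF k] ring_morphism_simps[OF ring_morphism_const3] kv power_one_right)
         (simp add: algebra_simps)
  qed
  have d: "form d (p ^ d)" if "form 1 p" for p :: "'a poly3" and d
    using form_power[OF that, of d] by simp
  have tx: "form d (tx ^ d)" "form d (ty ^ d)" "form d (tz ^ d)" for d
    unfolding tx_def ty_def tz_def by (intro d form_coords3)+
  have m: "form 6 (p * q)" if "form k p" "form l q" "k + l = 6" for p q :: "'a poly3" and k l
    using form_mult[OF that(1,2)] that(3) by simp
  have m4: "form 4 (p * q)" if "form k p" "form l q" "k + l = 4" for p q :: "'a poly3" and k l
    using form_mult[OF that(1,2)] that(3) by simp
  have m2: "form 2 (p * q)" if "form k p" "form l q" "k + l = 2" for p q :: "'a poly3" and k l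
    using form_mult[OF that(1,2)] that(3) by simp
  show ?thesis unfolding e
    by (intro form_add form_const3_mult tx m[OF tx(2) tx(3)]
         m[OF form_add[OF form_add[OF form_add[OF form_const3_mult[OF tx(2)] form_const3_mult[OF m4[OF tx(2) tx(3)]]] form_const3_mult[OF m4[OF tx(2) tx(3)]]] form_const3_mult[OF tx(3)]] tx(1)]
         m[OF form_add[OF form_add[OF form_const3_mult[OF m2[OF tx(2) tx(3)]] form_const3_mult[OF tx(3)]] form_const3_mult[OF tx(2)]] tx(1)]) simp_all
qed

text \<open>The gradients of the Weierstrass form at its nonzero zeros, listed in the order v, u, w
  of the sextic. These are coordinate vectors, not points up to scaling, so later scalars have to be
  absorbed into x, y, z.\<close>

definition permuted_tangents :: "'a::field \<Rightarrow> 'a \<Rightarrow> ('a ^ 3) set" where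
  "permuted_tangents a b = {vector [2 * y * z, - 3 * x\<^sup>2 - a * z\<^sup>2, y\<^sup>2 - 2 * a * x * z - 3 * b * z\<^sup>2] | x y z.
     y\<^sup>2 * z = x ^ 3 + a * x * z\<^sup>2 + b * z ^ 3 \<and> (x \<noteq> 0 \<or> y \<noteq> 0 \<or> z \<noteq> 0)}"

lemma sextic_scale: "sextic a b (c * v) (c * u) (c * w) = c ^ 6 * sextic a b v u w" for a :: "'a::field"
  unfolding sextic_def by Groebner_Basis.algebra

lemma sextic_tangent:
  fixes a b x y z :: "'a::field"
  assumes "y\<^sup>2 * z = x ^ 3 + a * x * z\<^sup>2 + b * z ^ 3"
  shows "sextic a b (2 * y * z) (- 3 * x\<^sup>2 - a * z\<^sup>2) (y\<^sup>2 - 2 * a * x * z - 3 * b * z\<^sup>2) = 0"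
proof (cases "z = 0")
  case True
  then show ?thesis using assms by (simp add: sextic_def)
next
  case False
  define p q where "p = x / z" and "q = y / z"
  have xy: "x = p * z" "y = q * z" using False by (simp_all add: p_def q_def)
  have "z ^ 3 * q\<^sup>2 = z ^ 3 * (p ^ 3 + a * p + b)"
    using assms unfolding xy by (simp add: algebra_simps power2_eq_square power3_eq_cube)
  then have q2: "q\<^sup>2 = p ^ 3 + a * p + b" using False by simp
  have q4: "q ^ 4 = (p ^ 3 + a * p + b)\<^sup>2" and q6: "q ^ 6 = (p ^ 3 + a * p + b) ^ 3"
    unfolding q2[symmetric] by (simp_all flip: power_mult)
  have "sextic a b (2 * q) (- 3 * p\<^sup>2 - a) (q\<^sup>2 - 2 * a * p - 3 * b) = 0"
    unfolding sextic_def power_mult_distrib q2 q4 q6 by Groebner_Basis.algebra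
  then have "sextic a b (z\<^sup>2 * (2 * q)) (z\<^sup>2 * (- 3 * p\<^sup>2 - a)) (z\<^sup>2 * (q\<^sup>2 - 2 * a * p - 3 * b)) = 0"
    by (simp add: sextic_scale)
  moreover have "z\<^sup>2 * (2 * q) = 2 * y * z" "z\<^sup>2 * (- 3 * p\<^sup>2 - a) = - 3 * x\<^sup>2 - a * z\<^sup>2"
    "z\<^sup>2 * (q\<^sup>2 - 2 * a * p - 3 * b) = y\<^sup>2 - 2 * a * x * z - 3 * b * z\<^sup>2"
    unfolding xy by (simp_all add: algebra_simps power2_eq_square)
  ultimately show ?thesis by simp
qed

section \<open>Six tangents in a general pencil of lines\<close>

lemma infinite_UNIV_alg_closed_field: "infinite (UNIV :: 'a::alg_closed_field set)"
proof
  assume fin: "finite (UNIV :: 'a set)"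
  define p :: "'a poly" where "p = (\<Prod>c\<in>UNIV. [:- c, 1:])"
  have "degree p = card (UNIV :: 'a set)"
    unfolding p_def by (subst degree_prod_eq_sum_degree) auto
  then have "degree p > 0"
    using fin by (simp add: card_gt_0_iff)
  then have "degree (p + 1) > 0"
    by (metis degree_1 degree_add_eq_left)
  then obtain x where "poly (p + 1) x = 0"
    using alg_closed_imp_poly_has_root by blast
  moreover have "poly p x = 0"
    unfolding p_def poly_prod using fin by (intro prod_zero bexI[of _ x]) auto
  ultimately show False by simp
qed

lemma sqrt_exists: "\<exists>y. y\<^sup>2 = x" for x :: "'a::alg_closed_field"
  using nth_root_exists[of 2 x] by auto

lemma four_nonzero: "(2::'a::idom) \<noteq> 0 \<Longrightarrow> (4::'a) \<noteq> 0"
  using no_zero_divisors[of "2::'a" 2] by simp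

lemma six_nonzero: "(2::'a::idom) \<noteq> 0 \<Longrightarrow> (3::'a) \<noteq> 0 \<Longrightarrow> (6::'a) \<noteq> 0"
  using no_zero_divisors[of "2::'a" 3] by simp

lemma no_common_root:
  fixes a b x :: "'a::field"
  assumes "4 * a ^ 3 + 27 * b\<^sup>2 \<noteq> 0" "x ^ 3 + a * x + b = 0"
  shows "3 * x\<^sup>2 + a \<noteq> 0"
proof
  assume "3 * x\<^sup>2 + a = 0"
  then have "a = - 3 * x\<^sup>2" by (simp add: eq_neg_iff_add_eq_0 add.commute)
  moreover from this have "b = 2 * x ^ 3" using assms(2) by Groebner_Basis.algebra
  ultimately have "4 * a ^ 3 + 27 * b\<^sup>2 = 0" by Groebner_Basis.algebra
  then show False using assms(1) by simp
qed

text \<open>The abscissas of the points whose tangent meets the line \<open>y = 0\<close> at \<open>c\<close> are the roots of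
  \<open>x\<^sup>3 - 3 c x\<^sup>2 - a x - (2 b + a c) = (x - c) f'(x) - 2 f(x)\<close>.\<close>

lemma generic_polar_roots:
  fixes a b :: "'a::alg_closed_field"
  assumes "(2::'a) \<noteq> 0" "(3::'a) \<noteq> 0" "a \<noteq> 0" "4 * a ^ 3 + 27 * b\<^sup>2 \<noteq> 0"
  obtains N where "finite N" "\<And>c. c \<notin> N \<Longrightarrow> \<exists>Xs. card Xs = 3 \<and>
    (\<forall>x\<in>Xs. x ^ 3 - 3 * c * x\<^sup>2 - a * x - (2 * b + a * c) = 0 \<and> x ^ 3 + a * x + b \<noteq> 0 \<and> 3 * x\<^sup>2 + a \<noteq> 0)"
proof
  \<comment> \<open>Eliminating \<open>c\<close> from the cubic and its derivative gives
    \<open>psi\<close>, minus the 3-division polynomial: a double root can only be the abscissa of a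
    flex. \<open>N\<close> collects the finitely many \<open>c\<close> belonging to such roots, and
    the roots of f.\<close>
  define psi where "psi = [:a\<^sup>2, - 12 * b, - 6 * a, 0, - 3:]"
  define f where "f = [:b, a, 0, 1:]"
  define N where "N = (\<lambda>x. (3 * x\<^sup>2 - a) / (6 * x)) ` {x. poly psi x = 0} \<union> {x. poly f x = 0}"
  have pf: "poly psi x = - 3 * x ^ 4 - 6 * a * x\<^sup>2 - 12 * b * x + a\<^sup>2" "poly f x = x ^ 3 + a * x + b" for x
    by (simp_all add: psi_def f_def algebra_simps power2_eq_square eval_nat_numeral)
  have "psi \<noteq> 0" "f \<noteq> 0" using assms by (simp_all add: psi_def f_def)
  then show "finite N" unfolding N_def by (intro finite_UnI finite_imageI poly_roots_finite)
  fix c assume c: "c \<notin> N"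
  define h where "h x = x ^ 3 - 3 * c * x\<^sup>2 - a * x - (2 * b + a * c)" for x
  note six = six_nonzero[OF assms(1,2)]
  have nd: False if "h x = 0" "3 * x\<^sup>2 - 6 * c * x - a = 0" for x
  proof -
    have "poly psi x = 0"
      unfolding pf using that unfolding h_def by Groebner_Basis.algebra
    moreover have "x \<noteq> 0"
      using that(2) assms(3) by auto
    then have "c = (3 * x\<^sup>2 - a) / (6 * x)"
      using that(2) six by (simp add: field_simps)
    ultimately show False using c by (auto simp: N_def)
  qed
  have fne: "x ^ 3 + a * x + b \<noteq> 0" if "h x = 0" for x
  proof
    assume f0: "x ^ 3 + a * x + b = 0"
    have "(x - c) * (3 * x\<^sup>2 + a) = 0"
      using that f0 unfolding h_def by Groebner_Basis.algebra
    then have "x = c" using no_common_root[OF assms(4) f0] by simp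
    then show False using c f0 by (auto simp: N_def pf)
  qed
  have dne: "3 * x\<^sup>2 + a \<noteq> 0" if "h x = 0" for x
  proof
    assume "3 * x\<^sup>2 + a = 0"
    then have "2 * (x ^ 3 + a * x + b) = 0"
      using that unfolding h_def by Groebner_Basis.algebra
    then show False using fne[OF that] assms(1) mult_eq_0_iff by blast
  qed
  obtain x1 where x1: "h x1 = 0"
    using alg_closed_imp_poly_has_root[of "[:- (2 * b + a * c), - a, - 3 * c, 1:]"]
    by (auto simp: h_def algebra_simps power2_eq_square eval_nat_numeral)
  obtain x2 where x2: "x2\<^sup>2 + (x1 - 3 * c) * x2 + (x1\<^sup>2 - 3 * c * x1 - a) = 0"
    using alg_closed_imp_poly_has_root[of "[:x1\<^sup>2 - 3 * c * x1 - a, x1 - 3 * c, 1:]"]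
    by (auto simp: algebra_simps power2_eq_square)
  define x3 where "x3 = 3 * c - x1 - x2"
  have h2: "h x2 = 0" using x1 x2 unfolding h_def by Groebner_Basis.algebra
  have h3: "h x3 = 0" using x1 x2 unfolding h_def x3_def by Groebner_Basis.algebra
  have "x1 \<noteq> x2"
  proof
    assume "x1 = x2"
    have "3 * x1\<^sup>2 - 6 * c * x1 - a = 0" using x2 unfolding \<open>x1 = x2\<close>[symmetric] by Groebner_Basis.algebra
    then show False using nd x1 by blast
  qed
  moreover have "x1 \<noteq> x3"
  proof
    assume "x1 = x3"
    then have "x2 = 3 * c - 2 * x1" unfolding x3_def by Groebner_Basis.algebra
    then have "3 * x1\<^sup>2 - 6 * c * x1 - a = 0" using x2 by Groebner_Basis.algebra
    then show False using nd x1 by blast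
  qed
  moreover have "x2 \<noteq> x3"
  proof
    assume "x2 = x3"
    then have "x1 = 3 * c - 2 * x2" unfolding x3_def by Groebner_Basis.algebra
    then have "3 * x2\<^sup>2 - 6 * c * x2 - a = 0" using x2 by Groebner_Basis.algebra
    then show False using nd h2 by blast
  qed
  ultimately have "card {x1, x2, x3} = 3" by auto
  then show "\<exists>Xs. card Xs = 3 \<and>
    (\<forall>x\<in>Xs. x ^ 3 - 3 * c * x\<^sup>2 - a * x - (2 * b + a * c) = 0 \<and> x ^ 3 + a * x + b \<noteq> 0 \<and> 3 * x\<^sup>2 + a \<noteq> 0)"
    using x1 h2 h3 fne dne unfolding h_def[symmetric] by (intro exI[of _ "{x1, x2, x3}"]) auto
qed

text \<open>A line tangent at two points would meet the cubic with multiplicity at least 4.\<close>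

lemma no_bitangent:
  fixes a b :: "'a::field"
  assumes h: "\<And>i. i \<in> {x, x'} \<Longrightarrow> i ^ 3 - 3 * c * i\<^sup>2 - a * i - (2 * b + a * c) = 0"
    and f: "x ^ 3 + a * x + b \<noteq> 0" "x' ^ 3 + a * x' + b \<noteq> 0" and two: "(2::'a) \<noteq> 0"
    and eq: "(x ^ 3 + a * x + b) * (3 * x'\<^sup>2 + a)\<^sup>2 = (x' ^ 3 + a * x' + b) * (3 * x\<^sup>2 + a)\<^sup>2"
  shows "x = x'"
proof -
  \<comment> \<open>\<open>k\<close> is the squared slope of the tangent at abscissa
    \<open>x\<close>. By \<open>eq\<close> it is also that at \<open>x'\<close>, so the cubic f(X) -
    k (X - c)^2 would have double roots at both; if they differed, the degree would be too
    large.\<close>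
  define k where "k = (3 * x\<^sup>2 + a)\<^sup>2 / (4 * (x ^ 3 + a * x + b))"
  note four = four_nonzero[OF two]
  have "4 * (p / (4 * q)) * q = p" if "q \<noteq> 0" for p q :: 'a
    using that four by simp
  from this[OF f(1)] have kx: "4 * k * (x ^ 3 + a * x + b) = (3 * x\<^sup>2 + a)\<^sup>2"
    unfolding k_def .
  have "(x ^ 3 + a * x + b) * (4 * k * (x' ^ 3 + a * x' + b)) = (x ^ 3 + a * x + b) * (3 * x'\<^sup>2 + a)\<^sup>2"
    unfolding eq kx[symmetric] by Groebner_Basis.algebra
  then have "4 * k * (x' ^ 3 + a * x' + b) = (3 * x'\<^sup>2 + a)\<^sup>2"
    using f(1) mult_cancel_left by blast
  with kx have k1: "4 * k * (i ^ 3 + a * i + b) = (3 * i\<^sup>2 + a)\<^sup>2" if "i \<in> {x, x'}" for i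
    using that by blast
  have c1: "(i - c) * (3 * i\<^sup>2 + a) = 2 * (i ^ 3 + a * i + b)" if "i \<in> {x, x'}" for i
    using h[OF that] by Groebner_Basis.algebra
  have k2: "3 * i\<^sup>2 + a = 2 * k * (i - c)" if i: "i \<in> {x, x'}" for i
  proof -
    have "i ^ 3 + a * i + b \<noteq> 0" using i f by blast
    then have "(i - c) * (3 * i\<^sup>2 + a) \<noteq> 0" unfolding c1[OF i] using two mult_eq_0_iff by blast
    then have n: "3 * i\<^sup>2 + a \<noteq> 0" by simp
    have "(3 * i\<^sup>2 + a) * (3 * i\<^sup>2 + a - 2 * k * (i - c)) = 0"
      using c1[OF i] k1[OF i] by Groebner_Basis.algebra
    then show ?thesis using n by simp
  qed
  have k3: "i ^ 3 + a * i + b = k * (i - c)\<^sup>2" if i: "i \<in> {x, x'}" for i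
  proof -
    have "2 * (i ^ 3 + a * i + b - k * (i - c)\<^sup>2) = 0"
      using c1[OF i] k2[OF i] by Groebner_Basis.algebra
    then have "i ^ 3 + a * i + b - k * (i - c)\<^sup>2 = 0" using two mult_eq_0_iff by blast
    then show ?thesis by simp
  qed
  have k4: "3 * x\<^sup>2 + a = 2 * k * (x - c)" "3 * x'\<^sup>2 + a = 2 * k * (x' - c)"
    "x ^ 3 + a * x + b = k * (x - c)\<^sup>2" "x' ^ 3 + a * x' + b = k * (x' - c)\<^sup>2"
    by (simp_all add: k2 k3)
  define e where "e = x' - x"
  have x': "x' = x + e" by (simp add: e_def)
  have "e\<^sup>2 * (3 * x - k + e) = 0" "e * (2 * (3 * x - k) + 3 * e) = 0"
    using k4 unfolding x' by Groebner_Basis.algebra+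
  then have "e ^ 4 = 0" by Groebner_Basis.algebra
  then show ?thesis by (simp add: e_def)
qed

text \<open>A line [v:u:w] meets the axis y = 0 at abscissa -w/u. For a general such point there are
  three abscissas of tangency, each with two opposite ordinates; no two of the resulting tangents
  coincide, which yields as many values of v as the sextic has degree.\<close>

lemma generic_tangents:
  fixes a b :: "'a::alg_closed_field"
  assumes "(2::'a) \<noteq> 0" "(3::'a) \<noteq> 0" "a \<noteq> 0" "4 * a ^ 3 + 27 * b\<^sup>2 \<noteq> 0" "u \<noteq> 0"
  obtains N where "finite N"
    "\<And>w. w \<notin> N \<Longrightarrow> \<exists>V. card V = 6 \<and> (\<forall>v\<in>V. vector [v, u, w] \<in> permuted_tangents a b)"
proof -
  obtain N where N: "finite N" "\<And>c. c \<notin> N \<Longrightarrow> \<exists>Xs. card Xs = 3 \<and>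
    (\<forall>x\<in>Xs. x ^ 3 - 3 * c * x\<^sup>2 - a * x - (2 * b + a * c) = 0 \<and> x ^ 3 + a * x + b \<noteq> 0 \<and> 3 * x\<^sup>2 + a \<noteq> 0)"
    using generic_polar_roots[OF assms(1-4)] by metis
  show ?thesis
  proof (rule that)
    show "finite ((\<lambda>c. - c * u) ` N)" using N(1) by simp
    fix w assume "w \<notin> (\<lambda>c. - c * u) ` N"
    moreover define c where "c = - w / u"
    then have w: "w = - c * u" using assms(5) by simp
    ultimately have "c \<notin> N" by auto
    then obtain Xs where Xs: "card Xs = 3" and
      h: "\<And>x. x \<in> Xs \<Longrightarrow> x ^ 3 - 3 * c * x\<^sup>2 - a * x - (2 * b + a * c) = 0" and
      f: "\<And>x. x \<in> Xs \<Longrightarrow> x ^ 3 + a * x + b \<noteq> 0" and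
      d: "\<And>x. x \<in> Xs \<Longrightarrow> 3 * x\<^sup>2 + a \<noteq> 0"
      using N(2)[of c] by blast
    define r where "r x = (SOME y. y\<^sup>2 = x ^ 3 + a * x + b)" for x
    have r: "(r x)\<^sup>2 = x ^ 3 + a * x + b" for x
      unfolding r_def by (rule someI_ex[OF sqrt_exists])
    define v where "v x = - 2 * u * r x / (3 * x\<^sup>2 + a)" for x
    have v2: "(v x)\<^sup>2 * (3 * x\<^sup>2 + a)\<^sup>2 = 4 * u\<^sup>2 * (x ^ 3 + a * x + b)" if "x \<in> Xs" for x
      using d[OF that] r[of x] by (simp add: v_def power_mult_distrib power_divide)
    have v0: "v x \<noteq> 0" if "x \<in> Xs" for x
      using d[OF that] f[OF that] r[of x] assms(1,5) by (auto simp: v_def)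
    have ve: "x = x'" if x: "x \<in> Xs" "x' \<in> Xs" and e: "(v x)\<^sup>2 = (v x')\<^sup>2" for x x'
    proof (rule no_bitangent[of x x' c a b])
      have "4 * u\<^sup>2 \<noteq> 0" using assms(5) four_nonzero[OF assms(1)] by simp
      moreover have "4 * u\<^sup>2 * ((x ^ 3 + a * x + b) * (3 * x'\<^sup>2 + a)\<^sup>2)
         = 4 * u\<^sup>2 * ((x' ^ 3 + a * x' + b) * (3 * x\<^sup>2 + a)\<^sup>2)"
        using v2[OF x(1)] v2[OF x(2)] e by Groebner_Basis.algebra
      ultimately show "(x ^ 3 + a * x + b) * (3 * x'\<^sup>2 + a)\<^sup>2 = (x' ^ 3 + a * x' + b) * (3 * x\<^sup>2 + a)\<^sup>2"
        by simp
    qed (use x h f assms(1) in auto)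
    have neg: "v x \<noteq> - v x'" if x: "x \<in> Xs" "x' \<in> Xs" for x x'
    proof
      assume e: "v x = - v x'"
      then have "x = x'" using ve[OF x] by simp
      then have "2 * v x = 0" using e by simp
      then show False using v0[OF x(1)] assms(1) by simp
    qed
    have inj: "inj_on v Xs" by (rule inj_onI) (use ve in auto)
    have fin: "finite Xs" using Xs by (metis card.infinite zero_neq_numeral)
    have "card (v ` Xs \<union> (\<lambda>x. - v x) ` Xs) = card (v ` Xs) + card ((\<lambda>x. - v x) ` Xs)"
      using fin neg by (intro card_Un_disjoint) auto
    also have "card (v ` Xs) = 3" using card_image[OF inj] Xs by simp
    also have "card ((\<lambda>x. - v x) ` Xs) = 3"
      using card_image[of "\<lambda>x. - v x" Xs] inj Xs by (auto simp: inj_on_def)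
    finally have "card (v ` Xs \<union> (\<lambda>x. - v x) ` Xs) = 6" by simp
    moreover have "vector [v', u, w] \<in> permuted_tangents a b"
      if v': "v' \<in> v ` Xs \<union> (\<lambda>x. - v x) ` Xs" for v'
    proof -
      obtain x y where x: "x \<in> Xs" and y: "y\<^sup>2 = x ^ 3 + a * x + b" "v' = - 2 * u * y / (3 * x\<^sup>2 + a)"
      proof -
        obtain x where x: "x \<in> Xs" and "v' = v x \<or> v' = - v x" using v' by auto
        then show ?thesis
          using that[of x "r x"] that[of x "- r x"] r[of x] by (auto simp: v_def)
      qed
      \<comment> \<open>The tangent must have exactly the coordinates v', u, w. The gradient is
        quadratic in the point, so rescaling (x, y, 1) by this \<open>z\<close> adjusts the
        factor.\<close>
      obtain z where z: "z\<^sup>2 = - u / (3 * x\<^sup>2 + a)" using sqrt_exists by blast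
      have z0: "z \<noteq> 0" using z assms(5) d[OF x] by auto
      have "v' = 2 * y * z\<^sup>2" unfolding z by (simp add: y(2))
      then have e1: "v' = 2 * (z * y) * z" by (simp add: power2_eq_square)
      have z': "u = - z\<^sup>2 * (3 * x\<^sup>2 + a)" using z d[OF x] by simp
      have e2: "u = - 3 * (z * x)\<^sup>2 - a * z\<^sup>2" unfolding z' by Groebner_Basis.algebra
      have e3: "w = (z * y)\<^sup>2 - 2 * a * (z * x) * z - 3 * b * z\<^sup>2"
        unfolding w z' using h[OF x] y(1) by Groebner_Basis.algebra
      have "(z * y)\<^sup>2 * z = (z * x) ^ 3 + a * (z * x) * z\<^sup>2 + b * z ^ 3"
        using y(1) by Groebner_Basis.algebra
      then show ?thesis
        unfolding permuted_tangents_def using e1 e2 e3 z0 by blast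
    qed
    ultimately show "\<exists>V. card V = 6 \<and> (\<forall>v\<in>V. vector [v, u, w] \<in> permuted_tangents a b)" by blast
  qed
qed

lemma eval1_eval1_id: "eval1 (eval1 id w) u q = poly (poly q [:u:]) w" for w :: "'a::comm_ring_1"
  by (induction q) (simp_all add: eval1_0 eval1_pCons ring_morphism_eval1 ring_morphism_id, simp add: eval1_def)

lemma degree_dual_sextic:
  fixes a b :: "'a::field"
  assumes "4 * a ^ 3 + 27 * b\<^sup>2 \<noteq> 0"
  shows "degree (dual_sextic a b) = 6" "Polynomial.lead_coeff (dual_sextic a b) = [:[:- (4 * a ^ 3 + 27 * b\<^sup>2):]:]"
proof -
  have "- 4 * [:[:a:]:] ^ 3 - 27 * [:[:b:]:]\<^sup>2 = [:[:- (4 * a ^ 3 + 27 * b\<^sup>2):]:]"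
    by (simp add: power2_eq_square power3_eq_cube numeral_poly)
  moreover have "[:[:- (4 * a ^ 3 + 27 * b\<^sup>2):]:] \<noteq> 0" using assms by (simp add: neg_eq_iff_add_eq_0)
  ultimately show "degree (dual_sextic a b) = 6" "Polynomial.lead_coeff (dual_sextic a b) = [:[:- (4 * a ^ 3 + 27 * b\<^sup>2):]:]"
    by (simp_all add: dual_sextic_def Let_def)
qed

text \<open>The leading coefficient in v is a nonzero constant, so pseudo-division leaves a
  remainder of degree less than 6 in v. At almost every (u, w) it has six roots, so all its
  coefficients vanish.\<close>

lemma dual_sextic_dvd:
  fixes a b :: "'a::alg_closed_field"
  assumes "(2::'a) \<noteq> 0" "(3::'a) \<noteq> 0" "a \<noteq> 0" "4 * a ^ 3 + 27 * b\<^sup>2 \<noteq> 0"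
    and H: "\<And>v. v \<in> permuted_tangents a b \<Longrightarrow> eval3 id H v = 0"
  shows "dual_sextic a b dvd H"
proof -
  let ?G = "dual_sextic a b"
  define d where "d = - (4 * a ^ 3 + 27 * b\<^sup>2)"
  have d0: "d \<noteq> 0" using assms(4) unfolding d_def by (subst neg_equal_0_iff_equal)
  have G0: "?G \<noteq> 0" using degree_dual_sextic(1)[OF assms(4)] by force
  obtain Q R where QR: "pseudo_divmod H ?G = (Q, R)" by fastforce
  define n where "n = Suc (degree H) - degree ?G"
  have QR1: "Polynomial.smult ([:[:d:]:] ^ n) H = ?G * Q + R" and "R = 0 \<or> degree R < 6"
    using pseudo_divmod[OF G0 QR] degree_dual_sextic[OF assms(4)] by (simp_all add: n_def d_def)
  then have dR: "degree R < 6" by auto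
  have sm: "Polynomial.smult ([:[:d:]:] ^ n) H = const3 (d ^ n) * H"
  proof -
    have "const3 (d ^ n) = const3 d ^ n"
      by (rule ring_morphism_power[OF ring_morphism_const3])
    also have "\<dots> = [:[:[:d:]:] ^ n:]"
      by (simp add: const3_def ring_morphism_power[OF ring_morphism_const_poly, symmetric])
    finally show ?thesis by simp
  qed
  note ri = ring_morphism_id(1)[where 'a = 'a]
  have R0: "eval3 id R v = 0" if v: "v \<in> permuted_tangents a b" for v
  proof -
    have "eval3 id (const3 (d ^ n) * H) v = eval3 id (?G * Q + R) v" using QR1 sm by simp
    moreover have "eval3 id ?G v = 0"
      using v sextic_tangent by (auto simp: eval3_dual_sextic[OF ri] permuted_tangents_def)
    ultimately show ?thesis using H[OF v] by (simp add: eval3_simps[OF ri])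
  qed
  have "coeff R i = 0" for i
  proof -
    have "poly (coeff R i) [:u:] = 0" if u: "u \<noteq> 0" for u
    proof -
      obtain N where N: "finite N"
        "\<And>w. w \<notin> N \<Longrightarrow> \<exists>V. card V = 6 \<and> (\<forall>v\<in>V. vector [v, u, w] \<in> permuted_tangents a b)"
        using generic_tangents[OF assms(1-4) u] by metis
      have "poly (poly (coeff R i) [:u:]) w = 0" if w: "w \<notin> N" for w
      proof -
        obtain V where V: "card V = 6" "\<And>v. v \<in> V \<Longrightarrow> vector [v, u, w] \<in> permuted_tangents a b"
          using N(2)[OF w] by blast
        define S where "S = map_poly (eval1 (eval1 id w) u) R"
        have "poly S v = 0" if "v \<in> V" for v
          using R0[OF V(2)[OF that]] by (simp add: eval3_eval1 eval1_def[of "eval1 (eval1 id w) u"] S_def)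
        then have "V \<subseteq> {v. poly S v = 0}" by blast
        moreover have "degree S \<le> degree R" unfolding S_def by (rule map_poly_degree_leq)
        ultimately have "S = 0"
          using dR V(1) by (metis card_mono card_poly_roots_bound poly_roots_finite not_less order_trans)
        then have "coeff S i = 0" by simp
        then show ?thesis
          by (simp add: S_def coeff_map_poly eval1_0 eval1_eval1_id)
      qed
      then have "- N \<subseteq> {w. poly (poly (coeff R i) [:u:]) w = 0}" by auto
      moreover have "infinite (- N)"
        using N(1) by (simp add: Compl_eq_Diff_UNIV infinite_UNIV_alg_closed_field)
      ultimately show ?thesis
        by (metis finite_subset poly_roots_finite)
    qed
    then have "(\<lambda>u. [:u:]) ` (- {0}) \<subseteq> {p. poly (coeff R i) p = 0}" by auto
    moreover have "infinite ((\<lambda>u. [:u:]) ` (- {0::'a}))"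
      by (subst finite_image_iff) (auto simp: inj_on_def Compl_eq_Diff_UNIV infinite_UNIV_alg_closed_field)
    ultimately show ?thesis
      by (metis finite_subset poly_roots_finite)
  qed
  then have "R = 0" by (simp add: poly_eq_iff)
  then have "?G dvd const3 (d ^ n) * H" using QR1 sm by simp
  then have "?G dvd const3 (inverse (d ^ n)) * (const3 (d ^ n) * H)" by (rule dvd_mult)
  also have "const3 (inverse (d ^ n)) * (const3 (d ^ n) * H) = H"
    using d0 by (simp add: mult.assoc[symmetric] ring_morphism_simps[OF ring_morphism_const3, symmetric])
  finally show ?thesis .
qed

section \<open>Transport from the Weierstrass form to the given cubic\<close>

lemma ring_morphism_map_poly:
  assumes "ring_morphism h"
  shows "ring_morphism (map_poly h)"
proof (rule ring_morphismI)
  show "map_poly h 1 = 1" by (simp add: map_poly_1 ring_morphism_simps[OF assms])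
  show "map_poly h (x + y) = map_poly h x + map_poly h y" for x y
    by (rule poly_eqI) (simp add: coeff_map_poly ring_morphism_simps[OF assms])
  show "map_poly h (x * y) = map_poly h x * map_poly h y" for x y
    by (rule poly_eqI) (simp add: coeff_map_poly coeff_mult ring_morphism_sum[OF assms] ring_morphism_simps[OF assms])
qed

lemma map_poly_const: "ring_morphism h \<Longrightarrow> map_poly h [:c:] = [:h c:]"
  by (simp add: map_poly_pCons ring_morphism_0)

lemma ring_morphism_sextic: "ring_morphism h \<Longrightarrow> h (sextic a b v u w) = sextic (h a) (h b) (h v) (h u) (h w)"
  by (simp add: sextic_def ring_morphism_simps)

text \<open>Reconciles the coordinates u, v, w of a line with the order v, u, w used for the
  sextic.\<close>

definition swap12 :: "'a::comm_ring_1 ^ 3 ^ 3" where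
  "swap12 = vector [vector [0, 1, 0], vector [1, 0, 0], vector [0, 0, 1]]"

lemma swap12_vector: "swap12 *v v = vector [v $ 2, v $ 1, v $ 3]"
  by (simp add: vec_eq_iff forall_3 swap12_def matrix_vector_mult_def sum_3)

lemma swap12_swap12: "swap12 ** swap12 = mat 1"
  by (simp add: vec_eq_iff forall_3 swap12_def matrix_matrix_mult_def sum_3 mat_def)

lemma map_mat_swap12: "ring_morphism h \<Longrightarrow> map_mat h swap12 = swap12"
  by (simp add: vec_eq_iff forall_3 swap12_def map_mat_def ring_morphism_simps)

lemma invertible_swap12: "invertible (swap12 :: 'a::comm_ring_1 ^ 3 ^ 3)"
  unfolding invertible_def using swap12_swap12 by blast

lemma matrix_vector_mult_smult: "A *v (k *s v) = k *s (A *v v)" for k :: "'a::comm_ring_1"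
  by (simp add: vec_eq_iff matrix_vector_mult_def sum_distrib_left mult_ac)

lemma map_mat_id: "map_mat id M = M"
  by (simp add: map_mat_def)

lemma gradient_weierstrass_form_scale:
  assumes "ring_morphism h"
  shows "gradient h (weierstrass_form a b) (k *s v) = k\<^sup>2 *s gradient h (weierstrass_form a b) v"
  by (simp add: gradient_weierstrass_form[OF assms] vec_eq_iff forall_3 algebra_simps power2_eq_square)

locale weierstrass_cubic =
  fixes F :: "'k::field poly3" and M :: "'k ^ 3 ^ 3" and c a b :: 'k
  assumes two: "(2::'k) \<noteq> 0" and three: "(3::'k) \<noteq> 0" and smooth: "smooth_cubic F"
    and inv_M: "invertible M" and c_nz: "c \<noteq> 0"
    and model: "linear_substitution M F = const3 c * weierstrass_form a b"
    and a_nz: "a \<noteq> 0" and disc_nz: "4 * a ^ 3 + 27 * b\<^sup>2 \<noteq> 0"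
begin

text \<open>\<open>line_matrix\<close> carries the coordinates of a line to those of its preimage under \<open>M\<close>, with the
  first two interchanged.\<close>

definition line_matrix :: "'k ^ 3 ^ 3" where
  "line_matrix = swap12 ** transpose M"

lemma invertible_line_matrix: "invertible line_matrix"
  unfolding line_matrix_def by (intro invertible_mult invertible_swap12 invertible_transpose inv_M)

lemma eval3_model:
  assumes h: "ring_morphism h"
  shows "eval3 h F (map_mat h M *v v) = h c * eval3 h (weierstrass_form a b) v"
  unfolding eval3_linear_substitution[OF h, symmetric] model
  by (simp add: eval3_simps[OF h] eval3_const3[OF h])

lemma line_matrix_gradient:
  assumes h: "ring_morphism h"
  shows "map_mat h line_matrix *v gradient h F (map_mat h M *v v)
     = h c *s (swap12 *v gradient h (weierstrass_form a b) v)"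
proof -
  have "map_mat h line_matrix *v gradient h F (map_mat h M *v v)
     = swap12 *v (transpose (map_mat h M) *v gradient h F (map_mat h M *v v))"
    unfolding line_matrix_def map_mat_mult[OF h] map_mat_swap12[OF h] map_mat_transpose
    by (simp only: matrix_vector_mul_assoc)
  also have "transpose (map_mat h M) *v gradient h F (map_mat h M *v v) = h c *s gradient h (weierstrass_form a b) v"
    unfolding gradient_linear_substitution[OF h, symmetric] model gradient_const3_mult[OF h] ..
  finally show ?thesis by (simp only: matrix_vector_mult_smult)
qed

abbreviation "M' \<equiv> map_mat to_ac M"
abbreviation "N' \<equiv> map_mat to_ac line_matrix"

lemma swap12_gradient_permuted:
  fixes v :: "'k alg_closure ^ 3"
  assumes "v \<noteq> 0" "eval3 to_ac (weierstrass_form a b) v = 0"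
  shows "swap12 *v gradient to_ac (weierstrass_form a b) v \<in> permuted_tangents (to_ac a) (to_ac b)"
proof -
  have "v $ 1 \<noteq> 0 \<or> v $ 2 \<noteq> 0 \<or> v $ 3 \<noteq> 0"
    using assms(1) by (auto simp: vec_eq_iff forall_3)
  moreover have "(v $ 2)\<^sup>2 * v $ 3 = (v $ 1) ^ 3 + to_ac a * v $ 1 * (v $ 3)\<^sup>2 + to_ac b * (v $ 3) ^ 3"
    using assms(2) by (simp add: eval3_weierstrass_form[OF ring_morphism_to_ac] algebra_simps)
  ultimately show ?thesis
    unfolding permuted_tangents_def swap12_vector gradient_weierstrass_form[OF ring_morphism_to_ac] vector_3
    by blast
qed

lemma tangent_lines_permuted:
  assumes "s \<in> tangent_lines F"
  obtains p where "p \<in> permuted_tangents (to_ac a) (to_ac b)" "N' *v s = to_ac c *s p"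
proof -
  obtain v where v: "s = gradient to_ac F v" "v \<noteq> 0" "eval3 to_ac F v = 0"
    using assms by (auto simp: tangent_lines_def)
  have iM: "invertible M'" by (rule invertible_map_mat[OF ring_morphism_to_ac inv_M])
  then obtain B where B: "M' ** B = mat 1" unfolding invertible_def by blast
  define v' where "v' = B *v v"
  have v': "v = M' *v v'" unfolding v'_def by (simp add: matrix_vector_mul_assoc B)
  then have "v' \<noteq> 0" using v(2) by auto
  moreover have "eval3 to_ac (weierstrass_form a b) v' = 0"
    using v(3) c_nz unfolding v' eval3_model[OF ring_morphism_to_ac] by simp
  ultimately show ?thesis
    using that[OF swap12_gradient_permuted] unfolding v(1) v' line_matrix_gradient[OF ring_morphism_to_ac] by blast
qed

lemma permuted_tangent_lines:
  assumes "p \<in> permuted_tangents (to_ac a) (to_ac b)"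
  obtains s where "s \<in> tangent_lines F" "N' *v s = p"
proof -
  obtain x y z where xyz: "y\<^sup>2 * z = x ^ 3 + to_ac a * x * z\<^sup>2 + to_ac b * z ^ 3" "x \<noteq> 0 \<or> y \<noteq> 0 \<or> z \<noteq> 0"
    and p: "p = vector [2 * y * z, - 3 * x\<^sup>2 - to_ac a * z\<^sup>2, y\<^sup>2 - 2 * to_ac a * x * z - 3 * to_ac b * z\<^sup>2]"
    using assms by (auto simp: permuted_tangents_def)
  define v1 :: "'k alg_closure ^ 3" where "v1 = vector [x, y, z]"
  have p': "p = swap12 *v gradient to_ac (weierstrass_form a b) v1"
    unfolding p swap12_vector gradient_weierstrass_form[OF ring_morphism_to_ac] by (simp add: v1_def)
  have v1: "v1 \<noteq> 0" "eval3 to_ac (weierstrass_form a b) v1 = 0"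
    using xyz by (auto simp: v1_def eval3_weierstrass_form[OF ring_morphism_to_ac] vec_eq_iff forall_3)
  \<comment> \<open>The model carries a factor \<open>c\<close>; scaling the point by
    \<open>k\<close> multiplies the quadratic gradient by k^2 and cancels it.\<close>
  obtain k where k: "k\<^sup>2 = 1 / to_ac c" using sqrt_exists by blast
  have k0: "k \<noteq> 0" using k c_nz by auto
  define s where "s = gradient to_ac F (M' *v (k *s v1))"
  have iM: "invertible M'" by (rule invertible_map_mat[OF ring_morphism_to_ac inv_M])
  have "k *s v1 \<noteq> 0" using k0 v1(1) by simp
  then have "M' *v (k *s v1) \<noteq> 0" by (simp add: invertible_mult_eq_0_iff[OF iM])
  moreover have "eval3 to_ac F (M' *v (k *s v1)) = 0"
  proof -
    have "eval3 to_ac (weierstrass_form a b) (k *s v1) = k ^ 3 * eval3 to_ac (weierstrass_form a b) v1"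
      unfolding eval3_weierstrass_form[OF ring_morphism_to_ac] vector_smult_component by Groebner_Basis.algebra
    then show ?thesis unfolding eval3_model[OF ring_morphism_to_ac] v1(2) by simp
  qed
  ultimately have "s \<in> tangent_lines F" by (auto simp: tangent_lines_def s_def)
  moreover have "N' *v s = p"
    unfolding s_def line_matrix_gradient[OF ring_morphism_to_ac] p'
      gradient_weierstrass_form_scale[OF ring_morphism_to_ac] k matrix_vector_mult_smult[symmetric]
    using c_nz by (simp add: vector_smult_assoc)
  ultimately show ?thesis by (rule that)
qed

definition dual_equation :: "'k alg_closure poly3" where
  "dual_equation = linear_substitution N' (dual_sextic (to_ac a) (to_ac b))"

lemma eval3_dual_equation:
  assumes "ring_morphism h"
  shows "eval3 h dual_equation v = eval3 h (dual_sextic (to_ac a) (to_ac b)) (map_mat h N' *v v)"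
  unfolding dual_equation_def by (rule eval3_linear_substitution[OF assms])

lemma nonzero_consts:
  "(2 :: 'k alg_closure) \<noteq> 0" "(3 :: 'k alg_closure) \<noteq> 0" "to_ac a \<noteq> 0"
  "4 * (to_ac a) ^ 3 + 27 * (to_ac b)\<^sup>2 \<noteq> 0"
proof -
  have "to_ac (2::'k) \<noteq> 0" "to_ac (3::'k) \<noteq> 0" "to_ac (4 * a ^ 3 + 27 * b\<^sup>2) \<noteq> 0"
    using two three disc_nz by (simp_all only: to_ac_eq_0_iff not_False_eq_True)
  then show "(2 :: 'k alg_closure) \<noteq> 0" "(3 :: 'k alg_closure) \<noteq> 0" "to_ac a \<noteq> 0"
    "4 * (to_ac a) ^ 3 + 27 * (to_ac b)\<^sup>2 \<noteq> 0"
    using a_nz by simp_all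
qed

text \<open>A form vanishes on a Zariski closure exactly when it vanishes on the original set, so
  only the tangents themselves matter. Smoothness makes their vectors nonzero, and an invertible
  substitution moves the divisibility statement to the Weierstrass form.\<close>

theorem curve_equation_dual_equation: "curve_equation 6 dual_equation (dual_curve F)"
proof -
  note ri = ring_morphism_id(1)[where 'a = "'k alg_closure"]
  have iN: "invertible N'" by (rule invertible_map_mat[OF ring_morphism_to_ac invertible_line_matrix])
  then obtain B where B: "N' ** B = mat 1" "B ** N' = mat 1" unfolding invertible_def by blast
  have ls1: "linear_substitution N' (linear_substitution B p) = p"
    and ls2: "linear_substitution B (linear_substitution N' p) = p" for p
    by (simp_all add: linear_substitution_comp B linear_substitution_one)
  have vanish: "eval3 id dual_equation s = 0" if st: "s \<in> tangent_lines F" for s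
  proof -
    obtain p where p: "p \<in> permuted_tangents (to_ac a) (to_ac b)" "N' *v s = to_ac c *s p"
      by (rule tangent_lines_permuted[OF st])
    have "eval3 id (dual_sextic (to_ac a) (to_ac b)) p = 0"
      using p(1) sextic_tangent by (auto simp: eval3_dual_sextic[OF ri] permuted_tangents_def)
    then show ?thesis
      unfolding eval3_dual_equation[OF ri] map_mat_id p(2) eval3_scale[OF form_dual_sextic ri] by simp
  qed
  have "dual_equation \<noteq> 0"
  proof
    assume "dual_equation = 0"
    then have "dual_sextic (to_ac a) (to_ac b) = (0 :: 'k alg_closure poly3)"
      using ls2[of "dual_sextic (to_ac a) (to_ac b)"]
      by (simp add: dual_equation_def ring_morphism_0[OF ring_morphism_linear_substitution])
    then show False using degree_dual_sextic(1)[OF nonzero_consts(4)] by simp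
  qed
  moreover have "form 6 dual_equation"
    unfolding dual_equation_def by (intro form_linear_substitution form_dual_sextic)
  moreover have "(\<forall>v\<in>dual_curve F. eval3 id H v = 0) \<longleftrightarrow> dual_equation dvd H" if H: "form m H" for m H
  proof
    assume "dual_equation dvd H"
    then have "eval3 id H s = 0" if "s \<in> tangent_lines F" for s
      using vanish[OF that] by (auto elim!: dvdE simp: eval3_simps[OF ri])
    then show "\<forall>v\<in>dual_curve F. eval3 id H v = 0"
      using H unfolding dual_curve_def zariski_closure_def by blast
  next
    assume *: "\<forall>v\<in>dual_curve F. eval3 id H v = 0"
    have "eval3 id (linear_substitution B H) p = 0" if pt: "p \<in> permuted_tangents (to_ac a) (to_ac b)" for p
    proof -
      obtain s where s: "s \<in> tangent_lines F" "N' *v s = p" by (rule permuted_tangent_lines[OF pt])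
      have "s \<noteq> 0" using s(1) smooth by (auto simp: tangent_lines_def smooth_cubic_def)
      then have "s \<in> dual_curve F"
        using s(1) by (auto simp: dual_curve_def zariski_closure_def)
      then have "eval3 id H s = 0" using * by blast
      moreover have "B *v p = s" unfolding s(2)[symmetric] by (simp add: matrix_vector_mul_assoc B)
      ultimately show ?thesis by (simp add: eval3_linear_substitution[OF ri] map_mat_id)
    qed
    from dual_sextic_dvd[OF nonzero_consts this]
    obtain Q where "linear_substitution B H = dual_sextic (to_ac a) (to_ac b) * Q" by (auto elim: dvdE)
    then have "linear_substitution N' (linear_substitution B H) = dual_equation * linear_substitution N' Q"
      by (simp add: dual_equation_def ring_morphism_mult[OF ring_morphism_linear_substitution])
    then show "dual_equation dvd H" unfolding ls1 by simp
  qed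
  ultimately show ?thesis unfolding curve_equation_def by blast
qed

text \<open>A nonzero polynomial which becomes a square after multiplication by a square has even
  order at every geometric point and even degree. The point at infinity causes no trouble because
  the degree 6 of the dual equation is even.\<close>

lemma even_intersectionI:
  assumes L: "map_mat (\<lambda>c. [:c:]) line_matrix *v L = vector [v, u, w]"
    and d: "- 3 * sextic [:a:] [:b:] v u w * e\<^sup>2 = d\<^sup>2" "d \<noteq> 0"
  shows "even_intersection F L"
proof -
  define g where "g = eval3 (\<lambda>x. [:x:]) dual_equation (geometric_param L)"
  define h where "h = (map_poly to_ac :: 'k poly \<Rightarrow> 'k alg_closure poly)"
  have rh: "ring_morphism h" unfolding h_def by (rule ring_morphism_map_poly[OF ring_morphism_to_ac])
  have hc: "h [:x:] = [:to_ac x:]" for x unfolding h_def by (rule map_poly_const[OF ring_morphism_to_ac])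
  have "map_mat (\<lambda>c. [:c:]) N' = map_mat h (map_mat (\<lambda>c. [:c:]) line_matrix)"
    by (simp add: map_mat_comp hc)
  moreover have "geometric_param L = (\<chi> i. h (L $ i))"
    by (simp add: geometric_param_def h_def)
  ultimately have "map_mat (\<lambda>c. [:c:]) N' *v geometric_param L = (\<chi> i. h (vector [v, u, w] $ i))"
    by (simp only: map_mat_vector_mult[OF rh] L)
  then have "g = sextic [:to_ac a:] [:to_ac b:] (h v) (h u) (h w)"
    unfolding g_def eval3_dual_equation[OF ring_morphism_const_poly]
    by (simp add: eval3_dual_sextic[OF ring_morphism_const_poly])
  also have "\<dots> = h (sextic [:a:] [:b:] v u w)"
    by (simp add: ring_morphism_sextic[OF rh] hc)
  finally have g: "(- 3 * g) * (h e)\<^sup>2 = (h d)\<^sup>2"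
    using arg_cong[OF d(1), of h] by (simp add: ring_morphism_simps[OF rh])
  have hd: "h d \<noteq> 0" using d(2) by (simp add: h_def poly_eq_iff coeff_map_poly)
  have he: "h e \<noteq> 0" using g hd by auto
  have g0: "g \<noteq> 0" using g hd by auto
  have n3: "- 3 \<noteq> (0 :: 'k alg_closure)" using nonzero_consts(2) by simp
  have g3: "- 3 * g = Polynomial.smult (- 3) g"
    by (simp add: numeral_poly)
  have g30: "- 3 * g \<noteq> 0" unfolding g3 using g0 n3 by simp
  have "Polynomial.order t (- 3 * g) + 2 * Polynomial.order t (h e) = 2 * Polynomial.order t (h d)" for t
    using arg_cong[OF g, of "Polynomial.order t"] g30 hd he by (simp add: power2_eq_square order_mult)
  moreover have "Polynomial.order t (- 3 * g) = Polynomial.order t g" for t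
    unfolding g3 using n3 by (rule order_smult)
  ultimately have "even (Polynomial.order t g)" for t
    by (metis even_add even_mult_iff even_numeral)
  moreover have "degree (- 3 * g) + 2 * degree (h e) = 2 * degree (h d)"
    using arg_cong[OF g, of degree] g30 hd he by (simp add: power2_eq_square degree_mult_eq)
  then have "degree g + 2 * degree (h e) = 2 * degree (h d)"
    unfolding g3 using n3 by simp
  then have "even (degree g)"
    by (metis even_add even_mult_iff even_numeral)
  then have "even (6 * param_degree L - degree g)"
    \<comment> \<open>If the subtraction of natural numbers were truncated, its value 0 would be
      even too.\<close>
    by (cases "degree g \<le> 6 * param_degree L") auto
  ultimately show ?thesis
    unfolding even_intersection_def Let_def using curve_equation_dual_equation g0 unfolding g_def
    by (intro exI[of _ "6 :: nat"] exI[of _ dual_equation]) blast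
qed

end

section \<open>Doubling points of \<open>y\<^sup>2 = x\<^sup>3 + \<alpha> x + \<beta>\<close> over a rational function field\<close>

text \<open>The tangent construction for x = r / s^2, y = w / s^3, with slope m / (2 w s).
  Denominators are cleared and nothing is cancelled.\<close>

definition double_point :: "'a::comm_ring_1 \<Rightarrow> 'a \<times> 'a \<times> 'a \<Rightarrow> 'a \<times> 'a \<times> 'a" where
  "double_point \<alpha> = (\<lambda>(r, w, s). let m = 3 * r\<^sup>2 + \<alpha> * s ^ 4; r' = m\<^sup>2 - 8 * r * w\<^sup>2 in
     (r', m * (4 * r * w\<^sup>2 - r') - 8 * w ^ 4, 2 * w * s))"

lemma double_point_on_curve:
  fixes r w s \<alpha> \<beta> :: "'a::idom"
  assumes "w\<^sup>2 = r ^ 3 + \<alpha> * r * s ^ 4 + \<beta> * s ^ 6" "double_point \<alpha> (r, w, s) = (r', w', s')"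
  shows "w'\<^sup>2 = r' ^ 3 + \<alpha> * r' * s' ^ 4 + \<beta> * s' ^ 6"
proof -
  define m where "m = 3 * r\<^sup>2 + \<alpha> * s ^ 4"
  have r': "r' = m\<^sup>2 - 8 * r * w\<^sup>2" and w': "w' = m * (4 * r * w\<^sup>2 - r') - 8 * w ^ 4" and s': "s' = 2 * w * s"
    using assms(2) by (auto simp: double_point_def m_def Let_def)
  have "\<beta> * s' ^ 6 = 64 * w ^ 6 * (\<beta> * s ^ 6)" unfolding s' by Groebner_Basis.algebra
  also have "\<beta> * s ^ 6 = w\<^sup>2 - r ^ 3 - \<alpha> * r * s ^ 4" using assms(1) by simp
  also have "\<alpha> * s ^ 4 = m - 3 * r\<^sup>2" by (simp add: m_def)
  then have "w\<^sup>2 - r ^ 3 - \<alpha> * r * s ^ 4 = w\<^sup>2 + 2 * r ^ 3 - m * r" by Groebner_Basis.algebra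
  finally have b: "\<beta> * s' ^ 6 = 64 * w ^ 6 * (w\<^sup>2 + 2 * r ^ 3 - m * r)" .
  have "\<alpha> * r' * s' ^ 4 = 16 * w ^ 4 * r' * (\<alpha> * s ^ 4)" unfolding s' by Groebner_Basis.algebra
  then have a: "\<alpha> * r' * s' ^ 4 = 16 * w ^ 4 * r' * (m - 3 * r\<^sup>2)" by (simp add: m_def)
  show ?thesis unfolding a b
    unfolding w' r' by Groebner_Basis.algebra
qed

text \<open>Reduction modulo a place is a homomorphism on nonsingular points, so the double of a point
  with nonsingular reduction has nonsingular reduction.  Explicitly, if \<open>e\<close> is the abscissa of a
  singular point of \<open>y\<^sup>2 = (x - e)\<^sup>2 (x + 2 e)\<close> and of the double of \<open>(x, y)\<close>, then \<open>x = e\<close>.\<close>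

lemma double_point_nonsingular:
  fixes r w s \<alpha> \<beta> :: "'a::field"
  assumes two: "(2::'a) \<noteq> 0" and three: "(3::'a) \<noteq> 0"
    and eq: "w\<^sup>2 = r ^ 3 + \<alpha> * r * s ^ 4 + \<beta> * s ^ 6" and d: "double_point \<alpha> (r, w, s) = (r', w', s')"
    and rs: "r \<noteq> 0 \<or> s \<noteq> 0" and wm: "w \<noteq> 0 \<or> 3 * r\<^sup>2 + \<alpha> * s ^ 4 \<noteq> 0"
  shows "r' \<noteq> 0 \<or> s' \<noteq> 0" and "w' \<noteq> 0 \<or> 3 * r'\<^sup>2 + \<alpha> * s' ^ 4 \<noteq> 0"
proof -
  have r': "r' = (3 * r\<^sup>2 + \<alpha> * s ^ 4)\<^sup>2 - 8 * r * w\<^sup>2" and s': "s' = 2 * w * s"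
    using d by (auto simp: double_point_def Let_def)
  show 1: "r' \<noteq> 0 \<or> s' \<noteq> 0"
  proof (cases "s = 0")
    case True
    then have "r' = (3 * r\<^sup>2)\<^sup>2 - 8 * r * r ^ 3" unfolding r' eq by simp
    also have "\<dots> = r ^ 4" by Groebner_Basis.algebra
    finally show ?thesis using True rs by simp
  next
    case False
    then show ?thesis using two wm r' s' by (cases "w = 0") auto
  qed
  show "w' \<noteq> 0 \<or> 3 * r'\<^sup>2 + \<alpha> * s' ^ 4 \<noteq> 0"
  proof (rule ccontr)
    assume "\<not> ?thesis"
    then have z: "w' = 0" "3 * r'\<^sup>2 + \<alpha> * s' ^ 4 = 0" by auto
    have s0: "s' \<noteq> 0"
    proof
      assume "s' = 0"
      then have "3 * r'\<^sup>2 = 0" using z(2) by simp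
      then show False using 1 three \<open>s' = 0\<close> by simp
    qed
    then have ws: "w \<noteq> 0" "s \<noteq> 0" unfolding s' by auto
    define e where "e = r' / s'\<^sup>2"
    define x where "x = r / s\<^sup>2"
    define y where "y = w / s ^ 3"
    have e: "r' = e * s'\<^sup>2" using s0 by (simp add: e_def)
    have x: "r = x * s\<^sup>2" "w = y * s ^ 3" using ws by (simp_all add: x_def y_def)
    have "s' ^ 4 * (\<alpha> + 3 * e\<^sup>2) = 0" using z(2) unfolding e by Groebner_Basis.algebra
    then have "\<alpha> + 3 * e\<^sup>2 = 0" using s0 by simp
    then have a: "\<alpha> = - 3 * e\<^sup>2" by Groebner_Basis.algebra
    have "s' ^ 6 * (\<beta> - 2 * e ^ 3) = 0"
      using double_point_on_curve[OF eq d] z(1) unfolding e a by Groebner_Basis.algebra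
    then have b: "\<beta> = 2 * e ^ 3" using s0 by simp
    have "s ^ 6 * (y\<^sup>2 - (x - e)\<^sup>2 * (x + 2 * e)) = 0"
      using eq unfolding x a b by Groebner_Basis.algebra
    then have y2: "y\<^sup>2 = (x - e)\<^sup>2 * (x + 2 * e)" using ws by simp
    have "s ^ 8 * (4 * y\<^sup>2 * e - ((3 * x\<^sup>2 - 3 * e\<^sup>2)\<^sup>2 - 8 * x * y\<^sup>2)) = 0"
      using r' unfolding e s' x a by Groebner_Basis.algebra
    then have "4 * y\<^sup>2 * e - ((3 * x\<^sup>2 - 3 * e\<^sup>2)\<^sup>2 - 8 * x * y\<^sup>2) = 0" using ws by simp
    then have "(x - e) ^ 4 = 0" unfolding y2 by Groebner_Basis.algebra
    then have "y = 0" using y2 by simp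
    then show False using ws x by simp
  qed
qed

text \<open>Specialization at a geometric point of the t-line; the ground field need not contain the
  zeros and poles in question.\<close>

definition value_at :: "'k::field alg_closure \<Rightarrow> 'k poly \<Rightarrow> 'k alg_closure" where
  "value_at t = eval1 to_ac t"

lemma ring_morphism_value_at: "ring_morphism (value_at t)"
  unfolding value_at_def by (rule ring_morphism_eval1[OF ring_morphism_to_ac])

lemmas value_at_simps = ring_morphism_simps[OF ring_morphism_value_at]

lemma value_at_root_exists:
  assumes "degree p > 0"
  obtains t where "value_at t p = 0"
proof -
  have "degree (map_poly to_ac p) = degree p" by (rule degree_map_poly) simp
  then show ?thesis
    using assms that alg_closed_imp_poly_has_root[of "map_poly to_ac p"]
    by (auto simp: value_at_def eval1_def)
qed

text \<open>A point \<open>(r / s\<^sup>2, w / s\<^sup>3)\<close> in lowest terms which is nonsingular modulo every place and meets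
  the zero section at infinity.\<close>

definition integral_point :: "'k::field poly \<Rightarrow> 'k poly \<Rightarrow> 'k poly \<times> 'k poly \<times> 'k poly \<Rightarrow> bool" where
  "integral_point \<alpha> \<beta> = (\<lambda>(r, w, s). w\<^sup>2 = r ^ 3 + \<alpha> * r * s ^ 4 + \<beta> * s ^ 6 \<and> s \<noteq> 0 \<and>
     degree r = 2 * degree s + 6 \<and> (\<forall>t. value_at t r \<noteq> 0 \<or> value_at t s \<noteq> 0) \<and>
     (\<forall>t. value_at t w \<noteq> 0 \<or> value_at t (3 * r\<^sup>2 + \<alpha> * s ^ 4) \<noteq> 0))"

lemma degree_numeral_mult: "(numeral n :: 'a) \<noteq> 0 \<Longrightarrow> degree (numeral n * p) = degree p" for p :: "'a::field poly"
  by (simp add: numeral_poly)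

lemma degree_numeral_mult_le: "degree (numeral n * p) \<le> degree p" for p :: "'a::field poly"
  by (simp add: numeral_poly degree_smult_le)

text \<open>The pole at infinity makes r^3, of degree 6 deg s + 18, dominate the right-hand side:
  the other terms have degree at most 6 deg s + 14.\<close>

lemma integral_point_degree:
  assumes "integral_point \<alpha> \<beta> (r, w, s)" "degree \<alpha> \<le> 8" "degree \<beta> \<le> 12"
  shows "degree w = 3 * degree s + 9"
proof -
  have i: "w\<^sup>2 = r ^ 3 + \<alpha> * r * s ^ 4 + \<beta> * s ^ 6" "s \<noteq> 0" "degree r = 2 * degree s + 6"
    using assms(1) by (auto simp: integral_point_def)
  then have r0: "r \<noteq> 0" by auto
  have "degree (\<alpha> * r * s ^ 4) \<le> 8 + (2 * degree s + 6) + 4 * degree s"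
    by (intro order.trans[OF degree_mult_le] add_mono order.trans[OF degree_power_le])
       (use assms(2) i(3) in auto)
  moreover have "degree (\<beta> * s ^ 6) \<le> 12 + 6 * degree s"
    by (intro order.trans[OF degree_mult_le] add_mono order.trans[OF degree_power_le])
       (use assms(3) in auto)
  ultimately have "degree (\<alpha> * r * s ^ 4 + \<beta> * s ^ 6) \<le> 14 + 6 * degree s"
    by (intro degree_add_le) auto
  moreover have "degree (r ^ 3) = 6 * degree s + 18"
    using r0 i(3) by (simp add: degree_power_eq)
  ultimately have "degree (r ^ 3 + (\<alpha> * r * s ^ 4 + \<beta> * s ^ 6)) = 6 * degree s + 18"
    by (subst degree_add_eq_left) auto
  then have "degree (w\<^sup>2) = 6 * degree s + 18"
    unfolding i(1) by (simp add: add.assoc)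
  then show ?thesis
    by (cases "w = 0") (auto simp: degree_power_eq)
qed

lemma value_at_double_point:
  "double_point \<alpha> (r, w, s) = (r', w', s') \<Longrightarrow>
   double_point (value_at t \<alpha>) (value_at t r, value_at t w, value_at t s) = (value_at t r', value_at t w', value_at t s')"
  by (auto simp: double_point_def Let_def value_at_simps)

lemma integral_point_double:
  fixes \<alpha> \<beta> :: "'k::field poly"
  assumes two: "(2::'k) \<noteq> 0" and three: "(3::'k) \<noteq> 0"
    and P: "integral_point \<alpha> \<beta> P" and deg: "degree \<alpha> \<le> 8" "degree \<beta> \<le> 12"
  shows "integral_point \<alpha> \<beta> (double_point \<alpha> P)"
proof -
  obtain r w s where P': "P = (r, w, s)" by (cases P)
  obtain r' w' s' where d: "double_point \<alpha> (r, w, s) = (r', w', s')" by (cases "double_point \<alpha> (r, w, s)")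
  have i: "w\<^sup>2 = r ^ 3 + \<alpha> * r * s ^ 4 + \<beta> * s ^ 6" "s \<noteq> 0" "degree r = 2 * degree s + 6"
    "\<And>t. value_at t r \<noteq> 0 \<or> value_at t s \<noteq> 0"
    "\<And>t. value_at t w \<noteq> 0 \<or> value_at t (3 * r\<^sup>2 + \<alpha> * s ^ 4) \<noteq> 0"
    using P by (auto simp: integral_point_def P')
  have dw: "degree w = 3 * degree s + 9"
    using integral_point_degree P deg unfolding P' by blast
  then have w0: "w \<noteq> 0" by auto
  have r0: "r \<noteq> 0" using i(3) by auto
  have s': "s' = 2 * w * s" and r': "r' = (3 * r\<^sup>2 + \<alpha> * s ^ 4)\<^sup>2 - 8 * r * w\<^sup>2"
    using d by (auto simp: double_point_def Let_def)
  have two': "(2 :: 'k poly) \<noteq> 0" using two by (simp add: numeral_poly)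
  have ac: "(2 :: 'k alg_closure) \<noteq> 0" "(3 :: 'k alg_closure) \<noteq> 0"
    using two three to_ac_eq_0_iff[of "2::'k"] to_ac_eq_0_iff[of "3::'k"] by simp_all
  have iv: "(value_at t w)\<^sup>2 = (value_at t r) ^ 3 + value_at t \<alpha> * value_at t r * (value_at t s) ^ 4
      + value_at t \<beta> * (value_at t s) ^ 6" for t
    using arg_cong[OF i(1), of "value_at t"] by (simp add: value_at_simps)
  note ns = double_point_nonsingular[OF ac iv value_at_double_point[OF d] i(4) i(5)[unfolded value_at_simps]]
  have "degree s' = 4 * degree s + 9"
    using w0 i(2) two dw by (simp add: s' mult.assoc degree_numeral_mult degree_mult_eq)
  moreover have "degree r' = 8 * degree s + 24"
  proof -
    \<comment> \<open>Eliminating w^2 by the curve equation turns the leading part into 9 r^4 - 8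
      r^4 = r^4. Its coefficient 1 survives in every characteristic, while \<open>z\<close> has
      smaller degree.\<close>
    define z where "z = \<alpha>\<^sup>2 * s ^ 8 - 2 * (\<alpha> * r\<^sup>2 * s ^ 4) - 8 * (\<beta> * r * s ^ 6)"
    have "r' = r ^ 4 + z" unfolding r' i(1) z_def by Groebner_Basis.algebra
    moreover have "degree (r ^ 4) = 8 * degree s + 24" using i(3) r0 by (simp add: degree_power_eq)
    moreover have "degree z \<le> 8 * degree s + 20"
    proof -
      have "degree (\<alpha>\<^sup>2 * s ^ 8) \<le> 16 + 8 * degree s"
        by (intro order.trans[OF degree_mult_le] add_mono order.trans[OF degree_power_le]) (use deg in auto)
      moreover have "degree (\<alpha> * r\<^sup>2 * s ^ 4) \<le> 8 + (4 * degree s + 12) + 4 * degree s"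
        by (intro order.trans[OF degree_mult_le] add_mono order.trans[OF degree_power_le]) (use deg i(3) in auto)
      moreover have "degree (\<beta> * r * s ^ 6) \<le> 12 + (2 * degree s + 6) + 6 * degree s"
        by (intro order.trans[OF degree_mult_le] add_mono order.trans[OF degree_power_le]) (use deg i(3) in auto)
      ultimately show ?thesis
        unfolding z_def by (intro degree_diff_le order.trans[OF degree_numeral_mult_le]) auto
    qed
    ultimately show ?thesis by (simp add: degree_add_eq_left)
  qed
  ultimately have "degree r' = 2 * degree s' + 6" by simp
  moreover have "s' \<noteq> 0" using w0 i(2) two' by (simp add: s')
  ultimately show ?thesis
    using double_point_on_curve[OF i(1) d] ns
    by (auto simp: P' d integral_point_def value_at_simps)
qed

text \<open>The denominators satisfy s' = 2 w s. Since \<open>w\<close> is nonconstant and shares no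
  zero with \<open>s\<close>, each doubling keeps the old poles of the abscissa and adds at least
  one; hence all abscissas are different.\<close>

lemma infinitely_many_points:
  fixes \<alpha> \<beta> :: "'k::field poly"
  assumes two: "(2::'k) \<noteq> 0" and three: "(3::'k) \<noteq> 0"
    and P: "integral_point \<alpha> \<beta> P" and deg: "degree \<alpha> \<le> 8" "degree \<beta> \<le> 12"
  shows "infinite {x. \<exists>y. y\<^sup>2 = x ^ 3 + to_fract \<alpha> * x + to_fract \<beta>}"
proof -
  define f where "f n = (double_point \<alpha> ^^ n) P" for n
  define r where "r n = fst (f n)" for n
  define w where "w n = fst (snd (f n))" for n
  define s where "s n = snd (snd (f n))" for n
  have fe: "f n = (r n, w n, s n)" for n by (simp add: r_def w_def s_def)
  have i: "integral_point \<alpha> \<beta> (r n, w n, s n)" for n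
    unfolding fe[symmetric] f_def
    by (induction n) (simp_all add: P integral_point_double[OF two three _ deg])
  have c: "(w n)\<^sup>2 = r n ^ 3 + \<alpha> * r n * s n ^ 4 + \<beta> * s n ^ 6" "s n \<noteq> 0"
    "value_at t (r n) \<noteq> 0 \<or> value_at t (s n) \<noteq> 0" for n t
    using i[of n] by (auto simp: integral_point_def)
  have sS: "s (Suc n) = 2 * w n * s n" for n
    using fe[of "Suc n"] fe[of n] by (simp add: f_def double_point_def Let_def)
  define Z where "Z n = {t. value_at t (s n) = 0}" for n
  have mono: "Z n \<subseteq> Z m" if "n \<le> m" for n m
    using that
  proof (induction m rule: dec_induct)
    case (step m)
    then show ?case by (auto simp: Z_def sS value_at_simps)
  qed simp
  have strict: "\<exists>t. t \<in> Z m \<and> t \<notin> Z n" if "n < m" for n m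
  proof -
    have "degree (w n) > 0" using integral_point_degree[OF i deg, of n] by simp
    then obtain t where t: "value_at t (w n) = 0" by (rule value_at_root_exists)
    then have "t \<in> Z (Suc n)" by (simp add: Z_def sS value_at_simps)
    moreover have "t \<notin> Z n"
    proof
      assume "t \<in> Z n"
      then have "value_at t (s n) = 0" by (simp add: Z_def)
      moreover from this have "value_at t (r n) = 0"
        using arg_cong[OF c(1)[of n], of "value_at t"] t by (simp add: value_at_simps)
      ultimately show False using c(3) by blast
    qed
    ultimately show ?thesis using mono[of "Suc n" m] that by auto
  qed
  define x where "x n = to_fract (r n) / (to_fract (s n))\<^sup>2" for n
  have xn: "x n \<noteq> x m" if nm: "n < m" for n m
  proof
    assume "x n = x m"
    then have "to_fract (r n * (s m)\<^sup>2) = to_fract (r m * (s n)\<^sup>2)"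
      using c(2)[of n] c(2)[of m] by (simp add: x_def field_simps power2_eq_square)
    then have e: "r n * (s m)\<^sup>2 = r m * (s n)\<^sup>2" by (simp only: to_fract_eq_iff)
    obtain t where t: "t \<in> Z m" "t \<notin> Z n" using strict[OF nm] by blast
    have "value_at t (r m) * (value_at t (s n))\<^sup>2 = 0"
      using arg_cong[OF e, of "value_at t"] t(1) by (simp add: value_at_simps Z_def)
    then show False using t c(3)[of t m] by (auto simp: Z_def)
  qed
  then have "inj x" by (metis injI linorder_neqE_nat)
  then have "infinite (range x)" by (simp add: finite_image_iff)
  moreover have "range x \<subseteq> {x. \<exists>y. y\<^sup>2 = x ^ 3 + to_fract \<alpha> * x + to_fract \<beta>}"
  proof clarify
    fix n
    have s0: "to_fract (s n) \<noteq> 0" using c(2) by simp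
    have "(to_fract (w n))\<^sup>2 = to_fract (r n) ^ 3 + to_fract \<alpha> * to_fract (r n) * to_fract (s n) ^ 4 + to_fract \<beta> * to_fract (s n) ^ 6"
      using arg_cong[OF c(1)[of n], of to_fract] by (simp add: ring_morphism_simps[OF ring_morphism_to_fract])
    then have "(to_fract (w n) / to_fract (s n) ^ 3)\<^sup>2 = x n ^ 3 + to_fract \<alpha> * x n + to_fract \<beta>"
      using s0 by (simp add: x_def field_simps power_divide) 
    then show "\<exists>y. y\<^sup>2 = x n ^ 3 + to_fract \<alpha> * x n + to_fract \<beta>" by blast
  qed
  ultimately show ?thesis by (rule infinite_super[rotated])
qed

definition fraction_const :: "'k::field \<Rightarrow> 'k poly fract" where
  "fraction_const c = to_fract [:c:]"

lemma ring_morphism_fraction_const: "ring_morphism fraction_const"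
  unfolding fraction_const_def
  by (intro ring_morphism_comp[OF ring_morphism_to_fract ring_morphism_const_poly])

lemma fraction_const_eq_0_iff: "fraction_const c = 0 \<longleftrightarrow> c = 0"
  by (simp add: fraction_const_def)

lemma nonzero_fraction_numerals:
  assumes "(2::'k::field) \<noteq> 0" "(3::'k) \<noteq> 0"
  shows "(2 :: 'k poly fract) \<noteq> 0" "(3 :: 'k poly fract) \<noteq> 0"
  using assms fraction_const_eq_0_iff[of "2::'k"] fraction_const_eq_0_iff[of "3::'k"]
  by (simp_all add: ring_morphism_numeral[OF ring_morphism_fraction_const])

lemma numeral_powers_nonzero:
  assumes "(2::'a::idom) \<noteq> 0" "(3::'a) \<noteq> 0"
  shows "(9::'a) \<noteq> 0" "(18::'a) \<noteq> 0" "(27::'a) \<noteq> 0" "(108::'a) \<noteq> 0"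
    "(2916::'a) \<noteq> 0"
proof -
  have *: "x * y \<noteq> 0" if "x \<noteq> 0" "y \<noteq> 0" for x y :: 'a using that by simp
  show 9: "(9::'a) \<noteq> 0" using *[of 3 3] assms by simp
  show 18: "(18::'a) \<noteq> 0" using *[of 9 2] assms 9 by simp
  show 27: "(27::'a) \<noteq> 0" using *[of 9 3] assms 9 by simp
  show 108: "(108::'a) \<noteq> 0" using *[of 27 4] four_nonzero[OF assms(1)] 27 by simp
  show "(2916::'a) \<noteq> 0" using *[of 27 108] 27 108 by simp
qed

lemma degree_const_mult_X_power:
  assumes "degree k = 0" "n \<le> N"
  shows "degree (k * [:0, 1:] ^ n) \<le> N"
proof -
  have "degree (k * [:0, 1:] ^ n) \<le> degree k + degree ([:0, 1:] ^ n :: 'a poly)" by (rule degree_mult_le)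
  also have "degree ([:0, 1:] ^ n :: 'a poly) \<le> degree ([:0, 1:] :: 'a poly) * n" by (rule degree_power_le)
  also have "\<dots> \<le> 1 * n" by (intro mult_right_mono) auto
  finally show ?thesis using assms by simp
qed

lemma degree_0_mult: "degree p = 0 \<Longrightarrow> degree q = 0 \<Longrightarrow> degree (p * q) = 0"
  using degree_mult_le[of p q] by simp

lemma degree_0_power: "degree p = 0 \<Longrightarrow> degree (p ^ n) = 0"
  using degree_power_le[of p n] by simp

lemma degree_0_add: "degree p = 0 \<Longrightarrow> degree q = 0 \<Longrightarrow> degree (p + q) = 0"
  using degree_add_le[of p 0 q] by simp

lemmas degree_const_expression = degree_0_mult degree_0_power degree_0_add degree_numeral degree_pCons_0

section \<open>The elliptic surface of lines by slope\<close>

text \<open>The line \<open>y = t x + \<mu>\<close> meets the cubic where \<open>x - t\<^sup>2 / 3\<close> is a root of \<open>X\<^sup>3 + p X + q\<close>.  For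
  fixed \<open>t\<close>, the condition that \<open>81 q\<^sup>2 + 12 p\<^sup>3\<close> is a square is a curve of genus 1 in \<open>\<mu>\<close>, and
  \<open>p\<^sup>3 = 27 m (m + q)\<close> is another equation of it.\<close>

context weierstrass_cubic
begin

definition dep_p :: "'k poly fract \<Rightarrow> 'k poly fract" where
  "dep_p \<mu> = fraction_const a - 2 * to_fract [:0, 1:] * \<mu> - to_fract [:0, 1:] ^ 4 / 3"

definition dep_q :: "'k poly fract \<Rightarrow> 'k poly fract" where
  "dep_q \<mu> = - \<mu>\<^sup>2 + to_fract [:0, 1:] ^ 2 * dep_p \<mu> / 3 + to_fract [:0, 1:] ^ 6 / 27 + fraction_const b"

text \<open>With p as coordinate in place of \<mu>, one has 108 t^2 q = -27 p^2 + 18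
  \<open>R\<^sub>4\<close> p + \<open>Q\<^sub>8\<close>; this defines \<open>R\<^sub>4\<close> and
  \<open>Q\<^sub>8\<close>. For t nonzero, \<open>Q\<^sub>8\<close> = 0 means that p = q = 0 for
  some line of slope t, that is, t is the slope of a flex tangent. \<open>P\<^sub>6\<close> is 27
  times the value of x^3 + a x + b at t^2 / 3, and 4 t^2 \<open>P\<^sub>6\<close> =
  \<open>Q\<^sub>8\<close> + 3 \<open>R\<^sub>4\<close>^2.\<close>

definition P\<^sub>6 :: "'k poly" where
  "P\<^sub>6 = [:0, 1:] ^ 6 + 9 * [:a:] * [:0, 1:]\<^sup>2 + 27 * [:b:]"

definition Q\<^sub>8 :: "'k poly" where
  "Q\<^sub>8 = [:0, 1:] ^ 8 + 18 * [:a:] * [:0, 1:] ^ 4 + 108 * [:b:] * [:0, 1:]\<^sup>2 - 27 * [:a:]\<^sup>2"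

definition R\<^sub>4 :: "'k poly" where
  "R\<^sub>4 = [:0, 1:] ^ 4 + 3 * [:a:]"

text \<open>The short Weierstrass form of that curve.  Its zero section is \<open>p = m = 0\<close>, and its
  discriminant is a constant multiple of \<open>Q\<^sub>8\<^sup>3\<close>.\<close>

definition alpha :: "'k poly" where
  "alpha = 243 * (Q\<^sub>8 * R\<^sub>4 - P\<^sub>6\<^sup>2)"

definition beta :: "'k poly" where
  "beta = 729 * ([:0, 1:]\<^sup>2 * Q\<^sub>8\<^sup>2 - 3 * P\<^sub>6 * Q\<^sub>8 * R\<^sub>4 + 2 * P\<^sub>6 ^ 3)"

text \<open>The terms of degree 12 cancel, which only the expanded form shows; likewise the high
  terms of \<open>beta\<close> below. The bounds 8 and 12 are those of an elliptic K3
  surface.\<close>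

lemma degree_alpha: "degree alpha \<le> 8"
proof -
  have e: "alpha = 729 * [:a:] * [:0, 1:] ^ 8 + 13122 * [:b:] * [:0, 1:] ^ 6 - 13122 * [:a:]\<^sup>2 * [:0, 1:] ^ 4
     - 39366 * [:a:] * [:b:] * [:0, 1:] ^ 2 - (19683 * [:a:] ^ 3 + 177147 * [:b:]\<^sup>2) * [:0, 1:] ^ 0"
    unfolding alpha_def P\<^sub>6_def Q\<^sub>8_def R\<^sub>4_def power_0 by Groebner_Basis.algebra
  show ?thesis
    unfolding e
    by (intro degree_diff_le degree_add_le degree_const_mult_X_power degree_const_expression) simp_all
qed

lemma degree_beta: "degree beta \<le> 12"
proof -
  have e: "beta = 78732 * [:a:]\<^sup>2 * [:0, 1:] ^ 10 - 19683 * [:b:] * [:0, 1:] ^ 12 + 885735 * [:a:] * [:b:] * [:0, 1:] ^ 8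
     + 5314410 * [:b:]\<^sup>2 * [:0, 1:] ^ 6 - 2657205 * [:a:]\<^sup>2 * [:b:] * [:0, 1:] ^ 4
     + 2125764 * [:a:] ^ 4 * [:0, 1:] ^ 2 + 9565938 * [:a:] * [:b:]\<^sup>2 * [:0, 1:] ^ 2
     + (4782969 * [:a:] ^ 3 * [:b:] + 28697814 * [:b:] ^ 3) * [:0, 1:] ^ 0"
    unfolding beta_def P\<^sub>6_def Q\<^sub>8_def R\<^sub>4_def power_0 by Groebner_Basis.algebra
  show ?thesis
    unfolding e
    by (intro degree_diff_le degree_add_le degree_const_mult_X_power degree_const_expression) simp_all
qed

text \<open>Up to sign, three times S = (9 \<open>P\<^sub>6\<close>, 27 t \<open>Q\<^sub>8\<close>).
  In the coordinate \<xi> = x - 9 \<open>P\<^sub>6\<close>, S has \<xi> = 0 and tangent slope 9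
  \<open>R\<^sub>4\<close> / (2 t), 2 S has \<xi> = -27 \<open>Q\<^sub>8\<close> / (4 t^2), and in 3
  S the denominators cancel, leaving \<xi> = -8 t^2 (t^4 + 27 a).\<close>

definition initial_point :: "'k poly \<times> 'k poly \<times> 'k poly" where
  "initial_point = ([:0, 1:] ^ 6 - 135 * [:a:] * [:0, 1:]\<^sup>2 + 243 * [:b:],
     [:0, 1:] ^ 9 + 162 * [:a:] * [:0, 1:] ^ 5 - 2916 * [:b:] * [:0, 1:] ^ 3 - 2187 * [:a:]\<^sup>2 * [:0, 1:], 1)"

text \<open>A singular fibre has its singular point at x = 9 \<open>P\<^sub>6\<close>, and 3 S has x
  - 9 \<open>P\<^sub>6\<close> = -8 t^2 (t^4 + 27 A), which leaves only t = 0 and t^4 = -27 A to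
  exclude. The first forces A = 0, the second A (4 A^3 + 27 B^2) = 0.\<close>

lemma initial_point_nonsingular:
  fixes t A B :: "'f::field"
  assumes two: "(2::'f) \<noteq> 0" and three: "(3::'f) \<noteq> 0" and A: "A \<noteq> 0" and d: "4 * A ^ 3 + 27 * B\<^sup>2 \<noteq> 0"
    and w: "t ^ 9 + 162 * A * t ^ 5 - 2916 * B * t ^ 3 - 2187 * A\<^sup>2 * t = 0"
    and m: "3 * (t ^ 6 - 135 * A * t\<^sup>2 + 243 * B)\<^sup>2 + 729 * (A * t ^ 8 + 18 * B * t ^ 6 - 18 * A\<^sup>2 * t ^ 4
       - 54 * A * B * t\<^sup>2 - 27 * A ^ 3 - 243 * B\<^sup>2) = 0"
  shows False
proof (cases "t = 0")
  case True
  then have "3 * (243 * B)\<^sup>2 + 729 * (- 27 * A ^ 3 - 243 * B\<^sup>2) = 0" using m by simp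
  then have "27 * 27 * 27 * A ^ 3 = 0" by Groebner_Basis.algebra
  then show False using A numeral_powers_nonzero(3)[OF two three] by (metis mult_eq_0_iff power_eq_0_iff)
next
  case False
  have "t * (t ^ 8 + 162 * A * t ^ 4 - 2916 * B * t\<^sup>2 - 2187 * A\<^sup>2) = 0"
    using w by Groebner_Basis.algebra
  then have w': "t ^ 8 + 162 * A * t ^ 4 - 2916 * B * t\<^sup>2 - 2187 * A\<^sup>2 = 0" using False by simp
  have "8 * (t ^ 4 + 27 * A) ^ 3 = 0" using w' m by Groebner_Basis.algebra
  moreover have "8 = (2 ^ 3 :: 'f)" by simp
  ultimately have t4: "t ^ 4 + 27 * A = 0" using two by (metis mult_eq_0_iff power_eq_0_iff)
  have "5832 * A\<^sup>2 + 2916 * B * t\<^sup>2 = 0" using w' t4 by Groebner_Basis.algebra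
  moreover have "(2916::'f) \<noteq> 0"
    by (rule numeral_powers_nonzero(5)[OF two three])
  moreover have "5832 * A\<^sup>2 + 2916 * B * t\<^sup>2 = 2916 * (2 * A\<^sup>2 + B * t\<^sup>2)" by Groebner_Basis.algebra
  ultimately have "2 * A\<^sup>2 + B * t\<^sup>2 = 0" by (metis mult_eq_0_iff)
  then have "A * (4 * A ^ 3 + 27 * B\<^sup>2) = 0" using t4 by Groebner_Basis.algebra
  then show False using A d by simp
qed

lemma integral_initial_point: "integral_point alpha beta initial_point"
proof -
  define r where "r = [:0, 1:] ^ 6 - 135 * [:a:] * [:0, 1:]\<^sup>2 + 243 * [:b:]"
  define w where "w = [:0, 1:] ^ 9 + 162 * [:a:] * [:0, 1:] ^ 5 - 2916 * [:b:] * [:0, 1:] ^ 3 - 2187 * [:a:]\<^sup>2 * [:0, 1:]"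
  have "w\<^sup>2 = r ^ 3 + alpha * r + beta"
    unfolding w_def r_def alpha_def beta_def P\<^sub>6_def Q\<^sub>8_def R\<^sub>4_def by Groebner_Basis.algebra
  moreover have "degree r = 6"
  proof -
    have "degree ([:0, 1:] ^ 6 :: 'k poly) = 6" by (subst degree_power_eq) auto
    moreover have "degree (243 * [:b:] - 135 * [:a:] * [:0, 1:]\<^sup>2) \<le> 2"
      by (intro degree_diff_le degree_const_mult_X_power degree_const_expression)
         (simp_all add: degree_0_mult)
    ultimately have "degree ([:0, 1:] ^ 6 + (243 * [:b:] - 135 * [:a:] * [:0, 1:]\<^sup>2)) = 6"
      by (subst degree_add_eq_left) linarith+
    then show ?thesis by (simp add: r_def algebra_simps)
  qed
  moreover have "value_at t w \<noteq> 0 \<or> value_at t (3 * r\<^sup>2 + alpha) \<noteq> 0" for t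
  proof (rule ccontr)
    assume z: "\<not> (value_at t w \<noteq> 0 \<or> value_at t (3 * r\<^sup>2 + alpha) \<noteq> 0)"
    have v: "value_at t [:0, 1:] = t" "value_at t [:c:] = to_ac c" for c
      by (simp_all add: value_at_def eval1_pCons[OF ring_morphism_to_ac] eval1_0)
    have al: "alpha = 729 * ([:a:] * [:0, 1:] ^ 8 + 18 * [:b:] * [:0, 1:] ^ 6 - 18 * [:a:]\<^sup>2 * [:0, 1:] ^ 4
       - 54 * [:a:] * [:b:] * [:0, 1:]\<^sup>2 - 27 * [:a:] ^ 3 - 243 * [:b:]\<^sup>2)"
      unfolding alpha_def P\<^sub>6_def Q\<^sub>8_def R\<^sub>4_def by Groebner_Basis.algebra
    show False
      by (rule initial_point_nonsingular[OF nonzero_consts, of t])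
         (use z in \<open>simp_all only: w_def r_def al value_at_simps v de_Morgan_disj not_not\<close>)
  qed
  moreover have "initial_point = (r, w, 1)" by (simp only: initial_point_def r_def w_def)
  ultimately show ?thesis
    by (simp add: integral_point_def value_at_simps)
qed

text \<open>The map p = Q \<xi> / Z, m = Q^2 / Z carries points of the short Weierstrass curve to
  the plane cubic in (p, m). It is defined off two abscissas; conversely the abscissa is recovered
  from \<mu> and m, and each \<mu> admits at most two m. So infinitely many abscissas force
  infinitely many \<mu>.\<close>

lemma infinitely_many_sections:
  "infinite {\<mu>. \<exists>m. m \<noteq> 0 \<and> dep_p \<mu> ^ 3 = 27 * m * (m + dep_q \<mu>) \<and> 18 * m + 9 * dep_q \<mu> \<noteq> 0}"
proof -
  note rf = ring_morphism_to_fract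
  define T where "T = to_fract [:0, 1 :: 'k:]"
  define A where "A = fraction_const a"
  define B where "B = fraction_const b"
  define P where "P = to_fract P\<^sub>6"
  define Q where "Q = to_fract Q\<^sub>8"
  define R where "R = to_fract R\<^sub>4"
  have P: "P = T ^ 6 + 9 * A * T\<^sup>2 + 27 * B" and Q: "Q = T ^ 8 + 18 * A * T ^ 4 + 108 * B * T\<^sup>2 - 27 * A\<^sup>2"
    and R: "R = T ^ 4 + 3 * A"
    unfolding P_def Q_def R_def P\<^sub>6_def Q\<^sub>8_def R\<^sub>4_def ring_morphism_simps[OF rf] T_def A_def B_def fraction_const_def
    by simp_all
  have al: "to_fract alpha = 243 * (Q * R - P\<^sup>2)"
    and be: "to_fract beta = 729 * (T\<^sup>2 * Q\<^sup>2 - 3 * P * Q * R + 2 * P ^ 3)"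
    unfolding alpha_def beta_def ring_morphism_simps[OF rf] T_def P_def Q_def R_def by simp_all
  note n23 = nonzero_fraction_numerals[OF two three]
  note num = numeral_powers_nonzero[OF n23] four_nonzero[OF n23(1)]
  have T0: "T \<noteq> 0" by (simp add: T_def)
  have "poly Q\<^sub>8 0 \<noteq> 0"
    using a_nz numeral_powers_nonzero(3)[OF two three] by (simp add: Q\<^sub>8_def)
  then have Q0: "Q \<noteq> 0" by (auto simp: Q_def)
  have PQR: "4 * T\<^sup>2 * P = Q + 3 * R\<^sup>2" unfolding P Q R by Groebner_Basis.algebra
  define W where "W = {\<mu>. \<exists>m. m \<noteq> 0 \<and> dep_p \<mu> ^ 3 = 27 * m * (m + dep_q \<mu>)}"
  define ms where "ms \<mu> = {m. poly [:- (dep_p \<mu> ^ 3), 27 * dep_q \<mu>, 27:] m = 0}" for \<mu>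
  define bad where "bad = {9 * P, 9 * P - 27 * Q / (4 * T\<^sup>2)}"
  have sub: "{x. \<exists>y. y\<^sup>2 = x ^ 3 + to_fract alpha * x + to_fract beta}
     \<subseteq> bad \<union> (\<Union>\<mu>\<in>W. (\<lambda>m. dep_p \<mu> * Q / m + 9 * P) ` ms \<mu>)"
  proof clarify
    fix x y
    assume y: "y\<^sup>2 = x ^ 3 + to_fract alpha * x + to_fract beta"
      and nW: "x \<notin> (\<Union>\<mu>\<in>W. (\<lambda>m. dep_p \<mu> * Q / m + 9 * P) ` ms \<mu>)"
    define \<xi> where "\<xi> = x - 9 * P"
    define Z where "Z = 2 * T * y - 9 * R * \<xi> - 54 * T\<^sup>2 * Q"
    have x: "x = \<xi> + 9 * P" by (simp add: \<xi>_def)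
    have y': "y\<^sup>2 = \<xi> ^ 3 + 27 * P * \<xi>\<^sup>2 + 243 * R * Q * \<xi> + 729 * T\<^sup>2 * Q\<^sup>2"
      using y unfolding x al be by Groebner_Basis.algebra
    have eqZ: "Z\<^sup>2 + 18 * R * \<xi> * Z + 108 * T\<^sup>2 * Q * Z = 27 * Q * \<xi>\<^sup>2 + 4 * T\<^sup>2 * \<xi> ^ 3"
    proof -
      have "(Z + 9 * R * \<xi> + 54 * T\<^sup>2 * Q)\<^sup>2 = 4 * T\<^sup>2 * y\<^sup>2" unfolding Z_def by Groebner_Basis.algebra
      then show ?thesis unfolding y' using PQR by Groebner_Basis.algebra
    qed
    show "x \<in> bad"
    proof (cases "Z = 0")
      case True
      then have "\<xi>\<^sup>2 * (4 * T\<^sup>2 * \<xi> + 27 * Q) = 0" using eqZ by simp Groebner_Basis.algebra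
      then have "\<xi> = 0 \<or> 4 * T\<^sup>2 * \<xi> = - 27 * Q" by (auto simp: eq_neg_iff_add_eq_0)
      moreover have "\<xi> = - 27 * Q / (4 * T\<^sup>2)" if "4 * T\<^sup>2 * \<xi> = - 27 * Q"
        using that T0 num by (simp add: field_simps)
      ultimately show ?thesis by (auto simp: bad_def x)
    next
      case False
      define p where "p = Q * \<xi> / Z"
      define m where "m = Q\<^sup>2 / Z"
      define \<mu> where "\<mu> = (A - T ^ 4 / 3 - p) / (2 * T)"
      have m0: "m \<noteq> 0" using False Q0 by (simp add: m_def)
      have p: "dep_p \<mu> = p"
        using T0 n23 by (simp add: dep_p_def \<mu>_def T_def[symmetric] A_def[symmetric])
      define q where "q = dep_q \<mu>"
      have "2 * T * \<mu> = A - T ^ 4 / 3 - p" using T0 n23 by (simp add: \<mu>_def)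
      then have mu3: "6 * T * \<mu> = 3 * A - T ^ 4 - 3 * p" using n23 by (simp add: field_simps)
      have "27 * q = - 27 * \<mu>\<^sup>2 + 9 * T\<^sup>2 * p + T ^ 6 + 27 * B"
      proof -
        define u v where "u = T\<^sup>2 * p / 3" and "v = T ^ 6 / 27"
        have "3 * u = T\<^sup>2 * p" "27 * v = T ^ 6" using num(3) n23(2) by (simp_all add: u_def v_def)
        moreover have "q = - \<mu>\<^sup>2 + u + v + B"
          unfolding q_def dep_q_def p u_def v_def T_def[symmetric] B_def[symmetric] ..
        ultimately show ?thesis by Groebner_Basis.algebra
      qed
      then have "4 * (27 * T\<^sup>2 * q) = - 3 * (6 * T * \<mu>)\<^sup>2 + 36 * T ^ 4 * p + 4 * T ^ 8 + 108 * B * T\<^sup>2"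
        by Groebner_Basis.algebra
      then have q: "108 * T\<^sup>2 * q = - 27 * p\<^sup>2 + 18 * R * p + Q"
        unfolding mu3 Q R by Groebner_Basis.algebra
      have pZ: "p * Z = Q * \<xi>" and mZ: "m * Z = Q\<^sup>2" using False by (simp_all add: p_def m_def)
      have "Z ^ 3 * (108 * T\<^sup>2) * (p ^ 3 - 27 * m * (m + q)) = 0"
      proof -
        have "Z ^ 3 * (108 * T\<^sup>2) * (p ^ 3 - 27 * m * (m + q))
          = 108 * T\<^sup>2 * (p * Z) ^ 3 - 27 * (m * Z) * (108 * T\<^sup>2 * (m * Z) * Z + Z\<^sup>2 * (108 * T\<^sup>2 * q))"
          by Groebner_Basis.algebra
        also have "Z\<^sup>2 * (108 * T\<^sup>2 * q) = - 27 * (p * Z)\<^sup>2 + 18 * R * (p * Z) * Z + Q * Z\<^sup>2"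
          unfolding q by Groebner_Basis.algebra
        also have "108 * T\<^sup>2 * (p * Z) ^ 3 - 27 * (m * Z) * (108 * T\<^sup>2 * (m * Z) * Z
            + (- 27 * (p * Z)\<^sup>2 + 18 * R * (p * Z) * Z + Q * Z\<^sup>2)) = 0"
          unfolding pZ mZ using eqZ by Groebner_Basis.algebra
        finally show ?thesis .
      qed
      then have "p ^ 3 - 27 * m * (m + q) = 0" using False T0 num by simp
      then have pm: "p ^ 3 = 27 * m * (m + q)" by simp
      then have "\<mu> \<in> W" using m0 by (auto simp: W_def p q_def)
      moreover have "m \<in> ms \<mu>"
        using pm by (simp add: ms_def p q_def[symmetric] algebra_simps)
      moreover have "x = dep_p \<mu> * Q / m + 9 * P"
        using False Q0 by (simp add: x p p_def m_def power2_eq_square)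
      ultimately show ?thesis using nW by blast
    qed
  qed
  have "infinite W"
  proof
    assume "finite W"
    moreover have "finite (ms \<mu>)" for \<mu>
      unfolding ms_def using num by (intro poly_roots_finite) simp
    ultimately have "finite (bad \<union> (\<Union>\<mu>\<in>W. (\<lambda>m. dep_p \<mu> * Q / m + 9 * P) ` ms \<mu>))"
      by (simp add: bad_def)
    then show False
      using sub infinitely_many_points[OF two three integral_initial_point degree_alpha degree_beta]
      by (meson finite_subset)
  qed
  \<comment> \<open>These are the \<mu> with zero discriminant, for which the intersection with the
    dual curve would not be proper. As a polynomial in \<mu> the discriminant has the coefficient 27
    at \<mu>^4, coming from q^2.\<close>
  moreover have "finite {\<mu>. 4 * dep_p \<mu> ^ 3 + 27 * (dep_q \<mu>)\<^sup>2 = 0}"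
  proof -
    define pp where "pp = [:A - T ^ 4 / 3, - 2 * T:]"
    define qq where "qq = [:T\<^sup>2 * (A - T ^ 4 / 3) / 3 + T ^ 6 / 27 + B, - 2 * T ^ 3 / 3, - 1:]"
    have pp: "poly pp \<mu> = dep_p \<mu>" for \<mu>
      by (simp add: pp_def dep_p_def T_def A_def algebra_simps)
    have qq: "poly qq \<mu> = dep_q \<mu>" for \<mu>
      by (simp add: qq_def dep_q_def dep_p_def T_def A_def B_def algebra_simps power2_eq_square power3_eq_cube
          diff_divide_distrib add_divide_distrib)
    have "coeff (4 * pp ^ 3 + 27 * qq\<^sup>2) 4 = 27"
      by (simp add: pp_def qq_def power2_eq_square power3_eq_cube numeral_poly eval_nat_numeral)
    then have "4 * pp ^ 3 + 27 * qq\<^sup>2 \<noteq> 0" using num(3) by force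
    then have "finite {\<mu>. poly (4 * pp ^ 3 + 27 * qq\<^sup>2) \<mu> = 0}" by (rule poly_roots_finite)
    then show ?thesis by (simp add: pp qq)
  qed
  ultimately have "infinite (W - {\<mu>. 4 * dep_p \<mu> ^ 3 + 27 * (dep_q \<mu>)\<^sup>2 = 0})" by simp
  moreover have "W - {\<mu>. 4 * dep_p \<mu> ^ 3 + 27 * (dep_q \<mu>)\<^sup>2 = 0}
    \<subseteq> {\<mu>. \<exists>m. m \<noteq> 0 \<and> dep_p \<mu> ^ 3 = 27 * m * (m + dep_q \<mu>) \<and> 18 * m + 9 * dep_q \<mu> \<noteq> 0}"
  proof clarify
    fix \<mu> assume "\<mu> \<in> W" and n: "4 * dep_p \<mu> ^ 3 + 27 * (dep_q \<mu>)\<^sup>2 \<noteq> 0"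
    then obtain m where m: "m \<noteq> 0" "dep_p \<mu> ^ 3 = 27 * m * (m + dep_q \<mu>)" by (auto simp: W_def)
    moreover have "18 * m + 9 * dep_q \<mu> \<noteq> 0"
    proof
      assume "18 * m + 9 * dep_q \<mu> = 0"
      then have "9 * (2 * m + dep_q \<mu>) = 0" by Groebner_Basis.algebra
      then have "2 * m + dep_q \<mu> = 0" using num(1) mult_eq_0_iff by blast
      then have "4 * dep_p \<mu> ^ 3 + 27 * (dep_q \<mu>)\<^sup>2 = 0" using m(2) by Groebner_Basis.algebra
      then show False using n by simp
    qed
    ultimately show "\<exists>m. m \<noteq> 0 \<and> dep_p \<mu> ^ 3 = 27 * m * (m + dep_q \<mu>) \<and> 18 * m + 9 * dep_q \<mu> \<noteq> 0" by blast
  qed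
  ultimately show ?thesis by (meson finite_subset)
qed

end

section \<open>An elliptic curve has no nonconstant points over a rational function field\<close>

definition no_common_root :: "'a::field poly \<Rightarrow> 'a poly \<Rightarrow> bool" where
  "no_common_root p q \<longleftrightarrow> (\<forall>t. poly p t \<noteq> 0 \<or> poly q t \<noteq> 0)"

lemma even_order_imp_square:
  fixes p :: "'a::alg_closed_field poly"
  assumes "p \<noteq> 0" "\<And>t. even (Polynomial.order t p)"
  shows "\<exists>u. p = u\<^sup>2"
  using assms
proof (induction "degree p" arbitrary: p rule: less_induct)
  case less
  show ?case
  proof (cases "degree p = 0")
    case True
    then obtain c where c: "p = [:c:]" by (rule degree_eq_zeroE)
    obtain d where "d\<^sup>2 = c" using sqrt_exists by blast
    then have "p = [:d:]\<^sup>2" by (simp add: c power2_eq_square)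
    then show ?thesis by blast
  next
    case False
    then obtain t where t: "poly p t = 0" using alg_closed_imp_poly_has_root by blast
    then have "Polynomial.order t p \<noteq> 0" using less.prems(1) by (simp add: order_root)
    then have "2 \<le> Polynomial.order t p" using less.prems(2)[of t] by (cases "Polynomial.order t p = 1") auto
    then have "[:- t, 1:]\<^sup>2 dvd p" using order_divides by blast
    then obtain q where q: "p = [:- t, 1:]\<^sup>2 * q" by (elim dvdE)
    have q0: "q \<noteq> 0" using less.prems(1) q by auto
    have "degree p = 2 + degree q"
      using q0 by (simp add: q degree_mult_eq degree_power_eq)
    moreover have "even (Polynomial.order s q)" for s
    proof -
      have "Polynomial.order s p = Polynomial.order s ([:- t, 1:]\<^sup>2) + Polynomial.order s q"
        using less.prems(1) unfolding q by (rule order_mult)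
      moreover have "Polynomial.order s ([:- t, 1:]\<^sup>2) = 2 * Polynomial.order s [:- t, 1:]"
        unfolding power2_eq_square by (subst order_mult) auto
      ultimately show ?thesis using less.prems(2)[of s] by simp
    qed
    ultimately obtain u where "q = u\<^sup>2" using less.hyps[of q] q0 by auto
    then have "p = ([:- t, 1:] * u)\<^sup>2" by (simp only: q \<open>q = u\<^sup>2\<close> power_mult_distrib)
    then show ?thesis by blast
  qed
qed

lemma square_even_order: "p = u\<^sup>2 \<Longrightarrow> p \<noteq> 0 \<Longrightarrow> even (Polynomial.order t p)" for p :: "'a::field poly"
  by (simp add: power2_eq_square order_mult)

lemma no_common_root_square_factor:
  fixes p q :: "'a::alg_closed_field poly"
  assumes "p * q = z\<^sup>2" "no_common_root p q"
  shows "\<exists>u. p = u\<^sup>2"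
proof (cases "p = 0")
  case True
  then show ?thesis by (intro exI[of _ 0]) simp
next
  case p: False
  show ?thesis
  proof (rule even_order_imp_square[OF p])
    fix t
    show "even (Polynomial.order t p)"
    proof (cases "poly p t = 0")
      case True
      then have qt: "poly q t \<noteq> 0" using assms(2) by (auto simp: no_common_root_def)
      then have "p * q \<noteq> 0" using p by auto
      then have "even (Polynomial.order t p + Polynomial.order t q)"
        using square_even_order[OF assms(1)] by (metis order_mult)
      moreover have "Polynomial.order t q = 0" using qt by (simp add: order_0I)
      ultimately show ?thesis by simp
    qed (simp add: order_0I)
  qed
qed

lemma scaled_square:
  fixes p :: "'a::alg_closed_field poly"
  assumes "\<exists>u. p = u\<^sup>2"
  shows "\<exists>u. Polynomial.smult c p = u\<^sup>2"
proof -
  obtain u where u: "p = u\<^sup>2" using assms by blast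
  obtain d where "d\<^sup>2 = c" using sqrt_exists by blast
  then have "Polynomial.smult c p = (Polynomial.smult d u)\<^sup>2"
    by (simp add: u smult_power)
  then show ?thesis by blast
qed

text \<open>Infinite descent: if \<open>p = u\<^sup>2\<close> and \<open>q = v\<^sup>2\<close>, then \<open>p - q = (u - v) (u + v)\<close> and
  \<open>p - \<mu>\<^sup>2 q = (u - \<mu> v) (u + \<mu> v)\<close> make these four factors squares.\<close>

lemma four_squares_constant:
  fixes p q :: "'a::alg_closed_field poly"
  assumes two: "(2::'a) \<noteq> 0" and "no_common_root p q" "l \<noteq> 0" "l \<noteq> 1"
    "\<exists>u. p = u\<^sup>2" "\<exists>u. q = u\<^sup>2" "\<exists>u. p - q = u\<^sup>2" "\<exists>u. p - Polynomial.smult l q = u\<^sup>2"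
  shows "degree p = 0 \<and> degree q = 0"
  using assms(2-)
proof (induction "max (degree p) (degree q)" arbitrary: p q l rule: less_induct)
  case less
  show ?case
  proof (rule ccontr)
    assume n: "\<not> ?thesis"
    obtain u v w z where u: "p = u\<^sup>2" and v: "q = v\<^sup>2" and w: "p - q = w\<^sup>2" and z: "p - Polynomial.smult l q = z\<^sup>2"
      using less.prems by blast
    obtain m where m: "m\<^sup>2 = l" using sqrt_exists by blast
    have m1: "m \<noteq> 1" "m \<noteq> - 1" "m \<noteq> 0" using m less.prems(2,3) by auto
    have m1': "m - 1 \<noteq> 0" "m + 1 \<noteq> 0" using m1 by (auto simp: add_eq_0_iff add.commute)
    have nc: "poly u t \<noteq> 0 \<or> poly v t \<noteq> 0" for t
      using less.prems(1) unfolding no_common_root_def u v by auto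
    have ncr: "no_common_root (u - Polynomial.smult c v) (u + Polynomial.smult c v)" if c: "c \<noteq> 0" for c
      unfolding no_common_root_def
    proof (intro allI, rule ccontr)
      fix t
      assume "\<not> (poly (u - Polynomial.smult c v) t \<noteq> 0 \<or> poly (u + Polynomial.smult c v) t \<noteq> 0)"
      then have e: "poly u t = c * poly v t" "poly u t + c * poly v t = 0" by auto
      then have "2 * (c * poly v t) = 0" by simp
      then have "poly v t = 0" using two c by (metis mult_eq_0_iff)
      then show False using e nc[of t] by simp
    qed
    have sq: "\<exists>x. u - Polynomial.smult c v = x\<^sup>2" "\<exists>x. u + Polynomial.smult c v = x\<^sup>2"
      if c: "c \<noteq> 0" "\<exists>x. p - Polynomial.smult (c\<^sup>2) q = x\<^sup>2" for c
    proof -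
      have e: "(u - Polynomial.smult c v) * (u + Polynomial.smult c v) = p - Polynomial.smult (c\<^sup>2) q"
        by (simp add: u v algebra_simps power2_eq_square)
      have "no_common_root (u + Polynomial.smult c v) (u - Polynomial.smult c v)"
        using ncr[OF c(1)] unfolding no_common_root_def by blast
      then show "\<exists>x. u - Polynomial.smult c v = x\<^sup>2" "\<exists>x. u + Polynomial.smult c v = x\<^sup>2"
        using c(2) no_common_root_square_factor[OF _ ncr[OF c(1)]] no_common_root_square_factor e
        by (metis, metis mult.commute)
    qed
    have s1: "\<exists>x. u - v = x\<^sup>2" "\<exists>x. u + v = x\<^sup>2" using sq[of 1] w by auto
    have sm: "\<exists>x. u - Polynomial.smult m v = x\<^sup>2" "\<exists>x. u + Polynomial.smult m v = x\<^sup>2"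
      using sq[of m] m1(3) z m by auto
    \<comment> \<open>\<open>k\<close> makes p' - q' proportional to u - m v, and then 1 / k^2 in
      the role of \<open>l\<close> makes the other difference proportional to u + m v. The four new
      squares thus form a configuration of the same kind, of half the degree.\<close>
    define k where "k = (m - 1) / (m + 1)"
    have k0: "k \<noteq> 0" using m1' by (simp add: k_def)
    have k1: "k\<^sup>2 \<noteq> 1"
    proof
      assume "k\<^sup>2 = 1"
      then have "(m - 1)\<^sup>2 = (m + 1)\<^sup>2" using m1' by (simp add: k_def power_divide field_simps)
      then have "4 * m = 0" by Groebner_Basis.algebra
      then show False using m1(3) four_nonzero[OF two] by simp
    qed
    define p' where "p' = u - v"
    define q' where "q' = Polynomial.smult k (u + v)"
    have km: "1 - k = 2 / (m + 1)" "1 + k = 2 * m / (m + 1)" using m1' by (simp_all add: k_def field_simps)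
    have km': "1 - 1 / k = - 2 / (m - 1)" "1 + 1 / k = 2 * m / (m - 1)" using m1' by (simp_all add: k_def field_simps)
    have d1: "p' - q' = Polynomial.smult (2 / (m + 1)) (u - Polynomial.smult m v)"
    proof -
      have "p' - q' = Polynomial.smult (1 - k) u - Polynomial.smult (1 + k) v"
        by (simp add: p'_def q'_def smult_add_left smult_diff_left smult_add_right)
      then show ?thesis unfolding km by (simp add: smult_diff_right)
    qed
    have d2: "p' - Polynomial.smult (1 / k\<^sup>2) q' = Polynomial.smult (- 2 / (m - 1)) (u + Polynomial.smult m v)"
    proof -
      have "p' - Polynomial.smult (1 / k\<^sup>2) q' = Polynomial.smult (1 - 1 / k) u - Polynomial.smult (1 + 1 / k) v"
        using k0 by (simp add: p'_def q'_def smult_add_left smult_diff_left smult_add_right power2_eq_square)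
      then show ?thesis unfolding km' by (simp add: smult_add_right)
    qed
    have "degree p' = 0 \<and> degree q' = 0"
    proof (rule less.hyps[of p' q' "1 / k\<^sup>2"])
      have dp: "degree p = 2 * degree u" "degree q = 2 * degree v"
        unfolding u v by (cases "u = 0", simp, simp add: degree_power_eq, cases "v = 0", simp, simp add: degree_power_eq)
      have "degree p' \<le> max (degree u) (degree v)" unfolding p'_def by (intro degree_diff_le) auto
      moreover have "degree q' \<le> max (degree u) (degree v)"
        unfolding q'_def by (intro order.trans[OF degree_smult_le] degree_add_le) auto
      ultimately show "max (degree p') (degree q') < max (degree p) (degree q)"
        using n dp by auto
      show "no_common_root p' q'"
        using ncr[of 1] k0 unfolding no_common_root_def p'_def q'_def by simp
      show "1 / k\<^sup>2 \<noteq> 0" "1 / k\<^sup>2 \<noteq> 1" using k0 k1 by auto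
      show "\<exists>x. p' = x\<^sup>2" unfolding p'_def by (rule s1)
      show "\<exists>x. q' = x\<^sup>2" unfolding q'_def by (intro scaled_square s1)
      show "\<exists>x. p' - q' = x\<^sup>2" unfolding d1 by (intro scaled_square sm)
      show "\<exists>x. p' - Polynomial.smult (1 / k\<^sup>2) q' = x\<^sup>2" unfolding d2 by (intro scaled_square sm)
    qed
    then have p': "degree (u - v) = 0" and q': "degree (u + v) = 0" using k0 by (simp_all add: p'_def q'_def)
    have "degree ((u + v) + (u - v)) = 0" "degree ((u + v) - (u - v)) = 0"
      using degree_add_le[of "u + v" 0 "u - v"] degree_diff_le[of "u + v" 0 "u - v"] p' q' by simp_all
    moreover have "(u + v) + (u - v) = Polynomial.smult 2 u" "(u + v) - (u - v) = Polynomial.smult 2 v"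
      by (simp_all add: numeral_poly algebra_simps flip: mult_2)
    ultimately have "degree u = 0" "degree v = 0" using two by simp_all
    then show False using n by (simp add: u v degree_0_power)
  qed
qed

lemma cubic_roots:
  fixes a b :: "'a::alg_closed_field"
  assumes "4 * a ^ 3 + 27 * b\<^sup>2 \<noteq> 0"
  obtains e1 e2 e3 where "e1 \<noteq> e2" "e1 \<noteq> e3" "e2 \<noteq> e3" "e1 + e2 + e3 = 0" "e1 * e2 + e1 * e3 + e2 * e3 = a" "e1 * e2 * e3 = - b"
proof -
  obtain e1 where e1: "e1 ^ 3 + a * e1 + b = 0"
    using alg_closed_imp_poly_has_root[of "[:b, a, 0, 1:]"] by (auto simp: algebra_simps power3_eq_cube)
  obtain e2 where e2: "e2\<^sup>2 + e1 * e2 + (e1\<^sup>2 + a) = 0"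
    using alg_closed_imp_poly_has_root[of "[:e1\<^sup>2 + a, e1, 1:]"] by (auto simp: algebra_simps power2_eq_square)
  define e3 where "e3 = - e1 - e2"
  have s: "e1 + e2 + e3 = 0" by (simp add: e3_def)
  have a: "e1 * e2 + e1 * e3 + e2 * e3 = a" using e2 unfolding e3_def by Groebner_Basis.algebra
  have b: "e1 * e2 * e3 = - b" using e1 e2 unfolding e3_def by Groebner_Basis.algebra
  have "4 * a ^ 3 + 27 * b\<^sup>2 = - ((e1 - e2) * (e1 - e3) * (e2 - e3))\<^sup>2"
  proof -
    have b': "b = - (e1 * e2 * e3)" using b by simp
    show ?thesis unfolding b' a[symmetric] unfolding e3_def by Groebner_Basis.algebra
  qed
  then have "e1 \<noteq> e2" "e1 \<noteq> e3" "e2 \<noteq> e3" using assms by auto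
  then show ?thesis using that s a b by blast
qed

lemma reduce_fraction:
  fixes p q :: "'a::field poly"
  assumes "q \<noteq> 0"
  obtains p' q' where "q' \<noteq> 0" "no_common_root p' q'" "p * q' = p' * q"
  using assms
proof (induction "degree q" arbitrary: p q thesis rule: less_induct)
  case less
  show ?case
  proof (cases "no_common_root p q")
    case True
    then show ?thesis using less.prems by blast
  next
    case False
    then obtain t where "poly p t = 0" "poly q t = 0" by (auto simp: no_common_root_def)
    then obtain p1 q1 where p: "p = [:- t, 1:] * p1" and q: "q = [:- t, 1:] * q1"
      by (meson dvdE poly_eq_0_iff_dvd)
    have q1: "q1 \<noteq> 0" using less.prems(2) q by auto
    then have "degree q1 < degree q" unfolding q by (subst degree_mult_eq) auto
    from less.hyps[OF this _ q1, of p1]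
    obtain p' q' where "q' \<noteq> 0" "no_common_root p' q'" "p1 * q' = p' * q1" by blast
    moreover from this have "p * q' = p' * q" unfolding p q by (metis mult.left_commute mult.assoc)
    ultimately show ?thesis using less.prems(1) by blast
  qed
qed

text \<open>In lowest terms, q (p - e1 q)(p - e2 q)(p - e3 q) times a square is a square. Its
  factors have pairwise no common root, so each is a square, unless some factor is zero and the
  abscissa is constant at once. The descent on four squares then applies.\<close>

lemma elliptic_abscissa_constant:
  fixes p q r s :: "'a::alg_closed_field poly"
  assumes two: "(2::'a) \<noteq> 0" and disc: "4 * a ^ 3 + 27 * b\<^sup>2 \<noteq> 0" and q0: "q \<noteq> 0" and s0: "s \<noteq> 0"
    and eq: "r\<^sup>2 * q ^ 3 = s\<^sup>2 * (p ^ 3 + [:a:] * p * q\<^sup>2 + [:b:] * q ^ 3)"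
  shows "\<exists>e. p = Polynomial.smult e q"
proof -
  obtain p' q' where pq: "q' \<noteq> 0" "no_common_root p' q'" "p * q' = p' * q"
    by (rule reduce_fraction[OF q0])
  obtain e1 e2 e3 where e: "e1 \<noteq> e2" "e1 \<noteq> e3" "e2 \<noteq> e3" "e1 + e2 + e3 = 0"
      "e1 * e2 + e1 * e3 + e2 * e3 = a" "e1 * e2 * e3 = - b"
    by (rule cubic_roots[OF disc])
  have "q ^ 3 * (r\<^sup>2 * q' ^ 3) = q ^ 3 * (s\<^sup>2 * (p' ^ 3 + [:a:] * p' * q'\<^sup>2 + [:b:] * q' ^ 3))"
  proof -
    have "q ^ 3 * (r\<^sup>2 * q' ^ 3) = s\<^sup>2 * ((p * q') ^ 3 + [:a:] * (p * q') * (q * q')\<^sup>2 + [:b:] * (q * q') ^ 3)"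
      using eq by Groebner_Basis.algebra
    then show ?thesis unfolding pq(3) by Groebner_Basis.algebra
  qed
  then have eq': "r\<^sup>2 * q' ^ 3 = s\<^sup>2 * (p' ^ 3 + [:a:] * p' * q'\<^sup>2 + [:b:] * q' ^ 3)"
    using q0 by simp
  define N where "N e = p' - Polynomial.smult e q'" for e
  have N: "p' ^ 3 + [:a:] * p' * q'\<^sup>2 + [:b:] * q' ^ 3 = N e1 * N e2 * N e3"
  proof -
    have ab: "[:a:] = [:e1:] * [:e2:] + [:e1:] * [:e3:] + [:e2:] * [:e3:]" "[:b:] = - ([:e1:] * [:e2:] * [:e3:])"
      "[:e1:] + [:e2:] + [:e3:] = 0"
      using e(4-6) by (simp_all add: algebra_simps)
    have N': "N x = p' - [:x:] * q'" for x by (simp add: N_def)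
    show ?thesis using ab(3) unfolding ab(1,2) N' by Groebner_Basis.algebra
  qed
  have cases: "Polynomial.smult e q' = p' \<Longrightarrow> ?thesis" for e
  proof -
    assume "Polynomial.smult e q' = p'"
    then have "q' * p = q' * Polynomial.smult e q" using pq(3) by (auto simp: mult.commute)
    then have "p = Polynomial.smult e q" using pq(1) mult_cancel_left by blast
    then show ?thesis by blast
  qed
  show ?thesis
  proof (cases "N e1 = 0 \<or> N e2 = 0 \<or> N e3 = 0")
    case True
    then show ?thesis using cases unfolding N_def by auto
  next
    case False
    then have Nn: "N e1 \<noteq> 0" "N e2 \<noteq> 0" "N e3 \<noteq> 0" by auto
    have sq: "s\<^sup>2 * (q' * N e1 * N e2 * N e3) = (r * q'\<^sup>2)\<^sup>2"
      using eq' unfolding N by Groebner_Basis.algebra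
    have ev: "even (Polynomial.order t q' + Polynomial.order t (N e1) + Polynomial.order t (N e2) + Polynomial.order t (N e3))" for t
    proof -
      have n0: "s\<^sup>2 * (q' * N e1 * N e2 * N e3) \<noteq> 0" using s0 pq(1) Nn by simp
      have "even (Polynomial.order t (s\<^sup>2 * (q' * N e1 * N e2 * N e3)))"
        by (rule square_even_order[OF sq n0])
      moreover have "Polynomial.order t (s\<^sup>2 * (q' * N e1 * N e2 * N e3)) = 2 * Polynomial.order t s
         + (Polynomial.order t q' + Polynomial.order t (N e1) + Polynomial.order t (N e2) + Polynomial.order t (N e3))"
        using s0 pq(1) Nn by (simp add: power2_eq_square order_mult)
      ultimately show ?thesis by simp
    qed
    have o0: "Polynomial.order t x = 0" if "poly x t \<noteq> 0" for x :: "'a poly" and t using that by (rule order_0I)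
    have nq: "poly (N e) t \<noteq> 0" if "poly q' t = 0" for e t
      using pq(2) that unfolding no_common_root_def N_def by auto
    have nN: "poly (N e') t \<noteq> 0" if "poly (N e) t = 0" "e \<noteq> e'" for e e' t
    proof
      assume "poly (N e') t = 0"
      then have "poly p' t = e * poly q' t" "e * poly q' t = e' * poly q' t" using that(1) by (auto simp: N_def)
      then have "poly q' t = 0" using that(2) by simp
      then show False using nq that(1) by blast
    qed
    have "\<exists>u. q' = u\<^sup>2"
    proof (rule even_order_imp_square[OF pq(1)])
      fix t show "even (Polynomial.order t q')"
      proof (cases "poly q' t = 0")
        case True
        then have "Polynomial.order t (N e) = 0" for e using nq o0 by blast
        then show ?thesis using ev[of t] by simp
      qed (simp add: o0)
    qed
    moreover have sqN: "\<exists>u. N x = u\<^sup>2" if x: "N x \<noteq> 0" "x \<noteq> y" "x \<noteq> z"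
      and ev': "\<And>t. even (Polynomial.order t q' + Polynomial.order t (N x) + Polynomial.order t (N y) + Polynomial.order t (N z))"
      for x y z
    proof (rule even_order_imp_square[OF x(1)])
      fix t show "even (Polynomial.order t (N x))"
      proof (cases "poly (N x) t = 0")
        case True
        then have "poly q' t \<noteq> 0" using nq by blast
        then have "Polynomial.order t q' = 0" by (rule o0)
        moreover have "Polynomial.order t (N y) = 0" by (rule o0[OF nN[OF True x(2)]])
        moreover have "Polynomial.order t (N z) = 0" by (rule o0[OF nN[OF True x(3)]])
        ultimately show ?thesis using ev'[of t] by simp
      qed (simp add: o0)
    qed
    moreover have "\<exists>u. N e1 = u\<^sup>2" by (rule sqN[OF Nn(1) e(1,2)]) (use ev in simp)
    moreover have "\<exists>u. N e2 = u\<^sup>2" by (rule sqN[OF Nn(2) e(1)[symmetric] e(3)]) (use ev in \<open>simp add: add_ac\<close>)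
    moreover have "\<exists>u. N e3 = u\<^sup>2" by (rule sqN[OF Nn(3) e(2)[symmetric] e(3)[symmetric]]) (use ev in \<open>simp add: add_ac\<close>)
    ultimately have sqs: "\<exists>u. q' = u\<^sup>2" "\<exists>u. N e1 = u\<^sup>2" "\<exists>u. N e2 = u\<^sup>2" "\<exists>u. N e3 = u\<^sup>2" by blast+
    \<comment> \<open>The normalization sends e1, e2, e3 to 0, 1, l: with it N e1 - Q = N e2 and N
      e1 - l Q = N e3.\<close>
    define Q where "Q = Polynomial.smult (e2 - e1) q'"
    define l where "l = (e3 - e1) / (e2 - e1)"
    have "degree (N e1) = 0 \<and> degree Q = 0"
    proof (rule four_squares_constant[OF two, of _ _ l])
      show "no_common_root (N e1) Q"
        using nq[of _ e1] e(1) unfolding no_common_root_def Q_def by auto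
      show "l \<noteq> 0" "l \<noteq> 1" using e(1-3) by (auto simp: l_def)
      show "\<exists>u. N e1 = u\<^sup>2" by (rule sqs)
      show "\<exists>u. Q = u\<^sup>2" unfolding Q_def by (intro scaled_square sqs)
      have "N e1 - Q = N e2" by (simp add: N_def Q_def smult_diff_left)
      then show "\<exists>u. N e1 - Q = u\<^sup>2" using sqs by simp
      have "Polynomial.smult l Q = Polynomial.smult (e3 - e1) q'"
        using e(1) by (simp add: Q_def l_def)
      then have "N e1 - Polynomial.smult l Q = N e3"
        by (simp add: N_def smult_diff_left)
      then show "\<exists>u. N e1 - Polynomial.smult l Q = u\<^sup>2" using sqs by simp
    qed
    then have "degree q' = 0" "degree (N e1) = 0" using e(1) by (auto simp: Q_def)
    then obtain x y where "q' = [:x:]" "N e1 = [:y:]" by (metis degree_eq_zeroE)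
    then have "Polynomial.smult (y / x + e1) q' = p'" using pq(1) by (auto simp: N_def algebra_simps)
    then show ?thesis by (rule cases)
  qed
qed

text \<open>The factor is a quotient of two coefficients, hence already in \<open>k\<close>. It
  brings conclusions reached over the algebraic closure back to the ground field.\<close>

lemma proportional_over_alg_closure:
  fixes p q :: "'k::field poly"
  assumes "map_poly to_ac p = Polynomial.smult e (map_poly to_ac q)" "q \<noteq> 0"
  shows "\<exists>c. p = Polynomial.smult c q"
proof -
  obtain i where i: "coeff q i \<noteq> 0" using assms(2) by (auto simp: poly_eq_iff)
  have c: "to_ac (coeff p j) = e * to_ac (coeff q j)" for j
    using arg_cong[OF assms(1), of "\<lambda>x. coeff x j"] by (simp add: coeff_map_poly)
  have "e = to_ac (coeff p i / coeff q i)" using c[of i] i by simp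
  then have k: "to_ac (coeff p j) = to_ac (coeff (Polynomial.smult (coeff p i / coeff q i) q) j)" for j
    by (subst c) simp
  have "p = Polynomial.smult (coeff p i / coeff q i) q"
    by (rule poly_eqI, rule injD[OF inj_to_ac], rule k)
  then show ?thesis by (rule exI)
qed

theorem elliptic_point_constant:
  fixes x y :: "'k::field poly fract" and a b :: 'k
  assumes two: "(2::'k) \<noteq> 0" and disc: "4 * a ^ 3 + 27 * b\<^sup>2 \<noteq> 0"
    and eq: "y\<^sup>2 = x ^ 3 + fraction_const a * x + fraction_const b"
  obtains x0 y0 where "x = fraction_const x0" "y = fraction_const y0"
proof -
  define h where "h = (map_poly to_ac :: 'k poly \<Rightarrow> 'k alg_closure poly)"
  have rh: "ring_morphism h" unfolding h_def by (rule ring_morphism_map_poly[OF ring_morphism_to_ac])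
  have hc: "h [:c:] = [:to_ac c:]" for c unfolding h_def by (rule map_poly_const[OF ring_morphism_to_ac])
  have h0: "h p \<noteq> 0" if "p \<noteq> 0" for p using that by (auto simp: h_def poly_eq_iff coeff_map_poly)
  have ac: "(2 :: 'k alg_closure) \<noteq> 0" "4 * (to_ac a) ^ 3 + 27 * (to_ac b)\<^sup>2 \<noteq> 0"
    using two disc to_ac_eq_0_iff[of "2::'k"] to_ac_eq_0_iff[of "4 * a ^ 3 + 27 * b\<^sup>2"] by simp_all
  obtain p q where x: "x = to_fract p / to_fract q" and q0: "q \<noteq> 0"
    using Fract_cases[of x] by (auto simp: Fract_conv_to_fract)
  obtain r s where y: "y = to_fract r / to_fract s" and s0: "s \<noteq> 0"
    using Fract_cases[of y] by (auto simp: Fract_conv_to_fract)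
  have "to_fract (r\<^sup>2 * q ^ 3) = to_fract (s\<^sup>2 * (p ^ 3 + [:a:] * p * q\<^sup>2 + [:b:] * q ^ 3))"
  proof -
    define x' y' where "x' = to_fract q" and "y' = to_fract s"
    have n: "x' \<noteq> 0" "y' \<noteq> 0" using q0 s0 by (simp_all add: x'_def y'_def)
    have "to_fract p = x * x'" "to_fract r = y * y'" using n by (simp_all add: x y x'_def y'_def)
    moreover have "(y * y')\<^sup>2 * x' ^ 3 = y'\<^sup>2 * ((x * x') ^ 3 + fraction_const a * (x * x') * x'\<^sup>2 + fraction_const b * x' ^ 3)"
      using eq by Groebner_Basis.algebra
    ultimately show ?thesis
      unfolding ring_morphism_simps[OF ring_morphism_to_fract] fraction_const_def[symmetric] x'_def[symmetric] y'_def[symmetric]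
      by simp
  qed
  then have e: "r\<^sup>2 * q ^ 3 = s\<^sup>2 * (p ^ 3 + [:a:] * p * q\<^sup>2 + [:b:] * q ^ 3)" by (simp only: to_fract_eq_iff)
  have "(h r)\<^sup>2 * h q ^ 3 = (h s)\<^sup>2 * (h p ^ 3 + [:to_ac a:] * h p * (h q)\<^sup>2 + [:to_ac b:] * h q ^ 3)"
    using arg_cong[OF e, of h] by (simp only: ring_morphism_simps[OF rh] hc)
  then obtain e where "h p = Polynomial.smult e (h q)"
    using elliptic_abscissa_constant[OF ac h0[OF q0] h0[OF s0]] by blast
  then obtain x0 where "p = Polynomial.smult x0 q"
    using proportional_over_alg_closure[OF _ q0] unfolding h_def by blast
  then have "to_fract p = fraction_const x0 * to_fract q"
    unfolding fraction_const_def by (simp flip: to_fract_mult)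
  then have x0: "x = fraction_const x0" using q0 by (simp add: x)
  define c where "c = x0 ^ 3 + a * x0 + b"
  have "y\<^sup>2 = fraction_const c"
    unfolding eq x0 c_def ring_morphism_simps[OF ring_morphism_fraction_const] ..
  then have "(to_fract r)\<^sup>2 = fraction_const c * (to_fract s)\<^sup>2"
    using s0 by (simp add: y power_divide field_simps)
  then have "to_fract (r\<^sup>2) = to_fract ([:c:] * s\<^sup>2)"
    unfolding ring_morphism_simps[OF ring_morphism_to_fract] fraction_const_def .
  then have rs: "r\<^sup>2 = [:c:] * s\<^sup>2" by (simp only: to_fract_eq_iff)
  obtain d where d: "d\<^sup>2 = to_ac c" using sqrt_exists by blast
  have "(h r)\<^sup>2 = [:to_ac c:] * (h s)\<^sup>2"
    using arg_cong[OF rs, of h] by (simp only: ring_morphism_simps[OF rh] hc)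
  then have "(h r - [:d:] * h s) * (h r + [:d:] * h s) = 0"
    unfolding d[symmetric] by (simp add: algebra_simps power2_eq_square)
  then have "h r = Polynomial.smult d (h s) \<or> h r = Polynomial.smult (- d) (h s)"
    by (auto simp: add_eq_0_iff2)
  then obtain y0 where "r = Polynomial.smult y0 s"
    using proportional_over_alg_closure[OF _ s0] unfolding h_def by blast
  then have "to_fract r = fraction_const y0 * to_fract s"
    unfolding fraction_const_def by (simp flip: to_fract_mult)
  then have "y = fraction_const y0" using s0 by (simp add: y)
  with x0 show ?thesis by (rule that)
qed

section \<open>Algebraic constants\<close>

text \<open>Views a field type as a ring structure, to which the theory of subfields and finite
  extensions applies. Two facts are wanted from it: the algebraic constants form a field, and
  algebraicity is transitive.\<close>

abbreviation type_ring :: "'b::field ring" where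
  "type_ring \<equiv> ring_of_type_algebra"

abbreviation algebraic_over :: "'b::field set \<Rightarrow> 'b \<Rightarrow> bool" where
  "algebraic_over S x \<equiv> \<not> ring.transcendental type_ring S x"

lemma type_ring_simps:
  "carrier (type_ring :: 'b::field ring) = UNIV" "x \<otimes>\<^bsub>type_ring\<^esub> y = x * (y :: 'b)"
  "x \<oplus>\<^bsub>type_ring\<^esub> y = x + (y :: 'b)" "\<one>\<^bsub>type_ring\<^esub> = (1 :: 'b)" "\<zero>\<^bsub>type_ring\<^esub> = (0 :: 'b)"
  by (simp_all add: ring_of_type_algebra_def)

lemma type_ring_pow: "x [^]\<^bsub>type_ring\<^esub> n = (x :: 'b::field) ^ (n :: nat)"
proof -
  interpret R: Ring.field "type_ring :: 'b ring" by (rule field_from_type_algebra)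
  show ?thesis by (induction n) (simp_all add: type_ring_simps R.nat_pow_Suc)
qed

lemma type_ring_minus: "\<ominus>\<^bsub>type_ring\<^esub> x = - (x :: 'b::field)"
proof -
  interpret R: Ring.field "type_ring :: 'b ring" by (rule field_from_type_algebra)
  show ?thesis using R.minus_equality[of "- x" x] by (simp add: type_ring_simps)
qed

lemma type_ring_inv: "x \<noteq> 0 \<Longrightarrow> inv\<^bsub>type_ring\<^esub> x = inverse (x :: 'b::field)"
proof -
  interpret R: Ring.field "type_ring :: 'b ring" by (rule field_from_type_algebra)
  assume "x \<noteq> 0"
  then show ?thesis using R.comm_inv_char[of x "inverse x"] by (simp add: type_ring_simps)
qed

lemma type_ring_eval: "ring.eval type_ring p x = poly (Poly (rev p)) (x :: 'b::field)"
proof -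
  interpret R: Ring.field "type_ring :: 'b ring" by (rule field_from_type_algebra)
  show ?thesis
    by (induction p) (simp_all add: type_ring_simps type_ring_pow Poly_append poly_monom)
qed

lemma algebraic_over_iff:
  assumes S: "subring S (type_ring :: 'b::field ring)"
  shows "algebraic_over S x \<longleftrightarrow> (\<exists>q. q \<noteq> 0 \<and> (\<forall>i. coeff q i \<in> S) \<and> poly q x = 0)"
proof -
  interpret R: Ring.field "type_ring :: 'b ring" by (rule field_from_type_algebra)
  have S0: "0 \<in> S" using subringE(2)[OF S] by (simp add: type_ring_simps)
  show ?thesis
  proof
    assume "algebraic_over S x"
    then have "((R.algebraic over S) x)" by (simp add: over_def)
    then obtain p where p: "p \<in> carrier (S[X]\<^bsub>type_ring\<^esub>)" "p \<noteq> []" "R.eval p x = \<zero>\<^bsub>type_ring\<^esub>"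
      using R.algebraicE[OF S, of x] by (auto simp: type_ring_simps)
    have hd: "hd p \<noteq> 0" "set p \<subseteq> S"
      using p(1,2) by (auto simp: univ_poly_def polynomial_def type_ring_simps)
    define q where "q = Poly (rev p)"
    have q: "coeff q i = (if i < length p then p ! (length p - Suc i) else 0)" for i
      by (simp add: q_def nth_default_def rev_nth)
    have "coeff q (length p - 1) \<noteq> 0"
      using p(2) hd(1) by (simp add: q hd_conv_nth)
    then have "q \<noteq> 0" by auto
    moreover have "coeff q i \<in> S" for i using hd(2) S0 by (auto simp: q subset_iff)
    moreover have "poly q x = 0" using p(3) by (simp add: type_ring_eval type_ring_simps q_def)
    ultimately show "\<exists>q. q \<noteq> 0 \<and> (\<forall>i. coeff q i \<in> S) \<and> poly q x = 0" by blast
  next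
    assume "\<exists>q. q \<noteq> 0 \<and> (\<forall>i. coeff q i \<in> S) \<and> poly q x = 0"
    then obtain q where q: "q \<noteq> 0" "\<forall>i. coeff q i \<in> S" "poly q x = 0" by blast
    define p where "p = rev (coeffs q)"
    have ne: "coeffs q \<noteq> []" using q(1) by simp
    have "hd p \<noteq> 0" using ne q(1) by (simp add: p_def hd_rev last_coeffs_eq_coeff_degree)
    moreover have "set p \<subseteq> S" using q(2) by (auto simp: p_def coeffs_def)
    ultimately have "p \<in> carrier (S[X]\<^bsub>type_ring\<^esub>)"
      by (auto simp: univ_poly_def polynomial_def type_ring_simps)
    moreover have "R.eval p x = \<zero>\<^bsub>type_ring\<^esub>" using q(3) by (simp add: type_ring_eval type_ring_simps p_def)
    ultimately have "(R.algebraic over S) x" using ne by (intro R.algebraicI) (auto simp: p_def)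
    then show "algebraic_over S x" by (simp add: over_def)
  qed
qed

lemma subfield_range_ring_morphism:
  fixes h :: "'a::field \<Rightarrow> 'b::field"
  assumes h: "ring_morphism h"
  shows "subfield (range h) type_ring"
proof -
  interpret R: Ring.field "type_ring :: 'b ring" by (rule field_from_type_algebra)
  show ?thesis
  proof (intro R.subfieldI' R.subringI)
    show "\<one>\<^bsub>type_ring\<^esub> \<in> range h" using ring_morphism_1[OF h] by (metis rangeI type_ring_simps(4))
    show "\<ominus>\<^bsub>type_ring\<^esub> x \<in> range h" if "x \<in> range h" for x
      using that by (auto simp: type_ring_minus simp flip: ring_morphism_minus[OF h])
    show "x \<otimes>\<^bsub>type_ring\<^esub> y \<in> range h" if "x \<in> range h" "y \<in> range h" for x y
      using that by (auto simp: type_ring_simps simp flip: ring_morphism_mult[OF h])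
    show "x \<oplus>\<^bsub>type_ring\<^esub> y \<in> range h" if "x \<in> range h" "y \<in> range h" for x y
      using that by (auto simp: type_ring_simps simp flip: ring_morphism_add[OF h])
    show "inv\<^bsub>type_ring\<^esub> x \<in> range h" if x: "x \<in> range h - {\<zero>\<^bsub>type_ring\<^esub>}" for x
    proof -
      obtain y where y: "x = h y" "h y \<noteq> 0" using x by (auto simp: type_ring_simps)
      then have "y \<noteq> 0" using ring_morphism_0[OF h] by auto
      then have "h y * h (inverse y) = 1"
        by (simp add: ring_morphism_1[OF h] flip: ring_morphism_mult[OF h])
      then have "inverse (h y) = h (inverse y)" by (rule inverse_unique)
      then show ?thesis using y by (simp add: type_ring_inv)
    qed
  qed (simp add: type_ring_simps)
qed

lemma subfield_algebraic_over:
  assumes "subfield S (type_ring :: 'b::field ring)"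
  shows "subfield {x. algebraic_over S x} type_ring"
proof -
  interpret R: Ring.field "type_ring :: 'b ring" by (rule field_from_type_algebra)
  show ?thesis using R.subfield_of_algebraics[OF assms] by (simp add: type_ring_simps over_def)
qed

text \<open>Adjoining the coefficients of \<open>q\<close> gives a finite extension
  \<open>E\<close>; adjoining \<open>x\<close> to \<open>E\<close> is again finite, and so is the
  tower over \<open>S\<close>.\<close>

lemma algebraic_over_trans:
  assumes S: "subfield S (type_ring :: 'b::field ring)"
    and q: "q \<noteq> 0" "\<And>i. algebraic_over S (coeff q i)" "poly q x = 0"
  shows "algebraic_over S x"
proof -
  interpret R: Ring.field "type_ring :: 'b ring" by (rule field_from_type_algebra)
  define xs where "xs = coeffs q"
  have c: "set xs \<subseteq> carrier type_ring" by (simp add: type_ring_simps)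
  have xs: "(R.algebraic over S) y" if "y \<in> set xs" for y
  proof -
    have "y \<in> range (coeff q)" using that by (simp add: xs_def range_coeff)
    then show ?thesis using q(2) by (auto simp: over_def)
  qed
  define E where "E = R.finite_extension S xs"
  have E: "subfield E type_ring" unfolding E_def
    by (rule R.finite_extension_is_subfield[OF S c xs])
  have fE: "R.finite_dimension S E" unfolding E_def
    by (rule R.finite_extension_finite_dimension(1)[OF S c xs])
  have "set xs \<subseteq> E" unfolding E_def by (rule R.finite_extension_mem[OF subfieldE(1)[OF S] c])
  moreover have "0 \<in> E" using subringE(2)[OF subfieldE(1)[OF E]] by (simp add: type_ring_simps)
  ultimately have "range (coeff q) \<subseteq> E"
    unfolding range_coeff xs_def by simp
  then have "\<forall>i. coeff q i \<in> E" by (simp add: image_subset_iff)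
  then have "algebraic_over E x"
    using q(1,3) algebraic_over_iff[OF subfieldE(1)[OF E]] by blast
  then have aE: "(R.algebraic over E) x" by (simp add: over_def)
  have xc: "x \<in> carrier type_ring" by (simp add: type_ring_simps)
  have "R.finite_dimension E (R.simple_extension E x)"
    using R.finite_dimension_simple_extension[OF E xc] aE by blast
  then have f: "R.finite_dimension S (R.simple_extension E x)"
    by (rule R.telescopic_base_dim(1)[OF S E fE])
  have "subring (R.simple_extension E x) type_ring"
    by (rule R.simple_extension_is_subring[OF subfieldE(1)[OF E] xc])
  from R.finite_dimension_imp_algebraic[OF S this f R.simple_extension_mem[OF subfieldE(1)[OF E] xc]]
  show ?thesis by (simp add: over_def)
qed

lemma algebraic_const_iff_algebraic_over:
  "algebraic_const (x :: 'k::field radical) \<longleftrightarrow> algebraic_over (range const_fun) x"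
proof -
  note rc = ring_morphism_const_fun[where 'a = 'k]
  have inj: "inj (const_fun :: 'k \<Rightarrow> _)" by (auto simp: inj_def const_fun_def)
  have c0: "const_fun (0::'k) = 0" by (rule ring_morphism_0[OF rc])
  have "algebraic_const x \<longleftrightarrow> (\<exists>q. q \<noteq> 0 \<and> (\<forall>i. coeff q i \<in> range const_fun) \<and> poly q x = 0)"
  proof
    assume "algebraic_const x"
    then obtain p :: "'k poly" where p: "p \<noteq> 0" "poly (map_poly const_fun p) x = 0"
      by (auto simp: algebraic_const_def)
    have "map_poly const_fun p \<noteq> 0"
      using p(1) c0 inj by (auto simp: poly_eq_iff coeff_map_poly inj_def) metis
    then show "\<exists>q. q \<noteq> 0 \<and> (\<forall>i. coeff q i \<in> range const_fun) \<and> poly q x = 0"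
      using p(2) c0 by (intro exI[of _ "map_poly const_fun p"]) (auto simp: coeff_map_poly)
  next
    assume "\<exists>q. q \<noteq> 0 \<and> (\<forall>i. coeff q i \<in> range const_fun) \<and> poly q x = 0"
    then obtain q where q: "q \<noteq> 0" "\<And>i. coeff q i \<in> range (const_fun :: 'k \<Rightarrow> _)" "poly q x = 0" by blast
    define p where "p = map_poly (inv_into UNIV const_fun) q"
    have i0: "inv_into UNIV const_fun 0 = (0::'k)" using inv_f_f[OF inj, of 0] c0 by simp
    have "map_poly const_fun p = q"
      using q(2) by (intro poly_eqI) (simp add: p_def coeff_map_poly c0 i0 f_inv_into_f)
    moreover from this have "p \<noteq> 0" using q(1) by auto
    ultimately show "algebraic_const x" using q(3) by (auto simp: algebraic_const_def)
  qed
  then show ?thesis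
    using algebraic_over_iff[OF subfieldE(1)[OF subfield_range_ring_morphism[OF rc]]] by simp
qed

lemma algebraic_const_field:
  fixes x y :: "'k::field radical" and c :: 'k
  shows "algebraic_const x \<Longrightarrow> algebraic_const y \<Longrightarrow> algebraic_const (x + y)"
    "algebraic_const x \<Longrightarrow> algebraic_const y \<Longrightarrow> algebraic_const (x * y)"
    "algebraic_const x \<Longrightarrow> algebraic_const (inverse x)"
    "algebraic_const (const_fun c)"
proof -
  have S: "subfield (range (const_fun :: 'k \<Rightarrow> _)) type_ring"
    by (rule subfield_range_ring_morphism[OF ring_morphism_const_fun])
  have A: "subfield {x. algebraic_const (x :: 'k radical)} type_ring"
    using subfield_algebraic_over[OF S] by (simp add: algebraic_const_iff_algebraic_over)
  interpret R: Ring.field "type_ring :: 'k radical ring" by (rule field_from_type_algebra)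
  show "algebraic_const x \<Longrightarrow> algebraic_const y \<Longrightarrow> algebraic_const (x + y)"
    using subringE(7)[OF subfieldE(1)[OF A], of x y] by (simp add: type_ring_simps)
  show "algebraic_const x \<Longrightarrow> algebraic_const y \<Longrightarrow> algebraic_const (x * y)"
    using subringE(6)[OF subfieldE(1)[OF A], of x y] by (simp add: type_ring_simps)
  have c: "algebraic_const (const_fun c :: 'k radical)" for c
    unfolding algebraic_const_def
    by (intro exI[of _ "[:- c, 1:]"])
       (simp add: map_poly_pCons ring_morphism_simps[OF ring_morphism_const_fun])
  then show "algebraic_const (const_fun c :: 'k radical)" .
  show "algebraic_const x \<Longrightarrow> algebraic_const (inverse x)"
  proof (cases "x = 0")
    case True
    then show ?thesis using c[of 0] by (simp add: ring_morphism_0[OF ring_morphism_const_fun])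
  next
    case False
    assume "algebraic_const x"
    then show ?thesis
      using R.subfield_m_inv(1)[OF A, of x] False by (simp add: type_ring_simps type_ring_inv)
  qed
qed

lemma algebraic_const_trans:
  fixes x :: "'k::field radical"
  assumes "q \<noteq> 0" "\<And>i. algebraic_const (coeff q i)" "poly q x = 0"
  shows "algebraic_const x"
  using algebraic_over_trans[OF subfield_range_ring_morphism[OF ring_morphism_const_fun[where 'a = 'k]] assms(1) _ assms(3)]
    assms(2) by (simp add: algebraic_const_iff_algebraic_over)

abbreviation variable :: "'k::field radical" where
  "variable \<equiv> to_ac (to_fract [:0, 1:])"

lemma poly_const_fun_variable: "poly (map_poly const_fun p) variable = to_ac (to_fract p)"
proof -
  have "eval1 const_fun variable p = to_ac (to_fract p)"
  proof (induction p)
    case (pCons a p)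
    have "pCons a p = [:a:] + [:0, 1:] * p" by simp
    then have "to_ac (to_fract (pCons a p)) = const_fun a + variable * to_ac (to_fract p)"
      unfolding const_fun_def by (metis to_ac_add to_ac_mult to_fract_add to_fract_mult)
    then show ?case using pCons by (simp add: eval1_pCons[OF ring_morphism_const_fun])
  qed (simp add: eval1_0)
  then show ?thesis by (simp add: eval1_def)
qed

lemma variable_not_algebraic: "\<not> algebraic_const variable"
  by (auto simp: algebraic_const_def poly_const_fun_variable)

text \<open>The variable is transcendental over the field of algebraic constants, so a linear relation
  over \<open>k(t)\<close> between algebraic constants comes from relations over \<open>k\<close>.\<close>

lemma algebraic_const_linear:
  fixes x y :: "'k::field radical"
  assumes x: "algebraic_const x" and y: "algebraic_const y"
    and eq: "to_ac \<mu> = y - variable * x"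
  obtains x0 y0 where "x = const_fun x0" "y = const_fun y0"
proof -
  note rc = ring_morphism_const_fun[where 'a = 'k]
  obtain g h where \<mu>: "\<mu> = to_fract g / to_fract h" and h0: "h \<noteq> 0"
    using Fract_cases[of \<mu>] by (auto simp: Fract_conv_to_fract)
  define G where "G = map_poly const_fun g"
  define H where "H = map_poly const_fun h"
  define q where "q = H * [:y, - x:] - G"
  have cGH: "coeff G i = const_fun (coeff g i)" "coeff H i = const_fun (coeff h i)" for i
    by (simp_all add: G_def H_def coeff_map_poly ring_morphism_0[OF rc])
  have alg: "algebraic_const (u - v)" if "algebraic_const u" "algebraic_const v" for u v :: "'k radical"
  proof -
    have "algebraic_const (u + const_fun (- 1) * v)"
      by (intro algebraic_const_field that)
    then show ?thesis by (simp add: ring_morphism_simps[OF rc])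
  qed
  have cq: "coeff q i = coeff H i * y - (case i of 0 \<Rightarrow> 0 | Suc j \<Rightarrow> coeff H j * x) - coeff G i" for i
  proof -
    have "H * [:y, - x:] = Polynomial.smult y H - pCons 0 (Polynomial.smult x H)"
      by simp
    then show ?thesis by (simp add: q_def coeff_pCons mult.commute split: nat.split)
  qed
  have "algebraic_const (coeff q i)" for i
  proof -
    have "algebraic_const (0 :: 'k radical)"
      using algebraic_const_field(4)[of "0 :: 'k"] by (simp only: ring_morphism_0[OF rc])
    then show ?thesis
      unfolding cq by (intro alg algebraic_const_field) (auto simp: cGH intro!: algebraic_const_field x y split: nat.split)
  qed
  moreover have "poly q variable = 0"
  proof -
    have "to_ac (to_fract h) \<noteq> 0" using h0 by simp
    then have "to_ac (to_fract h) * (y - variable * x) = to_ac (to_fract g)"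
      unfolding eq[symmetric] \<mu> by simp
    then show ?thesis by (simp add: q_def G_def H_def poly_const_fun_variable algebra_simps)
  qed
  ultimately have "q = 0" using algebraic_const_trans variable_not_algebraic by blast
  then have c0: "coeff H i * y = (case i of 0 \<Rightarrow> 0 | Suc j \<Rightarrow> coeff H j * x) + coeff G i" for i
    using cq[of i] by (simp add: diff_eq_eq add.commute)
  \<comment> \<open>At the lowest nonzero coefficient of \<open>h\<close>, the relation h (y - t x)
    = g involves only \<open>y\<close>; the next coefficient then determines
    \<open>x\<close>.\<close>
  define i where "i = (LEAST i. coeff h i \<noteq> 0)"
  have ex: "\<exists>i. coeff h i \<noteq> 0" using h0 by (auto simp: poly_eq_iff)
  then have i: "coeff h i \<noteq> 0" unfolding i_def by (rule LeastI_ex)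
  have less: "coeff h j = 0" if "j < i" for j using that not_less_Least unfolding i_def by blast
  have ci: "const_fun (coeff h i) \<noteq> 0" using i by (simp add: const_fun_def)
  have div: "const_fun (u / v) = const_fun u / const_fun v" for u v :: 'k
    by (cases "v = 0") (simp_all add: const_fun_def field_simps flip: to_ac_mult to_fract_mult)
  have "const_fun (coeff h i) * y = const_fun (coeff g i)"
    using c0[of i] less by (auto simp: cGH ring_morphism_0[OF rc] split: nat.splits)
  then have y0: "y = const_fun (coeff g i / coeff h i)" using ci by (simp add: div field_simps)
  have "const_fun (coeff h (Suc i)) * y = const_fun (coeff h i) * x + const_fun (coeff g (Suc i))"
    using c0[of "Suc i"] by (simp add: cGH)
  then have "const_fun (coeff h i) * x = const_fun (coeff h (Suc i) * (coeff g i / coeff h i) - coeff g (Suc i))"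
    unfolding y0 ring_morphism_simps[OF rc] by (simp add: algebra_simps)
  then have "x = const_fun ((coeff h (Suc i) * (coeff g i / coeff h i) - coeff g (Suc i)) / coeff h i)"
    using ci by (simp add: div field_simps)
  then show ?thesis using y0 by (rule that)
qed

section \<open>Sections and their lines\<close>

text \<open>A denominator of least degree has no nontrivial common divisor with its numerator; this
  is the divisibility form of lowest terms that \<open>rational_parameterization\<close> asks
  for.\<close>

lemma reduced_fraction:
  fixes \<mu> :: "'k::field poly fract"
  obtains g h where "h \<noteq> 0" "\<mu> * to_fract h = to_fract g" "\<And>d. d dvd g \<Longrightarrow> d dvd h \<Longrightarrow> is_unit d"
proof -
  define R where "R n \<longleftrightarrow> (\<exists>h g. h \<noteq> 0 \<and> degree h = n \<and> \<mu> * to_fract h = to_fract g)" for n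
  obtain g h where "\<mu> = to_fract g / to_fract h" "h \<noteq> 0"
    using Fract_cases[of \<mu>] by (auto simp: Fract_conv_to_fract)
  then have "R (degree h)" unfolding R_def by (intro exI[of _ h] exI[of _ g]) simp
  then have "R (LEAST n. R n)" by (rule LeastI)
  then obtain h g where hg: "h \<noteq> 0" "degree h = (LEAST n. R n)" "\<mu> * to_fract h = to_fract g"
    unfolding R_def[of "LEAST n. R n"] by blast
  have "is_unit d" if d: "d dvd g" "d dvd h" for d
  proof -
    obtain g' h' where e: "g = d * g'" "h = d * h'" using d by (auto elim!: dvdE)
    have d0: "d \<noteq> 0" "h' \<noteq> 0" using hg(1) e by auto
    then have "to_fract d \<noteq> 0" by simp
    moreover have "to_fract d * (\<mu> * to_fract h') = to_fract d * to_fract g'"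
      using hg(3) unfolding e ring_morphism_mult[OF ring_morphism_to_fract] by (simp add: mult_ac)
    ultimately have "\<mu> * to_fract h' = to_fract g'" by simp
    then have "R (degree h')" unfolding R_def using d0 by blast
    then have "degree h \<le> degree h'" unfolding hg(2) by (rule Least_le)
    moreover have "degree h = degree d + degree h'" unfolding e using d0 by (simp add: degree_mult_eq)
    ultimately have "degree d = 0" by simp
    then show "is_unit d" using d0 by (metis is_unit_iff_degree)
  qed
  then show ?thesis using that[OF hg(1,3)] by blast
qed

lemma dvd_matrix_vector_mult:
  fixes v :: "'a::comm_ring_1 ^ 3"
  assumes "\<And>i. d dvd v $ i"
  shows "d dvd (A *v v) $ i"
  by (simp add: matrix_vector_mult_def sum_3) (intro dvd_add dvd_mult assms)

lemma const_fun_fraction: "const_fun c = to_ac (fraction_const c)"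
  by (simp add: const_fun_def fraction_const_def)

lemma scalar_product_3:
  "scalar_product u v = u $ 1 * v $ 1 + u $ 2 * v $ 2 + u $ 3 * v $ 3" for u v :: "'a::comm_ring_1 ^ 3"
  by (simp add: scalar_product_def sum_3)

text \<open>The form \<open>\<Sum> p\<^sub>i u\<^sup>i z\<^bsup>n-i\<^esup>\<close> with \<open>z = - v\<close>.\<close>

definition homogenized :: "nat \<Rightarrow> 'a::comm_ring_1 poly \<Rightarrow> 'a poly3" where
  "homogenized n p = (\<Sum>i\<le>n. const3 (coeff p i) * ((coords3 $ 2) ^ i * (- (coords3 $ 1)) ^ (n - i)))"

lemma form_homogenized: "form n (homogenized n p)"
proof -
  have u: "form 1 (- (coords3 $ 1) :: 'a poly3)"
    using form_const3_mult[OF form_coords3[of 1], of "- 1"]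
    by (simp add: ring_morphism_simps[OF ring_morphism_const3])
  have "form n ((coords3 $ 2) ^ i * (- (coords3 $ 1)) ^ (n - i) :: 'a poly3)" if "i \<le> n" for i
    using form_mult[OF form_power[OF form_coords3[of 2], of i] form_power[OF u, of "n - i"]] that by simp
  then show ?thesis unfolding homogenized_def by (intro form_sum form_const3_mult) auto
qed

lemma eval3_homogenized:
  fixes p :: "'a::comm_ring_1 poly"
  assumes "degree p \<le> n" "v $ 2 = z * t" "v $ 1 = - z"
  shows "eval3 id (homogenized n p) v = z ^ n * poly p t"
proof -
  note r = ring_morphism_id(1)[where 'a = 'a]
  have "eval3 id (homogenized n p) v = (\<Sum>i\<le>n. coeff p i * ((z * t) ^ i * z ^ (n - i)))"
    by (simp add: homogenized_def ring_morphism_sum[OF ring_morphism_eval3[OF r]] eval3_simps[OF r]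
        eval3_const3[OF r] eval3_coords3[OF r] assms(2,3))
  also have "\<dots> = (\<Sum>i\<le>n. z ^ n * (coeff p i * t ^ i))"
  proof (intro sum.cong refl)
    fix i assume "i \<in> {..n}"
    then have "z ^ n = z ^ i * z ^ (n - i)" by (simp flip: power_add)
    then show "coeff p i * ((z * t) ^ i * z ^ (n - i)) = z ^ n * (coeff p i * t ^ i)"
      by (simp add: power_mult_distrib mult_ac)
  qed
  also have "\<dots> = z ^ n * (\<Sum>i\<le>n. coeff p i * t ^ i)" by (simp add: sum_distrib_left)
  also have "(\<Sum>i\<le>n. coeff p i * t ^ i) = poly p t"
    unfolding poly_altdef using assms(1)
    by (intro sum.mono_neutral_right) (auto simp: coeff_eq_0)
  finally show ?thesis .
qed

context weierstrass_cubic
begin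

text \<open>\<open>m\<close> becomes the radicand of Cardan's cube root, by which the formula
  divides; the last condition keeps the discriminant nonzero.\<close>

definition is_section :: "'k poly fract \<Rightarrow> bool" where
  "is_section \<mu> \<longleftrightarrow> (\<exists>m. m \<noteq> 0 \<and> dep_p \<mu> ^ 3 = 27 * m * (m + dep_q \<mu>) \<and> 18 * m + 9 * dep_q \<mu> \<noteq> 0)"

text \<open>The line t x - y + \<mu> = 0 with its denominator cleared, in the order v, u, w.\<close>

definition line_of_section :: "'k poly fract \<Rightarrow> 'k poly ^ 3 \<Rightarrow> bool" where
  "line_of_section \<mu> L \<longleftrightarrow> (\<exists>g h. h \<noteq> 0 \<and> \<mu> * to_fract h = to_fract g \<and>
     (\<forall>d. d dvd g \<and> d dvd h \<longrightarrow> is_unit d) \<and>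
     map_mat (\<lambda>c. [:c:]) line_matrix *v L = vector [- h, h * [:0, 1:], g])"

text \<open>The Weierstrass coordinates are normalized with last coordinate 1, so that the scalar in
  an equivalence of two such points must be 1.\<close>

definition point_of_section :: "'k poly fract \<Rightarrow> 'k radical ^ 3 \<Rightarrow> bool" where
  "point_of_section \<mu> P \<longleftrightarrow> (\<exists>x. P = map_mat const_fun M *v vector [x, variable * x + to_ac \<mu>, 1] \<and>
     (variable * x + to_ac \<mu>)\<^sup>2 = x ^ 3 + const_fun a * x + const_fun b)"

lemma line_of_section_exists: "\<exists>L. line_of_section \<mu> L"
proof -
  obtain g h where gh: "h \<noteq> 0" "\<mu> * to_fract h = to_fract g" "\<And>d. d dvd g \<Longrightarrow> d dvd h \<Longrightarrow> is_unit d"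
    using reduced_fraction[of \<mu>] by metis
  obtain B where B: "line_matrix ** B = mat 1" using invertible_line_matrix unfolding invertible_def by blast
  have "map_mat (\<lambda>c. [:c:]) line_matrix *v (map_mat (\<lambda>c. [:c:]) B *v v) = v" for v :: "'k poly ^ 3"
    by (simp add: matrix_vector_mul_assoc B map_mat_one ring_morphism_const_poly flip: map_mat_mult[OF ring_morphism_const_poly])
  then show ?thesis unfolding line_of_section_def using gh by blast
qed

text \<open>In line coordinates t = u / (-v) is a quotient of two linear forms, so n = 1 works. A
  common divisor of the entries of \<open>L\<close> divides both \<open>h\<close> and
  \<open>g\<close>.\<close>

lemma rational_parameterization_line:
  assumes "line_of_section \<mu> L"
  shows "rational_parameterization L"
proof -
  note rc = ring_morphism_const_poly[where 'a = 'k]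
  obtain g h where gh: "h \<noteq> 0" "\<And>d. d dvd g \<and> d dvd h \<Longrightarrow> is_unit d"
    and L: "map_mat (\<lambda>c. [:c:]) line_matrix *v L = vector [- h, h * [:0, 1:], g]"
    using assms unfolding line_of_section_def by blast
  have "is_unit d" if "\<forall>i. d dvd L $ i" for d
  proof -
    have d: "d dvd vector [- h, h * [:0, 1:], g] $ i" for i :: 3
      unfolding L[symmetric] using that by (intro dvd_matrix_vector_mult) blast
    show ?thesis using d[of 1] d[of 3] by (intro gh(2)) simp
  qed
  moreover define A where "A = linear_substitution line_matrix (coords3 $ 2)"
  moreover define B where "B = - linear_substitution line_matrix (coords3 $ 1)"
  have "form 1 A" unfolding A_def by (intro form_linear_substitution form_coords3)
  moreover have "form 1 B"
    using form_const3_mult[OF form_linear_substitution[OF form_coords3[of 1]], of "- 1" line_matrix]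
    by (simp add: B_def ring_morphism_simps[OF ring_morphism_const3])
  moreover have "eval3 (\<lambda>x. [:x:]) A L = h * [:0, 1:]"
    unfolding A_def eval3_linear_substitution[OF rc] L by (simp add: eval3_coords3[OF rc] del: mult_pCons_right)
  moreover have "eval3 (\<lambda>x. [:x:]) B L = h"
    unfolding B_def ring_morphism_minus[OF ring_morphism_eval3[OF rc]] eval3_linear_substitution[OF rc] L
    by (simp add: eval3_coords3[OF rc])
  ultimately show ?thesis
    unfolding rational_parameterization_def using gh(1) by (metis mult.commute)
qed

text \<open>At v = -1, u = t, w = \<mu> the left side is the twisted discriminant 81 q^2 + 12 p^3 of
  X^3 + p X + q, and substituting p^3 = 27 m (m + q) completes the square.\<close>

lemma twisted_discriminant_square:
  assumes "dep_p \<mu> ^ 3 = 27 * m * (m + dep_q \<mu>)"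
  shows "- 3 * sextic (fraction_const a) (fraction_const b) (- 1) (to_fract [:0, 1:]) \<mu> = (18 * m + 9 * dep_q \<mu>)\<^sup>2"
proof -
  note n23 = nonzero_fraction_numerals[OF two three]
  define T where "T = to_fract [:0, 1 :: 'k:]"
  define p where "p = dep_p \<mu>"
  define q where "q = dep_q \<mu>"
  have t3: "3 * (T ^ 4 / 3) = T ^ 4" "27 * (T ^ 6 / 27) = T ^ 6" "3 * (T\<^sup>2 * p / 3) = T\<^sup>2 * p"
    using n23 numeral_powers_nonzero(3)[OF n23] by simp_all
  define x where "x = T ^ 4 / 3"
  define y where "y = T ^ 6 / 27"
  define z where "z = T\<^sup>2 * p / 3"
  have p: "p = fraction_const a - 2 * T * \<mu> - x" by (simp add: p_def dep_p_def T_def x_def)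
  have q: "q = - \<mu>\<^sup>2 + z + y + fraction_const b" by (simp add: q_def dep_q_def T_def y_def z_def p_def)
  have "3 * x = T ^ 4" "27 * y = T ^ 6" "3 * z = T\<^sup>2 * p" using t3 by (simp_all add: x_def y_def z_def)
  then have p': "3 * p = 3 * (fraction_const a - 2 * T * \<mu>) - T ^ 4"
    and q': "27 * q = - 27 * \<mu>\<^sup>2 + 9 * T\<^sup>2 * p + T ^ 6 + 27 * fraction_const b"
    unfolding p q by Groebner_Basis.algebra+
  have e1: "(18 * m + 9 * q)\<^sup>2 = 81 * q\<^sup>2 + 12 * p ^ 3"
    using assms unfolding p_def[symmetric] q_def[symmetric] by Groebner_Basis.algebra
  have e2: "27 * q = - 27 * \<mu>\<^sup>2 + 9 * T\<^sup>2 * (fraction_const a - 2 * T * \<mu>) - 2 * T ^ 6 + 27 * fraction_const b"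
    using q' p' by Groebner_Basis.algebra
  have "9 * (81 * q\<^sup>2 + 12 * p ^ 3) = (27 * q)\<^sup>2 + 4 * (3 * p) ^ 3" by Groebner_Basis.algebra
  also have "\<dots> = 9 * (- 3 * sextic (fraction_const a) (fraction_const b) (- 1) T \<mu>)"
    unfolding e2 p' sextic_def by Groebner_Basis.algebra
  finally have "81 * q\<^sup>2 + 12 * p ^ 3 = - 3 * sextic (fraction_const a) (fraction_const b) (- 1) T \<mu>"
    using numeral_powers_nonzero(1)[OF n23] mult_cancel_left by blast
  then show ?thesis using e1 by (simp add: q_def T_def)
qed

text \<open>Clearing the denominator of \<mu> multiplies the sextic by h^6, itself a square;
  \<open>s\<close> clears the denominator of the square root.\<close>

lemma even_intersection_line:
  assumes "is_section \<mu>" "line_of_section \<mu> L"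
  shows "even_intersection F L"
proof -
  note rf = ring_morphism_to_fract
  obtain m where m: "dep_p \<mu> ^ 3 = 27 * m * (m + dep_q \<mu>)" "18 * m + 9 * dep_q \<mu> \<noteq> 0"
    using assms(1) by (auto simp: is_section_def)
  obtain g h where gh: "h \<noteq> 0" "\<mu> * to_fract h = to_fract g"
    and L: "map_mat (\<lambda>c. [:c:]) line_matrix *v L = vector [- h, h * [:0, 1:], g]"
    using assms(2) unfolding line_of_section_def by blast
  define d where "d = 18 * m + 9 * dep_q \<mu>"
  obtain r s where rs: "to_fract h ^ 3 * d = to_fract r / to_fract s" "s \<noteq> 0"
    using Fract_cases[of "to_fract h ^ 3 * d"] by (auto simp: Fract_conv_to_fract)
  have s0: "to_fract s \<noteq> 0" using rs(2) by simp
  have r: "to_fract r = to_fract h ^ 3 * d * to_fract s" using rs s0 by simp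
  have "to_fract (- 3 * sextic [:a:] [:b:] (- h) (h * [:0, 1:]) g * s\<^sup>2) = to_fract (r\<^sup>2)"
  proof -
    have g: "to_fract g = to_fract h * \<mu>" using gh(2) by (simp add: mult.commute)
    have "to_fract (- 3 * sextic [:a:] [:b:] (- h) (h * [:0, 1:]) g * s\<^sup>2)
       = - 3 * sextic (fraction_const a) (fraction_const b) (to_fract h * - 1) (to_fract h * to_fract [:0, 1:]) (to_fract h * \<mu>) * (to_fract s)\<^sup>2"
      by (simp add: ring_morphism_simps[OF rf] ring_morphism_sextic[OF rf] fraction_const_def g
          del: mult_pCons_right to_fract_mult)
    also have "\<dots> = to_fract h ^ 6 * (- 3 * sextic (fraction_const a) (fraction_const b) (- 1) (to_fract [:0, 1:]) \<mu>) * (to_fract s)\<^sup>2"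
      unfolding sextic_scale by (simp add: mult_ac)
    also have "\<dots> = to_fract h ^ 6 * d\<^sup>2 * (to_fract s)\<^sup>2"
      unfolding twisted_discriminant_square[OF m(1)] d_def ..
    also have "\<dots> = (to_fract r)\<^sup>2" unfolding r by Groebner_Basis.algebra
    finally show ?thesis by (simp only: ring_morphism_simps[OF rf])
  qed
  then have "- 3 * sextic [:a:] [:b:] (- h) (h * [:0, 1:]) g * s\<^sup>2 = r\<^sup>2" by (simp only: to_fract_eq_iff)
  moreover have "to_fract r \<noteq> 0" using r gh(1) m(2) s0 by (simp add: d_def)
  then have "r \<noteq> 0" by auto
  ultimately show ?thesis by (rule even_intersectionI[OF L])
qed

lemma cardan_polynomial:
  "eval3 (\<lambda>c. [:to_fract [:c:]:]) F (\<chi> i. [:(map_mat fraction_const M *v vector [0, \<mu>, 1]) $ i,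
      (map_mat fraction_const M *v vector [1, to_fract [:0, 1:], 0]) $ i:])
   = [:fraction_const c * (\<mu>\<^sup>2 - fraction_const b), fraction_const c * (2 * to_fract [:0, 1:] * \<mu> - fraction_const a),
      fraction_const c * (to_fract [:0, 1:])\<^sup>2, - fraction_const c:]"
proof -
  define T where "T = to_fract [:0, 1 :: 'k:]"
  have rm: "ring_morphism (\<lambda>c. [:fraction_const c:])"
    by (rule ring_morphism_comp[OF ring_morphism_const_poly ring_morphism_fraction_const])
  define w :: "'k poly fract poly ^ 3" where "w = vector [[:0, 1:], [:\<mu>, T:], [:1:]]"
  have "(\<chi> i. [:(map_mat fraction_const M *v vector [0, \<mu>, 1]) $ i, (map_mat fraction_const M *v vector [1, T, 0]) $ i:])
     = map_mat (\<lambda>c. [:fraction_const c:]) M *v w"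
    by (simp add: vec_eq_iff matrix_vector_mult_def map_mat_def sum_3 w_def)
  then show ?thesis
    unfolding fraction_const_def[symmetric] T_def[symmetric]
    by (simp only: eval3_model[OF rm] eval3_weierstrass_form[OF rm])
       (simp add: w_def power2_eq_square power3_eq_cube algebra_simps)
qed

lemma section_points:
  assumes "is_section \<mu>"
  obtains P where "point_of_section \<mu> P" "\<exists>R s. s ^ 3 = to_ac R \<and> (\<forall>i. P $ i \<in> rational_fractions s)"
    "\<And>L. line_of_section \<mu> L \<Longrightarrow> gives_rise_to F L P"
proof -
  note n23 = nonzero_fraction_numerals[OF two three]
  note num = numeral_powers_nonzero[OF n23]
  define T where "T = to_fract [:0, 1 :: 'k:]"
  define C where "C = fraction_const c"
  define p where "p = dep_p \<mu>"
  define q where "q = dep_q \<mu>"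
  define \<alpha> where "\<alpha> = fraction_const a"
  define \<beta> where "\<beta> = fraction_const b"
  obtain m where m: "m \<noteq> 0" "p ^ 3 = 27 * m * (m + q)"
    using assms by (auto simp: is_section_def p_def q_def)
  have C0: "C \<noteq> 0" using c_nz by (simp add: C_def fraction_const_eq_0_iff)
  have p: "p = \<alpha> - 2 * T * \<mu> - T ^ 4 / 3" by (simp add: p_def dep_p_def T_def \<alpha>_def)
  have q: "q = - \<mu>\<^sup>2 + T\<^sup>2 * p / 3 + T ^ 6 / 27 + \<beta>" by (simp add: q_def dep_q_def T_def \<beta>_def p_def)
  obtain s where s: "s ^ 3 = to_ac m" using nth_root_exists[of 3 "to_ac m"] by auto
  have s0: "s \<noteq> 0" using s m(1) by auto
  define x where "x = s - to_ac (p / 3) / s + to_ac (T\<^sup>2 / 3)"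
  define A where "A = map_mat fraction_const M *v vector [1, T, 0]"
  define B where "B = map_mat fraction_const M *v vector [0, \<mu>, 1]"
  define P where "P = map_mat const_fun M *v vector [x, variable * x + to_ac \<mu>, 1]"
  define f where "f = eval3 (\<lambda>c. [:to_fract [:c:]:]) F (\<chi> i. [:B $ i, A $ i:])"
  have f: "f = [:C * (\<mu>\<^sup>2 - \<beta>), C * (2 * T * \<mu> - \<alpha>), C * T\<^sup>2, - C:]"
    unfolding f_def A_def B_def T_def C_def \<alpha>_def \<beta>_def by (rule cardan_polynomial)
  have P: "P $ i = x * to_ac (A $ i) + to_ac (B $ i)" for i
    by (simp add: P_def A_def B_def matrix_vector_mult_def map_mat_def sum_3 const_fun_fraction T_def algebra_simps)
  have card: "cardan_root f x"
  proof -
    \<comment> \<open>The leading coefficient of \<open>f\<close> is -C, so the twisted discriminant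
      carries C^4. With this sign of the square root, -q/2 + \<delta> / (18 C^2) is exactly
      \<open>m\<close>.\<close>
    define \<delta> where "\<delta> = C\<^sup>2 * (18 * m + 9 * q)"
    have cf: "coeff f 3 = - C" "coeff f 2 = C * T\<^sup>2" "coeff f 1 = C * (2 * T * \<mu> - \<alpha>)" "coeff f 0 = C * (\<mu>\<^sup>2 - \<beta>)"
      by (simp_all add: f eval_nat_numeral)
    have "degree f = 3" using C0 by (simp add: f)
    moreover have pe: "C * (2 * T * \<mu> - \<alpha>) / - C - (C * T\<^sup>2)\<^sup>2 / (3 * (- C)\<^sup>2) = p"
      using C0 n23 by (simp add: p power2_eq_square field_simps eval_nat_numeral)
    moreover have qe: "2 * (C * T\<^sup>2) ^ 3 / (27 * (- C) ^ 3) - C * T\<^sup>2 * (C * (2 * T * \<mu> - \<alpha>)) / (3 * (- C)\<^sup>2)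
        + C * (\<mu>\<^sup>2 - \<beta>) / - C = q"
    proof -
      have 1: "2 * (C * T\<^sup>2) ^ 3 / (27 * (- C) ^ 3) = - 2 * (T ^ 6 / 27)"
        using C0 num(3) by (simp add: power_mult_distrib flip: power_mult)
      have 2: "C * T\<^sup>2 * (C * (2 * T * \<mu> - \<alpha>)) / (3 * (- C)\<^sup>2) = T\<^sup>2 * (2 * T * \<mu> - \<alpha>) / 3"
        using C0 n23 by (simp add: power2_eq_square)
      have 3: "C * (\<mu>\<^sup>2 - \<beta>) / - C = - (\<mu>\<^sup>2 - \<beta>)" using C0 by simp
      have 4: "T\<^sup>2 * p / 3 = T\<^sup>2 * (\<alpha> - 2 * T * \<mu>) / 3 - 3 * (T ^ 6 / 27)"
      proof -
        have "T\<^sup>2 * (T ^ 4 / 3) / 3 = 3 * (T ^ 6 / 27)"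
          using n23 num(1,3) by (simp add: field_simps flip: power_add)
        then show ?thesis by (simp add: p ring_distribs diff_divide_distrib)
      qed
      show ?thesis unfolding 1 2 3 q 4 by (simp add: diff_divide_distrib ring_distribs algebra_simps)
    qed
    moreover have "\<delta>\<^sup>2 = twisted_discriminant f"
    proof -
      have "twisted_discriminant f = C ^ 4 * (- 3 * sextic \<alpha> \<beta> (- 1) T \<mu>)"
        unfolding twisted_discriminant_def Let_def cf sextic_def by Groebner_Basis.algebra
      also have "- 3 * sextic \<alpha> \<beta> (- 1) T \<mu> = (18 * m + 9 * q)\<^sup>2"
        using twisted_discriminant_square[of \<mu> m] m(2) unfolding \<alpha>_def \<beta>_def T_def p_def q_def by blast
      finally show ?thesis unfolding \<delta>_def by Groebner_Basis.algebra
    qed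
    moreover have "s ^ 3 = to_ac (- q / 2 + \<delta> / (18 * (- C)\<^sup>2))"
    proof -
      have "\<delta> / (18 * (- C)\<^sup>2) = (18 * m + 9 * q) / 18"
        using C0 by (simp add: \<delta>_def)
      also have "\<dots> = m + q / 2"
      proof -
        have "9 * q / 18 = 9 * q / (9 * 2)" by simp
        also have "\<dots> = q / 2" using num(1) by (subst mult_divide_mult_cancel_left) auto
        finally show ?thesis using num(2) by (simp add: add_divide_distrib)
      qed
      finally show ?thesis by (simp add: s)
    qed
    moreover have "x = s - to_ac (p / 3) / s - to_ac (C * T\<^sup>2 / (3 * - C))"
      using C0 by (simp add: x_def)
    ultimately show ?thesis
      unfolding cardan_root_def Let_def cf using s0 by (intro conjI exI[of _ \<delta>] exI[of _ s]) simp_all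
  qed
  have ts: "to_ac T = variable" by (simp add: T_def)
  have n3: "(3 :: 'k radical) \<noteq> 0" "(27 :: 'k radical) \<noteq> 0"
    using n23(2) num(3) to_ac_eq_0_iff[of "3 :: 'k poly fract"] to_ac_eq_0_iff[of "27 :: 'k poly fract"] by simp_all
  have "(variable * x + to_ac \<mu>)\<^sup>2 = x ^ 3 + const_fun a * x + const_fun b"
  proof -
    \<comment> \<open>Minus the second radical: u s = p / 3 and u^3 = m + q, so s - u is a root of
      the depressed cubic. Relations are kept multiplied by 3 and 27 to avoid fractions.\<close>
    define u where "u = to_ac (p / 3) / s"
    define t where "t = to_ac T"
    define y where "y = to_ac (T\<^sup>2 / 3)"
    define al where "al = to_ac \<alpha>"
    define be where "be = to_ac \<beta>"
    define mm where "mm = to_ac \<mu>"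
    have y3: "3 * y = t\<^sup>2" using n3 by (simp add: y_def t_def)
    have us: "3 * (u * s) = to_ac p" using n3 s0 by (simp add: u_def)
    have pp: "3 * to_ac p = 3 * (al - 2 * t * mm) - t ^ 4"
      using n3 by (simp add: p al_def t_def mm_def right_diff_distrib)
    have qq: "27 * to_ac q = - 27 * mm\<^sup>2 + 9 * t\<^sup>2 * to_ac p + t ^ 6 + 27 * be"
    proof -
      define v w where "v = to_ac (T\<^sup>2 * p / 3)" and "w = to_ac (T ^ 6 / 27)"
      have "3 * v = t\<^sup>2 * to_ac p" "27 * w = t ^ 6" using n3 by (simp_all add: v_def w_def t_def)
      moreover have "to_ac q = - mm\<^sup>2 + v + w + be"
        unfolding q v_def w_def mm_def be_def by (simp only: to_ac_add to_ac_minus to_ac_power)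
      ultimately show ?thesis by Groebner_Basis.algebra
    qed
    have mq: "to_ac p ^ 3 = 27 * s ^ 3 * (s ^ 3 + to_ac q)"
      using arg_cong[OF m(2), of to_ac] by (simp add: s)
    have "27 * s ^ 3 * (u ^ 3) = 27 * s ^ 3 * (s ^ 3 + to_ac q)"
      unfolding mq[symmetric] us[symmetric] by Groebner_Basis.algebra
    then have u3: "u ^ 3 = s ^ 3 + to_ac q" using n3 s0 by simp
    define Y where "Y = s - u"
    have "Y ^ 3 + to_ac p * Y + to_ac q = 0"
      using u3 unfolding Y_def us[symmetric] by Groebner_Basis.algebra
    moreover have xY: "x = Y + y" by (simp add: x_def Y_def u_def y_def)
    ultimately have "27 * (x ^ 3 - t\<^sup>2 * x\<^sup>2 + (al - 2 * t * mm) * x + be - mm\<^sup>2) = 0"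
      using y3 pp qq by Groebner_Basis.algebra
    then have "x ^ 3 - t\<^sup>2 * x\<^sup>2 + (al - 2 * t * mm) * x + be - mm\<^sup>2 = 0"
      using n3(2) mult_eq_0_iff by blast
    then have "(t * x + mm)\<^sup>2 = x ^ 3 + al * x + be" by Groebner_Basis.algebra
    then show ?thesis
      by (simp add: t_def ts mm_def al_def be_def const_fun_fraction \<alpha>_def \<beta>_def)
  qed
  then have pt: "point_of_section \<mu> P" unfolding point_of_section_def P_def by blast
  have rat: "P $ i \<in> rational_fractions s" for i
  proof -
    \<comment> \<open>s times the i-th coordinate of the point, as a quadratic polynomial in
      \<open>s\<close> over k(t).\<close>
    define nn where "nn = [:- (A $ i * (p / 3)), A $ i * (T\<^sup>2 / 3) + B $ i, A $ i:]"
    have "poly (map_poly to_ac nn) s / poly (map_poly to_ac [:0, 1:]) s = P $ i"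
      using s0 by (simp add: P x_def nn_def map_poly_pCons field_simps)
    moreover have "poly (map_poly to_ac [:0, 1:]) s \<noteq> 0" using s0 by (simp add: map_poly_pCons)
    ultimately show ?thesis
      unfolding rational_fractions_def mem_Collect_eq
      by (intro exI[of _ nn] exI[of _ "[:0, 1:] :: 'k poly fract poly"]) simp
  qed
  have gr: "gives_rise_to F L P" if L: "line_of_section \<mu> L" for L
  proof -
    note rf = ring_morphism_to_fract
    obtain g h where gh: "h \<noteq> 0" "\<mu> * to_fract h = to_fract g"
      and Le: "map_mat (\<lambda>c. [:c:]) line_matrix *v L = vector [- h, h * [:0, 1:], g]"
      using L unfolding line_of_section_def by blast
    define L' where "L' = (\<chi> i. to_fract (L $ i))"
    let ?Mf = "map_mat fraction_const M"
    have "map_mat to_fract (map_mat (\<lambda>c. [:c:]) line_matrix) *v L' = (\<chi> i. to_fract (vector [- h, h * [:0, 1:], g] $ i))"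
      unfolding L'_def map_mat_vector_mult[OF rf] Le ..
    moreover have "map_mat to_fract (map_mat (\<lambda>c. [:c:]) line_matrix) = swap12 ** transpose ?Mf"
      unfolding map_mat_comp fraction_const_def[symmetric] line_matrix_def
      by (simp only: map_mat_mult[OF ring_morphism_fraction_const] map_mat_swap12[OF ring_morphism_fraction_const] map_mat_transpose)
    ultimately have "swap12 *v (transpose ?Mf *v L') = (\<chi> i. to_fract (vector [- h, h * [:0, 1:], g] $ i))"
      by (simp only: matrix_vector_mul_assoc)
    then have "swap12 *v (swap12 *v (transpose ?Mf *v L')) = vector [to_fract h * T, - to_fract h, to_fract g]"
      unfolding swap12_vector[of "\<chi> i. to_fract (vector [- h, h * [:0, 1:], g] $ i)", symmetric] T_def
      by (simp add: swap12_vector ring_morphism_simps[OF rf] del: mult_pCons_right)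
    then have MtL: "transpose ?Mf *v L' = vector [to_fract h * T, - to_fract h, to_fract g]"
      by (simp only: matrix_vector_mul_assoc swap12_swap12 matrix_vector_mul_lid matrix_mul_assoc matrix_mul_lid)
    have sA: "scalar_product L' A = 0"
      unfolding A_def scalar_product_transpose[symmetric] MtL by (simp add: scalar_product_3)
    have sB: "scalar_product L' B = 0"
      unfolding B_def scalar_product_transpose[symmetric] MtL using gh(2) by (simp add: scalar_product_3 mult.commute)
    have ind: "k = 0 \<and> n = 0" if "k *s A + n *s B = 0" for k n
    proof -
      have "?Mf *v (k *s vector [1, T, 0] + n *s vector [0, \<mu>, 1]) = k *s A + n *s B"
        unfolding A_def B_def by (simp only: matrix_vector_right_distrib matrix_vector_mult_smult)
      then have "k *s vector [1, T, 0] + n *s vector [0, \<mu>, 1] = (0 :: 'k poly fract ^ 3)"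
        using that invertible_mult_eq_0_iff[OF invertible_map_mat[OF ring_morphism_fraction_const inv_M]] by metis
      then have "(k *s vector [1, T, 0] + n *s vector [0, \<mu>, 1] :: 'k poly fract ^ 3) $ i = 0" for i by simp
      from this[of 1] this[of 3] show ?thesis by simp
    qed
    show ?thesis
      unfolding gives_rise_to_def L'_def[symmetric]
      by (rule exI[of _ A], rule exI[of _ B], rule exI[of _ x], rule exI[of _ 1])
         (use sA sB ind card P in \<open>simp add: f_def\<close>)
  qed
  show ?thesis using that[OF pt _ gr] rat s by blast
qed

end

section \<open>Nonconstancy, inequivalence and distinctness\<close>

lemma algebraic_const_matrix_vector:
  fixes M :: "'k::field ^ 3 ^ 3"
  assumes "\<And>i. algebraic_const (v $ i)"
  shows "algebraic_const ((map_mat const_fun M *v v) $ i)"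
  unfolding matrix_vector_mult_def map_mat_def
  by (simp add: sum_3) (intro algebraic_const_field assms)

lemma const_fun_eq_iff: "const_fun c = const_fun d \<longleftrightarrow> c = d"
  by (simp add: const_fun_def)

text \<open>k(t) is generated by \<open>k\<close> and t, so its image stays in k(t) whatever happens
  to the radicals, and the substitution is the identity there when t is sent to itself.\<close>

lemma substitution_range:
  fixes \<sigma> :: "'k::field radical \<Rightarrow> 'k radical"
  assumes "substitution \<phi> \<sigma>"
  obtains \<nu> where "\<sigma> (to_ac \<mu>) = to_ac \<nu>" "to_ac \<phi> = variable \<Longrightarrow> \<nu> = \<mu>"
proof -
  have a: "\<sigma> (x + y) = \<sigma> x + \<sigma> y" and m: "\<sigma> (x * y) = \<sigma> x * \<sigma> y" and c: "\<sigma> (const_fun d) = const_fun d"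
    and v: "\<sigma> variable = to_ac \<phi>" for x y d
    using assms by (auto simp: substitution_def)
  have o: "\<sigma> 1 = 1" using c[of 1] by (simp add: ring_morphism_1[OF ring_morphism_const_fun])
  have rs: "ring_morphism \<sigma>" by (rule ring_morphismI[OF o a m])
  have "\<exists>\<nu>. \<sigma> (to_ac (to_fract p)) = to_ac \<nu> \<and> (to_ac \<phi> = variable \<longrightarrow> \<nu> = to_fract p)" for p
  proof (induction p)
    case 0
    then show ?case by (intro exI[of _ 0]) (simp add: ring_morphism_0[OF rs])
  next
    case (pCons d p)
    then obtain \<nu> where \<nu>: "\<sigma> (to_ac (to_fract p)) = to_ac \<nu>" "to_ac \<phi> = variable \<longrightarrow> \<nu> = to_fract p" by blast
    have "pCons d p = [:d:] + [:0, 1:] * p" by simp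
    then have e: "to_fract (pCons d p) = fraction_const d + to_fract [:0, 1:] * to_fract p"
      unfolding fraction_const_def by (metis to_fract_add to_fract_mult)
    have "\<sigma> (to_ac (to_fract (pCons d p))) = const_fun d + to_ac \<phi> * to_ac \<nu>"
      unfolding e to_ac_add to_ac_mult const_fun_fraction[symmetric] a m c v \<nu>(1) ..
    also have "\<dots> = to_ac (fraction_const d + \<phi> * \<nu>)" by (simp add: const_fun_fraction)
    finally show ?case using \<nu>(2) e by (intro exI[of _ "fraction_const d + \<phi> * \<nu>"]) auto
  qed
  then obtain f where f: "\<And>p. \<sigma> (to_ac (to_fract p)) = to_ac (f p)" "\<And>p. to_ac \<phi> = variable \<Longrightarrow> f p = to_fract p"
    by metis
  obtain g h where gh: "\<mu> = to_fract g / to_fract h" "h \<noteq> 0"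
    using Fract_cases[of \<mu>] by (auto simp: Fract_conv_to_fract)
  have h0: "to_fract h \<noteq> 0" using gh(2) by simp
  have "\<sigma> (to_ac (to_fract h)) * \<sigma> (to_ac (inverse (to_fract h))) = 1"
    unfolding m[symmetric] to_ac_mult[symmetric] using h0 o by simp
  then have fh: "f h \<noteq> 0" unfolding f by auto
  have "\<mu> * to_fract h = to_fract g" using gh(1) h0 by simp
  then have "\<sigma> (to_ac \<mu>) * to_ac (f h) = to_ac (f g)"
    unfolding f(1)[symmetric] m[symmetric] to_ac_mult[symmetric] by simp
  then have "\<sigma> (to_ac \<mu>) = to_ac (f g / f h)" using fh by (simp add: field_simps)
  moreover have "f g / f h = \<mu>" if "to_ac \<phi> = variable" using f(2)[OF that] gh(1) by simp
  ultimately show ?thesis by (rule that)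
qed

context weierstrass_cubic
begin

text \<open>A section of this kind is a family of lines through a fixed point of the cubic.  The
  discriminant of the remaining quadratic is then a quartic in \<open>t\<close> with four distinct roots.\<close>

lemma pencil_not_section:
  assumes "is_section (fraction_const y0 - to_fract [:0, 1:] * fraction_const x0)"
    and curve: "y0\<^sup>2 = x0 ^ 3 + a * x0 + b"
  shows False
proof -
  note rf = ring_morphism_to_fract and rfc = ring_morphism_fraction_const
  define T where "T = to_fract [:0, 1 :: 'k:]"
  define \<mu> where "\<mu> = fraction_const y0 - T * fraction_const x0"
  obtain m where m: "dep_p \<mu> ^ 3 = 27 * m * (m + dep_q \<mu>)" "18 * m + 9 * dep_q \<mu> \<noteq> 0"
    using assms(1) by (auto simp: is_section_def \<mu>_def T_def)
  define d where "d = 18 * m + 9 * dep_q \<mu>"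
  \<comment> \<open>The fixed abscissa x0 is a root of the cubic in x. \<open>D\<close> is the
    discriminant of the residual quadratic and \<open>E\<close> its value at x0, so the full
    discriminant is D E^2.\<close>
  define D where "D = [:- 3 * x0\<^sup>2 - 4 * a, 8 * y0, - 6 * x0, 0, 1:]"
  define E where "E = [:3 * x0\<^sup>2 + a, - 2 * y0:]"
  have D: "to_fract D = T ^ 4 - 6 * fraction_const x0 * T\<^sup>2 + 8 * fraction_const y0 * T
     - 3 * (fraction_const x0)\<^sup>2 - 4 * fraction_const a"
  proof -
    have "D = [:0, 1:] ^ 4 - 6 * [:x0:] * [:0, 1:]\<^sup>2 + 8 * [:y0:] * [:0, 1:] - 3 * [:x0:]\<^sup>2 - 4 * [:a:]"
      by (simp add: D_def power2_eq_square eval_nat_numeral numeral_poly)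
    then show ?thesis by (simp only: ring_morphism_simps[OF rf] T_def fraction_const_def)
  qed
  have E: "to_fract E = 3 * (fraction_const x0)\<^sup>2 + fraction_const a - 2 * T * fraction_const y0"
  proof -
    have "E = 3 * [:x0:]\<^sup>2 + [:a:] - 2 * [:0, 1:] * [:y0:]"
      by (simp add: E_def power2_eq_square numeral_poly)
    then show ?thesis by (simp only: ring_morphism_simps[OF rf] T_def fraction_const_def)
  qed
  have cf: "fraction_const b = (fraction_const y0)\<^sup>2 - (fraction_const x0) ^ 3 - fraction_const a * fraction_const x0"
    using arg_cong[OF curve, of fraction_const] by (simp add: ring_morphism_simps[OF rfc])
  have "d\<^sup>2 = - 3 * sextic (fraction_const a) (fraction_const b) (- 1) T \<mu>"
    unfolding d_def T_def by (rule twisted_discriminant_square[OF m(1), symmetric])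
  then have dD: "d\<^sup>2 = - 3 * to_fract D * (to_fract E)\<^sup>2"
    unfolding D E \<mu>_def cf sextic_def by Groebner_Basis.algebra
  obtain g h where gh: "d = to_fract g / to_fract h" "h \<noteq> 0"
    using Fract_cases[of d] by (auto simp: Fract_conv_to_fract)
  have g0: "g \<noteq> 0" using m(2) gh by (auto simp: d_def)
  have "to_fract h \<noteq> 0" using gh(2) by simp
  then have "(to_fract g)\<^sup>2 = (to_fract h)\<^sup>2 * d\<^sup>2" using gh(1) by (simp add: power_divide)
  then have "to_fract (g\<^sup>2) = to_fract (- 3 * D * (E * h)\<^sup>2)"
    unfolding dD ring_morphism_simps[OF rf] by Groebner_Basis.algebra
  then have gD: "g\<^sup>2 = - 3 * D * (E * h)\<^sup>2" by (simp only: to_fract_eq_iff)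
  define H where "H = (map_poly to_ac :: 'k poly \<Rightarrow> 'k alg_closure poly)"
  have rH: "ring_morphism H" unfolding H_def by (rule ring_morphism_map_poly[OF ring_morphism_to_ac])
  have H0: "H p \<noteq> 0" if "p \<noteq> 0" for p using that by (auto simp: H_def poly_eq_iff coeff_map_poly)
  have gH: "(H g)\<^sup>2 = (- 3 * H D) * (H (E * h))\<^sup>2"
    using arg_cong[OF gD, of H] by (simp only: ring_morphism_simps[OF rH])
  have n: "H g \<noteq> 0" by (rule H0[OF g0])
  have D0: "- 3 * H D \<noteq> 0" and Eh0: "H (E * h) \<noteq> 0" using gH n by auto
  have "even (Polynomial.order t (- 3 * H D))" for t
  proof -
    have "2 * Polynomial.order t (H g) = Polynomial.order t (- 3 * H D) + 2 * Polynomial.order t (H (E * h))"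
      using arg_cong[OF gH, of "Polynomial.order t"] n D0 Eh0 by (simp add: power2_eq_square order_mult)
    then show ?thesis by (metis even_add even_mult_iff even_numeral)
  qed
  then obtain u where u: "- 3 * H D = u\<^sup>2" using even_order_imp_square[OF D0] by blast
  have n23: "(2 :: 'k alg_closure) \<noteq> 0" "(3 :: 'k alg_closure) \<noteq> 0" using nonzero_consts by auto
  define Xa where "Xa = to_ac x0"
  define Y where "Y = to_ac y0"
  define A where "A = to_ac a"
  have HD: "- 3 * H D = [:- 3 * (- 3 * Xa\<^sup>2 - 4 * A), - 3 * (8 * Y), - 3 * (- 6 * Xa), 0, - 3:]"
    by (simp add: H_def D_def map_poly_pCons Xa_def Y_def A_def numeral_poly)
  have "degree (- 3 * H D) = 4" unfolding HD using n23 by simp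
  then have du: "degree u = 2" unfolding u using D0 u by (cases "u = 0") (auto simp: degree_power_eq)
  define u0 where "u0 = coeff u 0"
  define u1 where "u1 = coeff u 1"
  define u2 where "u2 = coeff u 2"
  have "u = [:u0, u1, u2:]"
  proof (rule poly_eqI)
    fix i
    show "coeff u i = coeff [:u0, u1, u2:] i"
      using du by (cases "i > 2") (auto simp: coeff_eq_0 u0_def u1_def u2_def numeral_2_eq_2 coeff_pCons split: nat.split)
  qed
  \<comment> \<open>The missing t^3 term forces u1 = 0, whence y0 = 0 and then 3 x0^2 + a = 0: the
    fixed point would be singular on the cubic.\<close>
  then have "[:- 3 * (- 3 * Xa\<^sup>2 - 4 * A), - 3 * (8 * Y), - 3 * (- 6 * Xa), 0, - 3:] = [:u0, u1, u2:]\<^sup>2"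
    using u HD by simp
  then have c: "- 3 * (- 3 * Xa\<^sup>2 - 4 * A) = u0\<^sup>2" "- 3 * (8 * Y) = 2 * u0 * u1"
    "- 3 * (- 6 * Xa) = u1\<^sup>2 + 2 * u0 * u2" "0 = 2 * u1 * u2" "- 3 = u2\<^sup>2"
    by (simp_all add: power2_eq_square algebra_simps)
  have "u2 \<noteq> 0" using c(5) n23 by auto
  then have u1: "u1 = 0" using c(4) n23 by simp
  have "24 * Y = 0" using c(2) u1 by simp
  moreover have "(24 :: 'k alg_closure) = 2 * 2 * 2 * 3" by simp
  ultimately have Y0: "Y = 0" using n23 by (metis mult_eq_0_iff)
  have "2 * (u0 * u2 - 9 * Xa) = 0" using c(3) u1 by (simp add: algebra_simps)
  then have "u0 * u2 - 9 * Xa = 0" using n23(1) mult_eq_0_iff by blast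
  then have "u0 * u2 = 9 * Xa" by simp
  then have "u0\<^sup>2 * u2\<^sup>2 = 81 * Xa\<^sup>2" by Groebner_Basis.algebra
  then have "36 * (3 * Xa\<^sup>2 + A) = 0" unfolding c(1)[symmetric] c(5)[symmetric] by Groebner_Basis.algebra
  moreover have "(36 :: 'k alg_closure) = 2 * 2 * 3 * 3" by simp
  ultimately have "3 * Xa\<^sup>2 + A = 0" using n23 by (metis mult_eq_0_iff)
  then have "to_ac (3 * x0\<^sup>2 + a) = 0" by (simp add: Xa_def A_def)
  then have x: "3 * x0\<^sup>2 + a = 0" by (simp only: to_ac_eq_0_iff)
  have "y0 = 0" using Y0 by (simp add: Y_def)
  then show False using no_common_root[OF disc_nz, of x0] curve x by simp
qed

lemma nonconstant_point_of_section:
  assumes sec: "is_section \<mu>" and P: "point_of_section \<mu> P"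
  shows "nonconstant_point P"
proof -
  note rc = ring_morphism_const_fun[where 'a = 'k]
  obtain x where x: "P = map_mat const_fun M *v vector [x, variable * x + to_ac \<mu>, 1]"
    "(variable * x + to_ac \<mu>)\<^sup>2 = x ^ 3 + const_fun a * x + const_fun b"
    using P by (auto simp: point_of_section_def)
  define y where "y = variable * x + to_ac \<mu>"
  obtain B where B: "B ** M = mat 1" using inv_M unfolding invertible_def by blast
  have BM: "map_mat const_fun B *v (map_mat const_fun M *v v) = v" for v
    by (simp add: matrix_vector_mul_assoc B map_mat_one[OF rc] flip: map_mat_mult[OF rc])
  have "P \<noteq> 0"
  proof
    assume "P = 0"
    then have "vector [x, y, 1] = (0 :: 'k radical ^ 3)" using BM[of "vector [x, y, 1]"] x(1) y_def by simp
    then have "(vector [x, y, 1] :: 'k radical ^ 3) $ 3 = 0" by simp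
    then show False by simp
  qed
  moreover have False if l: "l \<noteq> 0" "\<forall>i. algebraic_const (l * P $ i)" for l
  proof -
    have lv: "map_mat const_fun B *v (l *s P) = l *s vector [x, y, 1]"
      unfolding matrix_vector_mult_smult x(1) y_def[symmetric] BM ..
    have al: "algebraic_const ((l *s vector [x, y, 1] :: 'k radical ^ 3) $ i)" for i
      unfolding lv[symmetric] by (rule algebraic_const_matrix_vector) (use l(2) in simp)
    have "algebraic_const l" using al[of 3] by simp
    then have il: "algebraic_const (inverse l)" by (rule algebraic_const_field(3))
    have "algebraic_const (inverse l * (l * x))" "algebraic_const (inverse l * (l * y))"
      using algebraic_const_field(2)[OF il al[of 1]] algebraic_const_field(2)[OF il al[of 2]] by simp_all
    then have "algebraic_const x" "algebraic_const y" using l(1) by (simp_all add: mult.assoc[symmetric])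
    moreover have "to_ac \<mu> = y - variable * x" by (simp add: y_def)
    ultimately obtain x0 y0 where xy: "x = const_fun x0" "y = const_fun y0"
      by (rule algebraic_const_linear)
    have "to_ac \<mu> = to_ac (fraction_const y0 - to_fract [:0, 1:] * fraction_const x0)"
      unfolding to_ac_diff to_ac_mult const_fun_fraction[symmetric] xy[symmetric] by (simp add: y_def)
    then have "\<mu> = fraction_const y0 - to_fract [:0, 1:] * fraction_const x0" by (simp only: to_ac_eq_iff)
    moreover have "y\<^sup>2 = x ^ 3 + const_fun a * x + const_fun b"
      using x(2) by (simp only: y_def)
    then have "const_fun (y0\<^sup>2) = const_fun (x0 ^ 3 + a * x0 + b)"
      unfolding xy ring_morphism_simps[OF rc] .
    then have "y0\<^sup>2 = x0 ^ 3 + a * x0 + b" by (simp only: const_fun_eq_iff)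
    ultimately show False using pencil_not_section sec by blast
  qed
  ultimately show ?thesis unfolding nonconstant_point_def by blast
qed

lemma pseudo_parameterization_of_section:
  assumes "is_section \<mu>" "point_of_section \<mu> P" "\<exists>R s. s ^ 3 = to_ac R \<and> (\<forall>i. P $ i \<in> rational_fractions s)"
  shows "pseudo_parameterization F P"
proof -
  note rc = ring_morphism_const_fun[where 'a = 'k]
  obtain x where x: "P = map_mat const_fun M *v vector [x, variable * x + to_ac \<mu>, 1]"
    "(variable * x + to_ac \<mu>)\<^sup>2 = x ^ 3 + const_fun a * x + const_fun b"
    using assms(2) by (auto simp: point_of_section_def)
  have "eval3 const_fun F P = 0"
    unfolding x(1) eval3_model[OF rc] eval3_weierstrass_form[OF rc] using x(2) by simp
  then show ?thesis
    unfolding pseudo_parameterization_def using assms nonconstant_point_of_section by blast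
qed

text \<open>If two points are equivalent, the point lies on both lines.  Distinct lines would make it
  rational over \<open>k(t)\<close>, hence constant; and equal lines have the same slope, which is \<open>t\<close>.\<close>

lemma equivalent_sections_eq:
  assumes sec: "is_section \<mu>'" and P: "point_of_section \<mu> P" and P': "point_of_section \<mu>' P'"
    and eq: "equivalent_pseudo P P'"
  shows "\<mu> = \<mu>'"
proof -
  note rc = ring_morphism_const_fun[where 'a = 'k]
  obtain x where x: "P = map_mat const_fun M *v vector [x, variable * x + to_ac \<mu>, 1]"
    using P by (auto simp: point_of_section_def)
  obtain x' where x': "P' = map_mat const_fun M *v vector [x', variable * x' + to_ac \<mu>', 1]"
    "(variable * x' + to_ac \<mu>')\<^sup>2 = x' ^ 3 + const_fun a * x' + const_fun b"
    using P' by (auto simp: point_of_section_def)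
  define y where "y = variable * x + to_ac \<mu>"
  define y' where "y' = variable * x' + to_ac \<mu>'"
  obtain \<phi> \<sigma> l where s: "substitution \<phi> \<sigma>" "l \<noteq> 0" "\<And>i. P' $ i = l * \<sigma> (P $ i)"
    using eq by (auto simp: equivalent_pseudo_def)
  have sa: "\<sigma> (u + v) = \<sigma> u + \<sigma> v" and sm: "\<sigma> (u * v) = \<sigma> u * \<sigma> v" and sc: "\<sigma> (const_fun d) = const_fun d"
    and sv: "\<sigma> variable = to_ac \<phi>" for u v d
    using s(1) by (auto simp: substitution_def)
  have s1: "\<sigma> 1 = 1" using sc[of 1] by (simp add: ring_morphism_1[OF rc])
  obtain B where B: "B ** M = mat 1" using inv_M unfolding invertible_def by blast
  have BM: "map_mat const_fun B *v (map_mat const_fun M *v v) = v" for v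
    by (simp add: matrix_vector_mul_assoc B map_mat_one[OF rc] flip: map_mat_mult[OF rc])
  have "P' = map_mat const_fun M *v (l *s vector [\<sigma> x, \<sigma> y, 1])"
    unfolding vec_eq_iff s(3) x y_def[symmetric]
    by (simp add: matrix_vector_mult_def map_mat_def sum_3 sa sm sc s1 algebra_simps)
  then have "map_mat const_fun B *v P' = l *s vector [\<sigma> x, \<sigma> y, 1]"
    by (simp only: BM)
  then have e: "vector [x', y', 1] = (l *s vector [\<sigma> x, \<sigma> y, 1] :: 'k radical ^ 3)"
    unfolding x'(1) y'_def[symmetric] BM .
  then have e': "(vector [x', y', 1] :: 'k radical ^ 3) $ i = (l *s vector [\<sigma> x, \<sigma> y, 1]) $ i" for i by (simp only: e)
  have l1: "l = 1" using e'[of 3] by simp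
  have xs: "x' = \<sigma> x" "y' = \<sigma> y" using e'[of 1] e'[of 2] l1 by simp_all
  obtain \<nu> where \<nu>: "\<sigma> (to_ac \<mu>) = to_ac \<nu>" "to_ac \<phi> = variable \<Longrightarrow> \<nu> = \<mu>"
    using substitution_range[OF s(1)] by metis
  have y'2: "y' = to_ac \<phi> * x' + to_ac \<nu>"
    unfolding xs y_def sa sm sv \<nu>(1) ..
  show ?thesis
  proof (cases "to_ac \<phi> = variable")
    case True
    then have "to_ac \<mu> = to_ac \<mu>'" using y'2 \<nu>(2) unfolding y'_def by simp
    then show ?thesis by (simp only: to_ac_eq_iff)
  next
    case False
    define T where "T = to_fract [:0, 1 :: 'k:]"
    \<comment> \<open>The abscissa where the line of slope t through the second point meets the
      transformed line, of slope \<phi>; both have coefficients in k(t).\<close>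
    define \<xi> where "\<xi> = (\<mu>' - \<nu>) / (\<phi> - T)"
    define \<eta> where "\<eta> = T * \<xi> + \<mu>'"
    have "\<phi> \<noteq> T" using False by (auto simp: T_def)
    then have "to_ac \<phi> - to_ac T \<noteq> 0" by simp
    moreover have "x' * (to_ac \<phi> - to_ac T) = to_ac \<mu>' - to_ac \<nu>"
      using y'2 unfolding y'_def T_def by (simp add: algebra_simps)
    ultimately have xx: "x' = to_ac \<xi>" unfolding \<xi>_def to_ac_divide to_ac_diff by (metis nonzero_mult_div_cancel_right)
    then have yy: "y' = to_ac \<eta>" unfolding y'_def \<eta>_def T_def by simp
    have "y'\<^sup>2 = x' ^ 3 + const_fun a * x' + const_fun b"
      using x'(2) by (simp only: y'_def)
    then have "to_ac (\<eta>\<^sup>2) = to_ac (\<xi> ^ 3 + fraction_const a * \<xi> + fraction_const b)"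
      unfolding xx yy const_fun_fraction to_ac_power to_ac_add to_ac_mult .
    then have "\<eta>\<^sup>2 = \<xi> ^ 3 + fraction_const a * \<xi> + fraction_const b" by (simp only: to_ac_eq_iff)
    then obtain x0 y0 where "\<xi> = fraction_const x0" "\<eta> = fraction_const y0"
      by (rule elliptic_point_constant[OF two disc_nz])
    then have c: "x' = const_fun x0" "y' = const_fun y0" by (simp_all add: xx yy const_fun_fraction)
    have "algebraic_const ((vector [x', y', 1] :: 'k radical ^ 3) $ i)" for i
    proof -
      have "algebraic_const (1 :: 'k radical)"
        using algebraic_const_field(4)[of "1 :: 'k"] by (simp only: ring_morphism_1[OF rc])
      then show ?thesis
        using exhaust_3[of i] algebraic_const_field(4) by (auto simp: c)
    qed
    then have "algebraic_const (1 * P' $ i)" for i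
      unfolding x'(1) y'_def[symmetric] mult_1 by (rule algebraic_const_matrix_vector)
    then show ?thesis
      using nonconstant_point_of_section[OF sec P'] unfolding nonconstant_point_def by (metis one_neq_zero)
  qed
qed

text \<open>With z = -v, the curve of \<open>L'\<close> satisfies w / z = \<mu>'(u / z).
  \<open>G\<close> is this relation cleared of denominators and made homogeneous. If the curve of
  \<open>L\<close> satisfies it too, g h' and h g' agree at infinitely many parameters.\<close>

lemma parameterized_curve_eq_imp:
  assumes L: "line_of_section \<mu> L" and L': "line_of_section \<mu>' L'"
    and eq: "parameterized_curve L = parameterized_curve L'"
  shows "\<mu> = \<mu>'"
proof -
  define H where "H = (map_poly to_ac :: 'k poly \<Rightarrow> 'k alg_closure poly)"
  have rH: "ring_morphism H" unfolding H_def by (rule ring_morphism_map_poly[OF ring_morphism_to_ac])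
  have Hc: "H [:x:] = [:to_ac x:]" for x unfolding H_def by (rule map_poly_const[OF ring_morphism_to_ac])
  have HX: "H [:0, 1:] = [:0, 1:]" by (simp add: H_def map_poly_pCons)
  have H0: "H p \<noteq> 0" if "p \<noteq> 0" for p using that by (auto simp: H_def poly_eq_iff coeff_map_poly)
  note ri = ring_morphism_id(1)[where 'a = "'k alg_closure"]
  define pt where "pt L t = (\<chi> i. poly (geometric_param L $ i) t)" for L :: "'k poly ^ 3" and t
  have pt: "N' *v pt L t = vector [- poly (H h) t, poly (H h) t * t, poly (H g) t]"
    if "map_mat (\<lambda>c. [:c:]) line_matrix *v L = vector [- h, h * [:0, 1:], g]" for L g h t
  proof -
    define k where "k p = poly (H p) t" for p
    have rk: "ring_morphism k" unfolding k_def by (rule ring_morphism_comp[OF ring_morphism_poly rH])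
    have "pt L t = (\<chi> i. k (L $ i))" by (simp add: pt_def geometric_param_def k_def H_def)
    moreover have "N' = map_mat k (map_mat (\<lambda>c. [:c:]) line_matrix)"
      by (simp add: map_mat_comp k_def Hc)
    ultimately have "N' *v pt L t = (\<chi> i. k (vector [- h, h * [:0, 1:], g] $ i))"
      by (simp only: map_mat_vector_mult[OF rk] that)
    also have "\<dots> = vector [- k h, k h * k [:0, 1:], k g]"
      by (simp add: vec_eq_iff forall_3 ring_morphism_simps[OF rk] del: mult_pCons_right)
    finally show ?thesis by (simp add: k_def HX)
  qed
  obtain g h where gh: "h \<noteq> 0" "\<mu> * to_fract h = to_fract g"
    "map_mat (\<lambda>c. [:c:]) line_matrix *v L = vector [- h, h * [:0, 1:], g]"
    using L unfolding line_of_section_def by blast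
  obtain g' h' where gh': "h' \<noteq> 0" "\<mu>' * to_fract h' = to_fract g'"
    "map_mat (\<lambda>c. [:c:]) line_matrix *v L' = vector [- h', h' * [:0, 1:], g']"
    using L' unfolding line_of_section_def by blast
  define n where "n = max (degree (H g')) (degree (H h'))"
  define G where "G = coords3 $ 3 * homogenized n (H h') - (- (coords3 $ 1)) * homogenized n (H g')"
  define G' where "G' = linear_substitution N' G"
  have evG: "eval3 id G (vector [- z, z * t, w]) = z ^ n * (w * poly (H h') t - z * poly (H g') t)" for z t w
  proof -
    have "eval3 id (homogenized n (H h')) (vector [- z, z * t, w]) = z ^ n * poly (H h') t"
      "eval3 id (homogenized n (H g')) (vector [- z, z * t, w]) = z ^ n * poly (H g') t"
      by (rule eval3_homogenized; simp add: n_def)+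
    then show ?thesis
      unfolding G_def eval3_simps[OF ri] eval3_coords3[OF ri] by (simp add: algebra_simps)
  qed
  have "form (1 + n) G"
  proof -
    have "form (1 + n) (coords3 $ 3 * homogenized n (H h') + coords3 $ 1 * homogenized n (H g'))"
      by (intro form_add form_mult form_coords3 form_homogenized)
    then show ?thesis by (simp add: G_def)
  qed
  then have fG: "form (1 + n) G'" unfolding G'_def by (rule form_linear_substitution)
  have evG': "eval3 id G' v = eval3 id G (N' *v v)" for v
    unfolding G'_def eval3_linear_substitution[OF ri] map_mat_id ..
  have "eval3 id G' (pt L' t) = 0" for t
    unfolding evG' pt[OF gh'(3)] evG by (simp add: mult.commute)
  then have van: "\<forall>u\<in>range (pt L'). eval3 id G' u = 0" by blast
  \<comment> \<open>Closures contain only nonzero vectors, so parameters at which \<open>h\<close>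
    vanishes are avoided; there the power of z in \<open>G\<close> could not be cancelled
    either.\<close>
  have "poly (H g * H h' - H h * H g') t = 0" if t: "poly (H h) t \<noteq> 0" for t
  proof -
    have "pt L t \<noteq> 0"
    proof
      assume "pt L t = 0"
      then have "(vector [- poly (H h) t, poly (H h) t * t, poly (H g) t] :: 'k alg_closure ^ 3) $ 1 = 0"
        using pt[OF gh(3), of t] by simp
      then show False using t by simp
    qed
    then have "pt L t \<in> parameterized_curve L"
      unfolding parameterized_curve_def zariski_closure_def pt_def by auto
    then have "pt L t \<in> parameterized_curve L'" using eq by simp
    then have "eval3 id G' (pt L t) = 0"
      using fG van unfolding parameterized_curve_def zariski_closure_def pt_def by blast
    then show ?thesis using t unfolding evG' pt[OF gh(3)] evG by simp
  qed
  then have "{t. poly (H g * H h' - H h * H g') t = 0} \<union> {t. poly (H h) t = 0} = UNIV" by blast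
  then have "infinite {t. poly (H g * H h' - H h * H g') t = 0}"
    using infinite_UNIV_alg_closed_field[where 'a = "'k alg_closure"] poly_roots_finite[OF H0[OF gh(1)]]
    by (metis finite_UnI)
  then have "H g * H h' - H h * H g' = 0" using poly_roots_finite by blast
  then have "H (g * h' - h * g') = 0" by (simp only: ring_morphism_simps[OF rH])
  then have "g * h' - h * g' = 0" using H0[of "g * h' - h * g'"] by blast
  then have "g * h' = h * g'" by simp
  then have "to_fract g * to_fract h' = to_fract h * to_fract g'"
    unfolding ring_morphism_mult[OF ring_morphism_to_fract, symmetric] by simp
  then have "(to_fract h * to_fract h') * \<mu> = (to_fract h * to_fract h') * \<mu>'"
    unfolding gh(2)[symmetric] gh'(2)[symmetric] by (simp add: mult_ac)
  then show ?thesis using gh(1) gh'(1) by simp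
qed

theorem infinitely_many_curves:
  "\<exists>(L :: nat \<Rightarrow> 'k poly ^ 3) (P :: nat \<Rightarrow> 'k radical ^ 3).
    (\<forall>n. rational_parameterization (L n) \<and> even_intersection F (L n) \<and>
         pseudo_parameterization F (P n) \<and> gives_rise_to F (L n) (P n)) \<and>
    inj (\<lambda>n. parameterized_curve (L n)) \<and>
    (\<forall>m n. m \<noteq> n \<longrightarrow> \<not> equivalent_pseudo (P m) (P n))"
proof -
  have "infinite {\<mu>. is_section \<mu>}"
    using infinitely_many_sections unfolding is_section_def .
  then obtain f :: "nat \<Rightarrow> 'k poly fract" where f: "inj f" "range f \<subseteq> {\<mu>. is_section \<mu>}"
    using infinite_countable_subset by blast
  then have sec: "is_section (f n)" for n by blast
  have "\<exists>L P. line_of_section (f n) L \<and> point_of_section (f n) P \<and> rational_parameterization L \<and>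
      even_intersection F L \<and> pseudo_parameterization F P \<and> gives_rise_to F L P" for n
  proof -
    obtain L where L: "line_of_section (f n) L" using line_of_section_exists by blast
    obtain P where P: "point_of_section (f n) P" "\<exists>R s. s ^ 3 = to_ac R \<and> (\<forall>i. P $ i \<in> rational_fractions s)"
      "gives_rise_to F L P"
      using section_points[OF sec[of n]] L by metis
    show ?thesis
      using L P rational_parameterization_line[OF L] even_intersection_line[OF sec L]
        pseudo_parameterization_of_section[OF sec P(1,2)] by blast
  qed
  then obtain L P where LP: "\<And>n. line_of_section (f n) (L n)" "\<And>n. point_of_section (f n) (P n)"
    "\<And>n. rational_parameterization (L n) \<and> even_intersection F (L n) \<and>
         pseudo_parameterization F (P n) \<and> gives_rise_to F (L n) (P n)"
    by metis
  have "inj (\<lambda>n. parameterized_curve (L n))"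
    by (rule injI) (use parameterized_curve_eq_imp[OF LP(1) LP(1)] f(1) in \<open>auto dest: injD\<close>)
  moreover have "\<not> equivalent_pseudo (P m) (P n)" if "m \<noteq> n" for m n
    using equivalent_sections_eq[OF sec LP(2) LP(2)] f(1) that by (auto dest: injD)
  ultimately show ?thesis using LP(3) by blast
qed

end

theorem mainTheorem1:
  fixes F :: "'k::field poly3"
  assumes "CHAR('k) \<noteq> 2" and "CHAR('k) \<noteq> 3"
    and "smooth_cubic F"
    and "\<exists>v. flex F v"
    and "modular_invariant F \<noteq> 0"
  shows "\<exists>(L :: nat \<Rightarrow> 'k poly ^ 3) (P :: nat \<Rightarrow> 'k radical ^ 3).
    (\<forall>n. rational_parameterization (L n) \<and> even_intersection F (L n) \<and>
         pseudo_parameterization F (P n) \<and> gives_rise_to F (L n) (P n)) \<and>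
    inj (\<lambda>n. parameterized_curve (L n)) \<and>
    (\<forall>m n. m \<noteq> n \<longrightarrow> \<not> equivalent_pseudo (P m) (P n))"
proof -
  have n: "of_nat p \<noteq> (0 :: 'k)" if "Factorial_Ring.prime p" "CHAR('k) \<noteq> p" for p
  proof
    assume "of_nat p = (0 :: 'k)"
    then have "CHAR('k) dvd p" by (simp add: of_nat_eq_0_iff_char_dvd)
    then have "CHAR('k) = 1 \<or> CHAR('k) = p" using that(1) unfolding prime_nat_iff by blast
    then show False using that(2) CHAR_not_1' by auto
  qed
  have two: "(2::'k) \<noteq> 0" and three: "(3::'k) \<noteq> 0"
    using n[of 2] n[of 3] assms(1,2) by simp_all
  obtain v where v: "flex F v" using assms(4) by blast
  obtain a b where ab: "weierstrass_model F a b" "a \<noteq> 0" "4 * a ^ 3 + 27 * b\<^sup>2 \<noteq> 0"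
    by (rule modular_invariant_nonzero[OF two three assms(3) v assms(5)])
  obtain M c where M: "invertible M" "c \<noteq> 0" "linear_substitution M F = const3 c * weierstrass_form a b"
    using ab(1) unfolding weierstrass_model_def by blast
  interpret weierstrass_cubic F M c a b
    by unfold_locales (use two three assms(3) M ab in auto)
  show ?thesis by (rule infinitely_many_curves)
qed

end
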